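(* Let $\mathcal{A}\subset\mathbb{P}^n$ be an arrangement of $d$ hyperplanes. Denote by $S_0(\mathcal{A})=\{P\in S(\mathcal{A})\mid t_P\ge3\}$ the set of codimension two subspaces in $S(\mathcal{A})$ that are contained in at least three distinct hyperplanes of $\mathcal{A}$. Assume that no hyperplane in $\mathcal{A}$ contains two or more elements of $S_0(\mathcal{A})$ (that is, $\mathcal{A}$ is a union of disconnected pencils). Denote by $s$ the number of hyperplanes of $\mathcal{A}$ that do not contain any $P\in S_0(\mathcal{A})$. Then the graded minimal free resolution of $\mathrm{Jac}(f_{\mathcal{A}})^{top}$ has the form $$0\to S^{|S_0(\mathcal{A})|+s-1}(-d)\oplus\bigoplus_{P\in S_0(\mathcal{A})}S(-d-t_P+2)\to S^{2|S_0(\mathcal{A})|+s}(-d+1)\to\mathrm{Jac}(f_{\mathcal{A}})^{top}\to0.$$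
   Context: $K$ is a field of characteristic zero, $n\ge2$, $S=K[x_0,\dots,x_n]$ with the standard grading. A hyperplane arrangement $\mathcal{A}\subset\mathbb{P}^n$ is a finite nonempty set of distinct hyperplanes, and $f_{\mathcal{A}}$ is the product of linear forms defining them; $\mathrm{Jac}(f_{\mathcal{A}})$ is the ideal generated by its first partial derivatives. $\mathrm{Jac}(f_{\mathcal{A}})^{top}$ is the intersection of the primary components of height $2$ in a primary decomposition of $\mathrm{Jac}(f_{\mathcal{A}})$ (well defined). $S(\mathcal{A})=\{H\cap H':H\neq H'\in\mathcal{A}\}$, and for $P\in S(\mathcal{A})$, $t_P$ is the number of hyperplanes of $\mathcal{A}$ containing $P$. *)

theory Defs
  imports
    "HOL-Analysis.Cartesian_Space"
    "HOL-Library.Poly_Mapping"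
    "HOL-Library.Extended_Nat"
    "HOL-Algebra.Algebraic_Closure_Type"
begin

section \<open>The standard graded polynomial ring\<close>

text \<open>Finitely supported functions with the convolution product: the polynomial ring over
  \<open>'k\<close> whose variables are the elements of the finite type \<open>'x\<close>.  For \<open>x\<^sub>0, \<dots>, x\<^sub>n\<close>
  the type \<open>'x\<close> has \<open>n + 1\<close> elements.\<close>

type_synonym ('x, 'k) mpoly = "('x \<Rightarrow>\<^sub>0 nat) \<Rightarrow>\<^sub>0 'k"

abbreviation mpoly_ring :: "('x::finite, 'k::field) mpoly ring" where
  "mpoly_ring \<equiv> ring_of_type_algebra"

definition indeterminate :: "'x::finite \<Rightarrow> ('x, 'k::field) mpoly" where
  "indeterminate x = Poly_Mapping.single (Poly_Mapping.single x 1) 1"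

text \<open>Degrees are integers, so that twisting needs no case distinction; only \<open>0\<close> is homogeneous
  of a negative degree.\<close>

definition homogeneous :: "int \<Rightarrow> ('x::finite, 'k::field) mpoly \<Rightarrow> bool" where
  "homogeneous e p \<longleftrightarrow>
     (\<forall>m \<in> Poly_Mapping.keys p. int (\<Sum>x\<in>UNIV. Poly_Mapping.lookup m x) = e)"

definition partial_deriv :: "'x::finite \<Rightarrow> ('x, 'k::field) mpoly \<Rightarrow> ('x, 'k) mpoly" where
  "partial_deriv x p =
     (\<Sum>m \<in> Poly_Mapping.keys p.
        Poly_Mapping.single (m - Poly_Mapping.single x 1)
          (of_nat (Poly_Mapping.lookup m x) * Poly_Mapping.lookup p m))"

definition jacobian_ideal :: "('x::finite, 'k::field) mpoly \<Rightarrow> ('x, 'k) mpoly set" where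
  "jacobian_ideal f = Idl\<^bsub>mpoly_ring\<^esub> (range (\<lambda>x. partial_deriv x f))"


section \<open>Primary decomposition and height\<close>

locale primaryideal = ideal + cring +
  assumes I_notcarr: "carrier R \<noteq> I"
    and I_primary: "\<lbrakk>a \<in> carrier R; b \<in> carrier R; a \<otimes> b \<in> I\<rbrakk>
      \<Longrightarrow> a \<in> I \<or> (\<exists>k::nat. b [^] k \<in> I)"

text \<open>No irredundancy is required.  The intersection with \<open>carrier R\<close> lets the empty family
  decompose the unit ideal.\<close>

definition primary_decomposition :: "('a, 'm) ring_scheme \<Rightarrow> 'a set \<Rightarrow> 'a set set \<Rightarrow> bool" where
  "primary_decomposition R I \<Q> \<longleftrightarrow>
     finite \<Q> \<and> (\<forall>Q\<in>\<Q>. primaryideal Q R) \<and> I = carrier R \<inter> \<Inter>\<Q>"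

definition prime_height :: "('a, 'm) ring_scheme \<Rightarrow> 'a set \<Rightarrow> enat" where
  "prime_height R P =
     Sup {enat r | r. \<exists>C :: nat \<Rightarrow> 'a set.
            (\<forall>i\<le>r. primeideal (C i) R) \<and> (\<forall>i<r. C i \<subset> C (Suc i)) \<and> C r = P}"

definition ideal_height :: "('a, 'm) ring_scheme \<Rightarrow> 'a set \<Rightarrow> enat" where
  "ideal_height R I = Inf {prime_height R P | P. primeideal P R \<and> I \<subseteq> P}"

text \<open>For an ideal \<open>I\<close> of height at least \<open>2\<close>, such as a Jacobian ideal of a squarefree form,
  the result is the same for every primary decomposition \<open>\<Q>\<close> of \<open>I\<close>, irredundant or not:
  a prime of height \<open>2\<close> containing \<open>I\<close> is then minimal over \<open>I\<close>.\<close>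

definition top_part :: "('a, 'm) ring_scheme \<Rightarrow> 'a set set \<Rightarrow> 'a set" where
  "top_part R \<Q> = carrier R \<inter> \<Inter>{Q \<in> \<Q>. ideal_height R Q = 2}"


section \<open>Graded modules and minimal free resolutions\<close>

text \<open>\<open>grade M e\<close> is the homogeneous component of degree \<open>e\<close>.\<close>

record ('a, 'b) graded_module = "('a, 'b) module" +
  grade :: "int \<Rightarrow> 'b set"

definition graded_hom ::
  "('a, 'r) ring_scheme \<Rightarrow> ('a, 'b) graded_module \<Rightarrow> ('a, 'c) graded_module \<Rightarrow> ('b \<Rightarrow> 'c) set"
  where
  "graded_hom R M N = {\<phi> \<in> hom (add_monoid M) (add_monoid N).
     (\<forall>a \<in> carrier R. \<forall>v \<in> carrier M. \<phi> (a \<odot>\<^bsub>M\<^esub> v) = a \<odot>\<^bsub>N\<^esub> \<phi> v) \<and>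
     (\<forall>e. \<phi> ` grade M e \<subseteq> grade N e)}"

text \<open>The direct sum of the \<open>S(\<tau> b)\<close> over a finite set \<open>B\<close> of indices, where the component of
  degree \<open>e\<close> of \<open>S(\<tau> b)\<close> is the component of degree \<open>\<tau> b + e\<close> of the polynomial ring \<open>S\<close>.
  Tuples are represented by functions vanishing outside \<open>B\<close>.  The ring fields \<open>mult\<close> and
  \<open>one\<close> of a module record play no role.\<close>

definition twisted_free ::
  "'b set \<Rightarrow> ('b \<Rightarrow> int) \<Rightarrow> (('x::finite, 'k::field) mpoly, 'b \<Rightarrow> ('x, 'k) mpoly) graded_module"
  where
  "twisted_free B \<tau> =
     \<lparr>carrier = {v. \<forall>b. b \<notin> B \<longrightarrow> v b = 0},
      monoid.mult = undefined, one = undefined,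
      ring.zero = (\<lambda>_. 0), add = (\<lambda>v w b. v b + w b),
      module.smult = (\<lambda>p v b. p * v b),
      grade = (\<lambda>e. {v. (\<forall>b. b \<notin> B \<longrightarrow> v b = 0) \<and> (\<forall>b\<in>B. homogeneous (\<tau> b + e) (v b))})\<rparr>"

definition ideal_module ::
  "('x::finite, 'k::field) mpoly set \<Rightarrow> (('x, 'k) mpoly, ('x, 'k) mpoly) graded_module" where
  "ideal_module I =
     \<lparr>carrier = I, monoid.mult = (*), one = 1, ring.zero = 0, add = (+), module.smult = (*),
      grade = (\<lambda>e. {p \<in> I. homogeneous e p})\<rparr>"

text \<open>\<open>0 \<rightarrow> F\<^sub>1 \<rightarrow> F\<^sub>0 \<rightarrow> M \<rightarrow> 0\<close> is exact with \<open>F\<^sub>i = \<Oplus>\<^sub>b S(\<tau>\<^sub>i b)\<close>, and \<open>\<phi>\<close> maps \<open>F\<^sub>1\<close> into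
  \<open>\<mm> F\<^sub>0\<close>, where \<open>\<mm>\<close> is the ideal generated by the variables.\<close>

definition minimal_graded_free_resolution ::
  "'b set \<Rightarrow> ('b \<Rightarrow> int) \<Rightarrow> 'c set \<Rightarrow> ('c \<Rightarrow> int) \<Rightarrow> (('x::finite, 'k::field) mpoly, 'm) graded_module
    \<Rightarrow> (('b \<Rightarrow> ('x, 'k) mpoly) \<Rightarrow> ('c \<Rightarrow> ('x, 'k) mpoly)) \<Rightarrow> (('c \<Rightarrow> ('x, 'k) mpoly) \<Rightarrow> 'm) \<Rightarrow> bool"
  where
  "minimal_graded_free_resolution B\<^sub>1 \<tau>\<^sub>1 B\<^sub>0 \<tau>\<^sub>0 M \<phi> \<epsilon> \<longleftrightarrow>
     (let F\<^sub>1 = twisted_free B\<^sub>1 \<tau>\<^sub>1; F\<^sub>0 = twisted_free B\<^sub>0 \<tau>\<^sub>0 in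
       finite B\<^sub>1 \<and> finite B\<^sub>0 \<and>
       \<phi> \<in> graded_hom mpoly_ring F\<^sub>1 F\<^sub>0 \<and>
       \<epsilon> \<in> graded_hom mpoly_ring F\<^sub>0 M \<and>
       inj_on \<phi> (carrier F\<^sub>1) \<and>
       \<phi> ` carrier F\<^sub>1 = a_kernel F\<^sub>0 M \<epsilon> \<and>
       \<epsilon> ` carrier F\<^sub>0 = carrier M \<and>
       (\<forall>v \<in> carrier F\<^sub>1. \<forall>b\<in>B\<^sub>0. \<phi> v b \<in> Idl\<^bsub>mpoly_ring\<^esub> (range indeterminate)))"


section \<open>Hyperplane arrangements\<close>

text \<open>A point of projective space is a line through the origin in affine space.\<close>

definition projective_space :: "('k::field ^ 'x::finite) set set" where
  "projective_space = {vec.span {v} | v. v \<noteq> 0}"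

definition linear_form :: "'k::field ^ 'x::finite \<Rightarrow> ('x, 'k) mpoly" where
  "linear_form a = (\<Sum>x\<in>UNIV. Poly_Mapping.single (Poly_Mapping.single x 1) (a $ x))"

text \<open>The zero locus of \<open>linear_form a\<close>.\<close>

definition projective_hyperplane :: "'k::field ^ 'x::finite \<Rightarrow> ('k ^ 'x) set set" where
  "projective_hyperplane a =
     {p \<in> projective_space. \<forall>v\<in>p. (\<Sum>x\<in>UNIV. a $ x * v $ x) = 0}"

definition arrangement :: "('k::field ^ 'x::finite) set set set \<Rightarrow> bool" where
  "arrangement \<A> \<longleftrightarrow>
     finite \<A> \<and> \<A> \<noteq> {} \<and> (\<forall>H\<in>\<A>. \<exists>a. a \<noteq> 0 \<and> H = projective_hyperplane a)"

text \<open>A choice of a linear form for each hyperplane; it is unique up to nonzero scalars.\<close>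

definition defining_forms ::
  "('k::field ^ 'x::finite) set set set \<Rightarrow> (('k ^ 'x) set set \<Rightarrow> 'k ^ 'x) \<Rightarrow> bool" where
  "defining_forms \<A> a \<longleftrightarrow> (\<forall>H\<in>\<A>. a H \<noteq> 0 \<and> H = projective_hyperplane (a H))"

definition defining_polynomial ::
  "('k::field ^ 'x::finite) set set set \<Rightarrow> (('k ^ 'x) set set \<Rightarrow> 'k ^ 'x) \<Rightarrow> ('x, 'k) mpoly" where
  "defining_polynomial \<A> a = (\<Prod>H\<in>\<A>. linear_form (a H))"

definition intersections :: "'p set set \<Rightarrow> 'p set set" where
  "intersections \<A> = {H \<inter> H' | H H'. H \<in> \<A> \<and> H' \<in> \<A> \<and> H \<noteq> H'}"

definition multiplicity_at :: "'p set set \<Rightarrow> 'p set \<Rightarrow> nat" where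
  "multiplicity_at \<A> P = card {H \<in> \<A>. P \<subseteq> H}"

definition multiple_intersections :: "'p set set \<Rightarrow> 'p set set" where
  "multiple_intersections \<A> = {P \<in> intersections \<A>. multiplicity_at \<A> P \<ge> 3}"

end

(*
  Write b for a block of hyperplanes (a pencil of at least three hyperplanes through one P, or a
  single hyperplane containing no such P), g_b for the product of its forms, F_b = f / g_b, and J_b for
  the Jacobian ideal of g_b, which is generated by two derivatives G_b, G'_b (by a constant G_b for
  a single hyperplane).  Localising at the primes (l_H, l_K), the only ones of height two above
  Jac(f), identifies Jac(f)^top with the intersection of the ideals J_b of the pencils and of the
  (l_H, l_K) with H, K in different blocks.  An element p of this intersection lies in J_b F_b + (g_b)
  for each b, and subtracting the J_b F_b parts leaves a multiple of f; hence the top part is the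
  sum of the J_b F_b.  Euler's formula u_b G_b + v_b G'_b = g_b puts f in every summand.  Comparing
  these expressions of f gives the syzygies of degree d, and the Koszul relations between G_b and
  G'_b give the remaining ones: a general syzygy reduces modulo g_b to a multiple of the Euler
  expression, up to a Koszul relation.
*)
theory Submission
  imports Defs
begin

section \<open>Constants and monomials\<close>

text \<open>Two notions have to be made concrete: height and localisation. \<open>top_part\<close>
  refers to chains of primes, so the height of (l_H, l_K) must be bounded from above; this is done
  by viewing S as B[y] for a linear form y and dividing with remainder. Localisation is expressed by
  multipliers: p lies in an ideal near a prime if h p lies in the ideal for some h outside the
  prime, and \<open>saturated\<close> permits cancelling such an h. For J_b this cancellation is the
  unmixedness of a complete intersection, and it comes from a choice of generators. If w lies on
  none of the hyperplanes, the derivative G of g_b along w has no factor in common with g_b, so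
  (g_b, G) can be broken up along the factors of g_b until only the prime (l_H, l_K) is left;
  Euler's formula carries the result over to (G, G'). Characteristic zero enters in two ways: the
  field is infinite, so w exists, and Euler's formula can be divided by the degree. The rank |S_0| +
  s - 1 is the number of blocks minus one: a relation among the generators determines a multiple of
  f for each block, and these multiples sum to zero.\<close>

abbreviation const :: "'k \<Rightarrow> ('x::finite, 'k::field) mpoly" where
  "const \<equiv> Poly_Mapping.single 0"

lemma const_add: "const (c + d) = const c + const d"
  by (rule single_add)

lemma const_mult: "const (c * d) = const c * const d"
  by (simp add: mult_single)

lemma const_sum: "const (sum f A) = (\<Sum>i\<in>A. const (f i))"
  by (induction A rule: infinite_finite_induct) (auto simp: const_add)

lemma const_eq_0_iff [simp]: "const c = 0 \<longleftrightarrow> c = 0"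
  by (metis lookup_single_eq lookup_zero single_zero)

lemma const_mult_inverse: "c \<noteq> 0 \<Longrightarrow> const c * const (inverse c) = 1"
  by (simp flip: const_mult)

lemma indeterminate_power: "indeterminate x ^ k = Poly_Mapping.single (Poly_Mapping.single x k) 1"
  by (induction k) (simp_all add: indeterminate_def mult_single single_add[symmetric])

lemma prod_single_one:
  "finite A \<Longrightarrow> (\<Prod>x\<in>A. Poly_Mapping.single (m x) (1::'k::field)) = Poly_Mapping.single (\<Sum>x\<in>A. m x :: 'x \<Rightarrow>\<^sub>0 nat) 1"
  by (induction A rule: finite_induct) (auto simp: mult_single)

lemma monomial_eq_sum_single:
  "(\<Sum>x\<in>UNIV. Poly_Mapping.single x (Poly_Mapping.lookup m x)) = (m :: 'x::finite \<Rightarrow>\<^sub>0 nat)"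
  by (rule poly_mapping_eqI) (simp add: lookup_sum lookup_single when_def)

lemma single_eq_prod:
  "Poly_Mapping.single m c = const c * (\<Prod>x\<in>UNIV. indeterminate x ^ Poly_Mapping.lookup m x)"
proof -
  have "(\<Prod>x\<in>UNIV. indeterminate x ^ Poly_Mapping.lookup m x) = (Poly_Mapping.single m 1 :: ('a, 'b) mpoly)"
    by (simp add: indeterminate_power prod_single_one monomial_eq_sum_single)
  then show ?thesis by (simp add: mult_single)
qed

lemma mpoly_single_induct [case_names single add]:
  assumes "\<And>m c. P (Poly_Mapping.single m c)"
    and "\<And>p q. P p \<Longrightarrow> P q \<Longrightarrow> P (p + q)"
  shows "P (p :: ('x::finite, 'k::field) mpoly)"
proof (induction p rule: update_induct)
  case const
  then show ?case using assms(1)[of 0 0] by simp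
next
  case (update f a b)
  then have "Poly_Mapping.update a b f = f + Poly_Mapping.single a b"
    by (intro poly_mapping_eqI) (auto simp: lookup_update lookup_add lookup_single in_keys_iff when_def)
  then show ?case using update assms by simp
qed

lemma mpoly_induct [case_names const indeterminate add mult]:
  assumes "\<And>c. P (const c)" "\<And>x. P (indeterminate x)"
    and "\<And>p q. P p \<Longrightarrow> P q \<Longrightarrow> P (p + q)" "\<And>p q. P p \<Longrightarrow> P q \<Longrightarrow> P (p * q)"
  shows "P (p :: ('x::finite, 'k::field) mpoly)"
proof (induction p rule: mpoly_single_induct)
  case (single m c)
  have one: "P 1" using assms(1)[of 1] by simp
  have "P (indeterminate x ^ k)" for x k
    by (induction k) (auto intro: assms one)
  then have "P (\<Prod>x\<in>A. indeterminate x ^ Poly_Mapping.lookup m x)" for A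
    by (induction A rule: infinite_finite_induct) (auto intro: assms one)
  then show ?case unfolding single_eq_prod[of m] by (intro assms)
next
  case (add p q)
  then show ?case by (intro assms)
qed

section \<open>The polynomial ring is a domain\<close>

definition variable_index :: "'x::finite \<Rightarrow> nat" where
  "variable_index = (SOME f. inj f)"

lemma inj_variable_index: "inj variable_index"
  unfolding variable_index_def using finite_imp_inj_to_nat_seg[OF finite[of UNIV]] by (metis someI_ex)

text \<open>\<open>'x\<close> carries no order. Renaming the variables by natural numbers moves
  monomials into \<open>nat \<Rightarrow>\<^sub>0 nat\<close>, whose linear order is compatible with
  addition and serves as a monomial order.\<close>

definition nat_monomial :: "('x::finite \<Rightarrow>\<^sub>0 nat) \<Rightarrow> (nat \<Rightarrow>\<^sub>0 nat)" where
  "nat_monomial m = (\<Sum>x\<in>UNIV. Poly_Mapping.single (variable_index x) (Poly_Mapping.lookup m x))"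

lemma nat_monomial_add: "nat_monomial (m + n) = nat_monomial m + nat_monomial n"
  by (simp add: nat_monomial_def lookup_add single_add sum.distrib)

lemma lookup_nat_monomial:
  "Poly_Mapping.lookup (nat_monomial m) (variable_index x) = Poly_Mapping.lookup m x"
proof -
  have "Poly_Mapping.lookup (nat_monomial m) (variable_index x)
      = (\<Sum>y\<in>UNIV. if y = x then Poly_Mapping.lookup m y else 0)"
    unfolding nat_monomial_def lookup_sum
    by (rule sum.cong) (auto simp: lookup_single when_def inj_eq[OF inj_variable_index])
  then show ?thesis by simp
qed

lemma inj_nat_monomial: "inj nat_monomial"
  by (rule injI, rule poly_mapping_eqI) (metis lookup_nat_monomial)

text \<open>Leading terms multiply: the coefficient of \<open>p * q\<close> at the sum of the
  leading monomials is the product of the leading coefficients.\<close>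

lemma mpoly_mult_eq_0_iff [simp]:
  fixes p q :: "('x::finite, 'k::field) mpoly"
  shows "p * q = 0 \<longleftrightarrow> p = 0 \<or> q = 0"
proof -
  have "p * q \<noteq> 0" if nz: "p \<noteq> 0" "q \<noteq> 0"
  proof -
    let ?N = "nat_monomial :: ('x \<Rightarrow>\<^sub>0 nat) \<Rightarrow> _"
    have lead: "\<exists>m\<in>Poly_Mapping.keys p. \<forall>n\<in>Poly_Mapping.keys p. ?N n \<le> ?N m" if "p \<noteq> 0"
      for p :: "('x, 'k) mpoly"
    proof -
      have "Max (?N ` Poly_Mapping.keys p) \<in> ?N ` Poly_Mapping.keys p"
        using that by (intro Max_in) auto
      then obtain m where "m \<in> Poly_Mapping.keys p" "?N m = Max (?N ` Poly_Mapping.keys p)" by force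
      then show ?thesis by (intro bexI[of _ m]) auto
    qed
    obtain m where m: "m \<in> Poly_Mapping.keys p" "\<And>n. n \<in> Poly_Mapping.keys p \<Longrightarrow> ?N n \<le> ?N m"
      using lead nz by metis
    obtain n where n: "n \<in> Poly_Mapping.keys q" "\<And>k. k \<in> Poly_Mapping.keys q \<Longrightarrow> ?N k \<le> ?N n"
      using lead nz by metis
    \<comment> \<open>Both summands are bounded by the leading monomials, so equal sums force equal
      summands and no other pair contributes to this coefficient.\<close>
    have uniq: "k = m \<and> l = n"
      if "k \<in> Poly_Mapping.keys p" "l \<in> Poly_Mapping.keys q" "m + n = k + l" for k l
    proof -
      have "?N m + ?N n = ?N k + ?N l" using that nat_monomial_add by metis
      then have "?N k = ?N m"
        using m(2)[OF that(1)] n(2)[OF that(2)]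
        by (metis add_le_imp_le_right add_left_mono order_antisym)
      then have "k = m" by (rule injD[OF inj_nat_monomial])
      then show ?thesis using that(3) by simp
    qed
    have "Poly_Mapping.lookup (p * q) (m + n)
        = (\<Sum>k. Poly_Mapping.lookup p k * (\<Sum>l. Poly_Mapping.lookup q l when m + n = k + l))"
      by (rule lookup_mult)
    also have "\<dots> = (\<Sum>k. (Poly_Mapping.lookup p m * Poly_Mapping.lookup q n) when k = m)"
    proof (rule Sum_any.cong)
      fix k
      have "(\<Sum>l. Poly_Mapping.lookup q l when m + n = k + l) = (\<Sum>l. Poly_Mapping.lookup q n when l = n \<and> k = m)"
        if "k \<in> Poly_Mapping.keys p"
        by (rule Sum_any.cong) (use uniq[OF that] in \<open>auto simp: when_def in_keys_iff\<close>)
      also have "(\<Sum>l. Poly_Mapping.lookup q n when l = n \<and> k = m) = (Poly_Mapping.lookup q n when k = m)"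
        by (simp add: when_def)
      finally show "Poly_Mapping.lookup p k * (\<Sum>l. Poly_Mapping.lookup q l when m + n = k + l)
          = (Poly_Mapping.lookup p m * Poly_Mapping.lookup q n when k = m)"
        using m(1) by (cases "k \<in> Poly_Mapping.keys p") (auto simp: when_def in_keys_iff)
    qed
    also have "\<dots> = Poly_Mapping.lookup p m * Poly_Mapping.lookup q n" by simp
    also have "\<dots> \<noteq> 0" using m n by (simp add: in_keys_iff)
    finally show ?thesis by force
  qed
  then show ?thesis by auto
qed

lemma mpoly_mult_left_cancel:
  fixes p q r :: "('x::finite, 'k::field) mpoly"
  assumes "p * q = p * r" "p \<noteq> 0"
  shows "q = r"
proof -
  have "p * (q - r) = 0" unfolding right_diff_distrib assms(1) by (rule diff_self)
  then have "q - r = 0" using assms(2) mpoly_mult_eq_0_iff by blast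
  then show ?thesis by (simp only: right_minus_eq)
qed

lemma mpoly_prod_eq_0_iff:
  fixes p :: "'i \<Rightarrow> ('x::finite, 'k::field) mpoly"
  assumes "finite A"
  shows "prod p A = 0 \<longleftrightarrow> (\<exists>i\<in>A. p i = 0)"
  using assms by (induction A rule: finite_induct) auto

lemma mpoly_power_eq_0:
  fixes p :: "('x::finite, 'k::field) mpoly"
  shows "p ^ k = 0 \<Longrightarrow> p = 0"
  by (induction k) auto

section \<open>Substitution\<close>

definition subst :: "('x \<Rightarrow> ('x, 'k) mpoly) \<Rightarrow> ('x::finite, 'k::field) mpoly \<Rightarrow> ('x, 'k) mpoly" where
  "subst s p = (\<Sum>m\<in>Poly_Mapping.keys p.
     const (Poly_Mapping.lookup p m) * (\<Prod>x\<in>UNIV. s x ^ Poly_Mapping.lookup m x))"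

lemma subst_single:
  "subst s (Poly_Mapping.single m c) = const c * (\<Prod>x\<in>UNIV. s x ^ Poly_Mapping.lookup m x)"
  by (cases "c = 0") (auto simp: subst_def)

lemma subst_const [simp]: "subst s (const c) = const c"
  by (simp add: subst_single)

lemma subst_0 [simp]: "subst s 0 = 0" and subst_1 [simp]: "subst s 1 = 1"
  using subst_const[of s 0] subst_const[of s 1] by simp_all

lemma subst_add [simp]: "subst s (p + q) = subst s p + subst s q"
  unfolding subst_def
  by (rule setsum_keys_plus_distrib) (auto simp: const_add algebra_simps)

lemma subst_uminus [simp]: "subst s (- p) = - subst s p"
  using subst_add[of s p "- p"] by (simp add: eq_neg_iff_add_eq_0 add.commute)

lemma subst_diff [simp]: "subst s (p - q) = subst s p - subst s q"
  using subst_add[of s p "- q"] by simp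

lemma subst_mult [simp]: "subst s (p * q) = subst s p * subst s q"
proof (induction p rule: mpoly_single_induct)
  case (single m c)
  show ?case
  proof (induction q rule: mpoly_single_induct)
    case (single n d)
    show ?case
      unfolding mult_single[of m c n d]
      by (simp add: subst_single lookup_add power_add prod.distrib const_mult mult_ac)
  next
    case (add p q)
    then show ?case by (simp add: algebra_simps)
  qed
next
  case (add p q)
  then show ?case by (simp add: algebra_simps)
qed

lemma subst_indeterminate [simp]: "subst s (indeterminate x) = s x"
proof -
  have "subst s (indeterminate x) = (\<Prod>y\<in>UNIV. s y ^ (1 when x = y))"
    unfolding indeterminate_def subst_single lookup_single by simp
  also have "\<dots> = (\<Prod>y\<in>{x}. s y)"
    by (rule prod.mono_neutral_cong_right) (auto simp: when_def)
  finally show ?thesis by simp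
qed

lemma subst_sum [simp]: "subst s (sum p A) = (\<Sum>i\<in>A. subst s (p i))"
  by (induction A rule: infinite_finite_induct) auto

lemma subst_prod [simp]: "subst s (prod p A) = (\<Prod>i\<in>A. subst s (p i))"
  by (induction A rule: infinite_finite_induct) auto

lemma subst_power [simp]: "subst s (p ^ k) = subst s p ^ k"
  by (induction k) auto

section \<open>Linear forms and the ideals they generate\<close>

definition pairing :: "'k::field ^ 'x::finite \<Rightarrow> 'k ^ 'x \<Rightarrow> 'k" where
  "pairing a v = (\<Sum>x\<in>UNIV. a $ x * v $ x)"

lemma pairing_add_right: "pairing a (v + w) = pairing a v + pairing a w"
  by (simp add: pairing_def algebra_simps sum.distrib)

lemma pairing_smult_right: "pairing a (c *s v) = c * pairing a v"
  by (simp add: pairing_def sum_distrib_left mult_ac)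

lemma pairing_add_left: "pairing (a + b) v = pairing a v + pairing b v"
  by (simp add: pairing_def algebra_simps sum.distrib)

lemma pairing_smult_left: "pairing (c *s a) v = c * pairing a v"
  by (simp add: pairing_def sum_distrib_left mult_ac)

lemma pairing_axis: "pairing a (axis x 1) = a $ x"
proof -
  have "pairing a (axis x 1) = (\<Sum>y\<in>UNIV. if y = x then a $ y else 0)"
    unfolding pairing_def axis_def by (rule sum.cong) auto
  then show ?thesis by simp
qed

lemma linear_form_eq: "linear_form a = (\<Sum>x\<in>UNIV. const (a $ x) * indeterminate x)"
  by (simp add: linear_form_def indeterminate_def mult_single)

lemma linear_form_add: "linear_form (a + b) = linear_form a + linear_form b"
  by (simp add: linear_form_eq const_add algebra_simps sum.distrib)

lemma linear_form_smult: "linear_form (c *s a) = const c * linear_form a"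
  by (simp add: linear_form_eq const_mult sum_distrib_left mult_ac)

lemma linear_form_diff: "linear_form (a - b) = linear_form a - linear_form b"
  using linear_form_add[of "a - b" b] by simp

lemma lookup_linear_form: "Poly_Mapping.lookup (linear_form a) (Poly_Mapping.single x 1) = a $ x"
proof -
  have "Poly_Mapping.single y (1::nat) = Poly_Mapping.single x 1 \<longleftrightarrow> y = x" for y
    by (metis lookup_single_eq lookup_single_not_eq zero_neq_one)
  then have "Poly_Mapping.lookup (linear_form a) (Poly_Mapping.single x 1) = (\<Sum>y\<in>UNIV. if y = x then a $ y else 0)"
    unfolding linear_form_def lookup_sum by (intro sum.cong) (auto simp: lookup_single when_def)
  then show ?thesis by simp
qed

lemma linear_form_eq_0_iff: "linear_form a = 0 \<longleftrightarrow> a = 0"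
proof
  assume "linear_form a = 0"
  then have "a $ x = 0" for x using lookup_linear_form[of a x] by simp
  then show "a = 0" by (simp add: vec_eq_iff)
qed (simp add: linear_form_def)

text \<open>For \<open>pairing u e = 1\<close> this is pullback along the projection \<open>v \<mapsto> v - u(v) e\<close> onto the
  hyperplane \<open>u = 0\<close>.\<close>

definition restrict_hyp :: "'k::field ^ 'x::finite \<Rightarrow> 'k ^ 'x \<Rightarrow> ('x, 'k) mpoly \<Rightarrow> ('x, 'k) mpoly" where
  "restrict_hyp u e = subst (\<lambda>x. indeterminate x - const (e $ x) * linear_form u)"

lemma restrict_hyp_simps [simp]:
  "restrict_hyp u e (const c) = const c"
  "restrict_hyp u e 0 = 0" "restrict_hyp u e 1 = 1"
  "restrict_hyp u e (p + q) = restrict_hyp u e p + restrict_hyp u e q"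
  "restrict_hyp u e (p - q) = restrict_hyp u e p - restrict_hyp u e q"
  "restrict_hyp u e (p * q) = restrict_hyp u e p * restrict_hyp u e q"
  "restrict_hyp u e (p ^ k) = restrict_hyp u e p ^ k"
  "restrict_hyp u e (prod f A) = (\<Prod>i\<in>A. restrict_hyp u e (f i))"
  "restrict_hyp u e (- p) = - restrict_hyp u e p"
  "restrict_hyp u e (indeterminate x) = indeterminate x - const (e $ x) * linear_form u"
  by (simp_all add: restrict_hyp_def)

lemma restrict_hyp_linear_form:
  "restrict_hyp u e (linear_form a) = linear_form a - const (pairing a e) * linear_form u"
proof -
  have "restrict_hyp u e (linear_form a)
      = (\<Sum>x\<in>UNIV. const (a $ x) * (indeterminate x - const (e $ x) * linear_form u))"
    by (simp add: restrict_hyp_def linear_form_eq[of a])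
  also have "\<dots> = linear_form a - const (pairing a e) * linear_form u"
    by (simp add: linear_form_eq[of a] pairing_def const_sum const_mult algebra_simps
        sum_subtractf sum_distrib_left sum_distrib_right)
  finally show ?thesis .
qed

text \<open>The identity and the restriction are algebra maps that agree on the variables modulo
  \<open>linear_form u\<close>.\<close>

lemma linear_form_dvd_diff_restrict_hyp: "linear_form u dvd p - restrict_hyp u e p"
proof (induction p rule: mpoly_induct)
  case (add p q)
  have "p + q - restrict_hyp u e (p + q) = (p - restrict_hyp u e p) + (q - restrict_hyp u e q)" by simp
  then show ?case using add by (metis dvd_add)
next
  case (mult p q)
  have "p * q - restrict_hyp u e (p * q)
      = (p - restrict_hyp u e p) * q + restrict_hyp u e p * (q - restrict_hyp u e q)"
    by (simp add: algebra_simps)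
  then show ?case using mult by (metis dvd_add dvd_mult dvd_mult2)
qed auto

text \<open>Divisibility becomes the vanishing of a homomorphism into a domain, which makes
  primality of linear forms immediate and replaces unique factorisation throughout.\<close>

lemma linear_form_dvd_iff:
  assumes "pairing u e = 1"
  shows "linear_form u dvd p \<longleftrightarrow> restrict_hyp u e p = 0"
proof
  assume "linear_form u dvd p"
  then obtain q where "p = linear_form u * q" by (elim dvdE)
  then show "restrict_hyp u e p = 0" by (simp add: restrict_hyp_linear_form assms)
next
  assume "restrict_hyp u e p = 0"
  then show "linear_form u dvd p" using linear_form_dvd_diff_restrict_hyp[of u p e] by simp
qed

lemma restrict_hyp_idem:
  assumes "pairing u e = 1"
  shows "restrict_hyp u e (restrict_hyp u e p) = restrict_hyp u e p"
proof -
  have "restrict_hyp u e (p - restrict_hyp u e p) = 0"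
    using linear_form_dvd_iff[OF assms] linear_form_dvd_diff_restrict_hyp by blast
  then show ?thesis by simp
qed

lemma ex_pairing_eq_1:
  assumes "u \<noteq> 0"
  shows "\<exists>e. pairing u e = 1"
proof -
  obtain x where "u $ x \<noteq> 0" using assms by (auto simp: vec_eq_iff)
  then have "pairing u (inverse (u $ x) *s axis x 1) = 1"
    by (simp add: pairing_smult_right pairing_axis)
  then show ?thesis by blast
qed

lemma linear_form_prime:
  assumes "linear_form u dvd p * q" "u \<noteq> 0"
  shows "linear_form u dvd p \<or> linear_form u dvd q"
proof -
  obtain e where e: "pairing u e = 1" using ex_pairing_eq_1 assms(2) by blast
  show ?thesis using assms(1) by (simp add: linear_form_dvd_iff[OF e])
qed

lemma linear_form_prime_prod:
  assumes "linear_form u dvd prod p A" "u \<noteq> 0" "finite A"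
  shows "\<exists>i\<in>A. linear_form u dvd p i"
proof -
  obtain e where e: "pairing u e = 1" using ex_pairing_eq_1 assms(2) by blast
  show ?thesis using assms(1,3) by (simp add: linear_form_dvd_iff[OF e] mpoly_prod_eq_0_iff)
qed

definition ideal2 :: "('x::finite, 'k::field) mpoly \<Rightarrow> ('x, 'k) mpoly \<Rightarrow> ('x, 'k) mpoly set" where
  "ideal2 p q = {r * p + s * q | r s. True}"

lemma ideal2I: "r * p + s * q \<in> ideal2 p q"
  by (auto simp: ideal2_def)

lemma ideal2E:
  assumes "z \<in> ideal2 p q"
  obtains r s where "z = r * p + s * q"
  using assms by (auto simp: ideal2_def)

lemma gens_in_ideal2 [simp]: "p \<in> ideal2 p q" "q \<in> ideal2 p q"
  using ideal2I[of 1 p 0 q] ideal2I[of 0 p 1 q] by simp_all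

lemma ideal2_0 [simp]: "0 \<in> ideal2 p q"
  using ideal2I[of 0 p 0 q] by simp

lemma ideal2_add:
  assumes "y \<in> ideal2 p q" "z \<in> ideal2 p q"
  shows "y + z \<in> ideal2 p q"
proof -
  obtain r s r' s' where "y = r * p + s * q" "z = r' * p + s' * q"
    using assms by (auto elim!: ideal2E)
  then have "y + z = (r + r') * p + (s + s') * q" by (simp add: algebra_simps)
  then show ?thesis by (simp only: ideal2I)
qed

lemma ideal2_mult:
  assumes "z \<in> ideal2 p q"
  shows "y * z \<in> ideal2 p q"
proof -
  obtain r s where "z = r * p + s * q" using assms by (rule ideal2E)
  then have "y * z = (y * r) * p + (y * s) * q" by (simp add: algebra_simps)
  then show ?thesis by (simp only: ideal2I)
qed

lemma ideal2_mult2: "z \<in> ideal2 p q \<Longrightarrow> z * y \<in> ideal2 p q"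
  by (subst mult.commute) (rule ideal2_mult)

lemma ideal2_uminus: "z \<in> ideal2 p q \<Longrightarrow> - z \<in> ideal2 p q"
  using ideal2_mult[of z p q "-1"] by simp

lemma ideal2_diff: "y \<in> ideal2 p q \<Longrightarrow> z \<in> ideal2 p q \<Longrightarrow> y - z \<in> ideal2 p q"
  using ideal2_add[of y p q "- z"] ideal2_uminus[of z] by simp

lemma ideal2_dvd: "z \<in> ideal2 p q \<Longrightarrow> z dvd y \<Longrightarrow> y \<in> ideal2 p q"
  by (auto elim!: dvdE intro: ideal2_mult2)

lemma ideal2_commute: "ideal2 p q = ideal2 q p"
  unfolding ideal2_def by (subst add.commute) blast

lemma ideal2_least:
  assumes "p \<in> ideal2 r s" "q \<in> ideal2 r s"
  shows "ideal2 p q \<subseteq> ideal2 r s"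
  using assms by (auto elim!: ideal2E[of _ p q] intro!: ideal2_add ideal2_mult)

text \<open>Linear independence of \<open>u\<close> and \<open>u'\<close>, kept together with its
  witnesses because these are the projection directions for two successive restrictions.\<close>

definition dual_vectors :: "'k::field ^ 'x::finite \<Rightarrow> 'k ^ 'x \<Rightarrow> 'k ^ 'x \<Rightarrow> 'k ^ 'x \<Rightarrow> bool" where
  "dual_vectors u u' e e' \<longleftrightarrow>
     pairing u e = 1 \<and> pairing u e' = 0 \<and> pairing u' e = 0 \<and> pairing u' e' = 1"

lemma dual_vectors_swap: "dual_vectors u u' e e' \<Longrightarrow> dual_vectors u' u e' e"
  by (auto simp: dual_vectors_def)

lemma dual_vectors_nonzero: "dual_vectors u u' e e' \<Longrightarrow> u \<noteq> 0 \<and> u' \<noteq> 0"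
  by (auto simp: dual_vectors_def pairing_def)

text \<open>Since \<open>u'\<close> vanishes at \<open>e\<close>, its form survives the first
  restriction unchanged, so the composite of the two restrictions has exactly this kernel. The ideal
  is therefore prime.\<close>

lemma mem_ideal2_linear_forms_iff:
  assumes "dual_vectors u u' e e'"
  shows "p \<in> ideal2 (linear_form u) (linear_form u') \<longleftrightarrow> restrict_hyp u' e' (restrict_hyp u e p) = 0"
proof
  assume "p \<in> ideal2 (linear_form u) (linear_form u')"
  then obtain r s where "p = r * linear_form u + s * linear_form u'" by (rule ideal2E)
  then show "restrict_hyp u' e' (restrict_hyp u e p) = 0"
    using assms by (simp add: restrict_hyp_linear_form dual_vectors_def)
next
  assume "restrict_hyp u' e' (restrict_hyp u e p) = 0"
  then have "linear_form u' dvd restrict_hyp u e p"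
    using linear_form_dvd_iff assms dual_vectors_def by blast
  then have "restrict_hyp u e p \<in> ideal2 (linear_form u) (linear_form u')"
    by (meson gens_in_ideal2(2) ideal2_dvd)
  moreover have "p - restrict_hyp u e p \<in> ideal2 (linear_form u) (linear_form u')"
    by (meson gens_in_ideal2(1) ideal2_dvd linear_form_dvd_diff_restrict_hyp)
  ultimately show "p \<in> ideal2 (linear_form u) (linear_form u')"
    using ideal2_add by (metis diff_add_cancel)
qed

lemma linear_forms_prime:
  assumes "dual_vectors u u' e e'" "p * q \<in> ideal2 (linear_form u) (linear_form u')"
  shows "p \<in> ideal2 (linear_form u) (linear_form u') \<or> q \<in> ideal2 (linear_form u) (linear_form u')"
  using assms(2) by (simp add: mem_ideal2_linear_forms_iff[OF assms(1)])

lemma one_notin_linear_forms: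
  assumes "dual_vectors u u' e e'"
  shows "1 \<notin> ideal2 (linear_form u) (linear_form u')"
  by (simp add: mem_ideal2_linear_forms_iff[OF assms])

section \<open>Ideals of the polynomial ring\<close>

lemma mpoly_ring_simps [simp]:
  "carrier mpoly_ring = UNIV" "monoid.mult mpoly_ring = (*)" "monoid.one mpoly_ring = 1"
  "ring.zero mpoly_ring = 0" "add mpoly_ring = (+)"
  by (simp_all add: ring_of_type_algebra_def fun_eq_iff)

lemma mpoly_ring_cring: "cring mpoly_ring"
  by (rule cring_from_type_algebra)

lemma mpoly_ring_pow [simp]: "p [^]\<^bsub>mpoly_ring\<^esub> (k::nat) = p ^ k"
proof -
  interpret cring "mpoly_ring :: ('a, 'b) mpoly ring" by (rule mpoly_ring_cring)
  show ?thesis by (induction k) (simp_all add: mult.commute)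
qed

definition mpoly_ideal :: "('x::finite, 'k::field) mpoly set \<Rightarrow> bool" where
  "mpoly_ideal I \<longleftrightarrow> 0 \<in> I \<and> (\<forall>p\<in>I. \<forall>q\<in>I. p + q \<in> I) \<and> (\<forall>p\<in>I. \<forall>r. r * p \<in> I)"

lemma mpoly_idealD:
  assumes "mpoly_ideal I"
  shows "0 \<in> I" "p \<in> I \<Longrightarrow> q \<in> I \<Longrightarrow> p + q \<in> I" "p \<in> I \<Longrightarrow> r * p \<in> I" "p \<in> I \<Longrightarrow> p * r \<in> I"
  using assms by (auto simp: mpoly_ideal_def) (metis mult.commute)

lemma mpoly_ideal_uminus: "mpoly_ideal I \<Longrightarrow> p \<in> I \<Longrightarrow> - p \<in> I"
  using mpoly_idealD(3)[of I p "- 1"] by simp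

lemma mpoly_ideal_diff: "mpoly_ideal I \<Longrightarrow> p \<in> I \<Longrightarrow> q \<in> I \<Longrightarrow> p - q \<in> I"
  using mpoly_idealD(2)[of I p "- q"] mpoly_ideal_uminus[of I q] by simp

lemma mpoly_ideal_dvd: "mpoly_ideal I \<Longrightarrow> p \<in> I \<Longrightarrow> p dvd q \<Longrightarrow> q \<in> I"
  by (auto elim!: dvdE intro: mpoly_idealD)

lemma mpoly_ideal_sum:
  "mpoly_ideal I \<Longrightarrow> (\<And>i. i \<in> A \<Longrightarrow> p i \<in> I) \<Longrightarrow> sum p A \<in> I"
  by (induction A rule: infinite_finite_induct) (auto intro: mpoly_idealD)

lemma mpoly_ideal_ideal2: "mpoly_ideal (ideal2 p q)"
  by (auto simp: mpoly_ideal_def intro: ideal2_add ideal2_mult)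

lemma ideal2_subset: "mpoly_ideal I \<Longrightarrow> p \<in> I \<Longrightarrow> q \<in> I \<Longrightarrow> ideal2 p q \<subseteq> I"
  using mpoly_idealD(2)[OF _ mpoly_idealD(3) mpoly_idealD(3)] by (auto elim!: ideal2E)

lemma ideal_mpoly_ring_iff: "ideal I mpoly_ring \<longleftrightarrow> mpoly_ideal I"
proof
  assume "ideal I (mpoly_ring :: ('a, 'b) mpoly ring)"
  then interpret ideal I "mpoly_ring :: ('a, 'b) mpoly ring" .
  show "mpoly_ideal I"
    using additive_subgroup.zero_closed[OF additive_subgroup_axioms]
      additive_subgroup.a_closed[OF additive_subgroup_axioms] I_l_closed
    by (auto simp: mpoly_ideal_def)
next
  interpret R: cring "mpoly_ring :: ('a, 'b) mpoly ring" by (rule mpoly_ring_cring)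
  assume I: "mpoly_ideal I"
  have inv: "inv\<^bsub>add_monoid mpoly_ring\<^esub> p = - p" for p :: "('a, 'b) mpoly"
    using R.minus_equality[of "- p" p] by (simp add: a_inv_def)
  show "ideal I mpoly_ring"
  proof (rule idealI)
    show "ring (mpoly_ring :: ('a, 'b) mpoly ring)" by (rule R.ring_axioms)
    show "subgroup I (add_monoid mpoly_ring)"
    proof (rule subgroup.intro)
      show "inv\<^bsub>add_monoid mpoly_ring\<^esub> p \<in> I" if "p \<in> I" for p
        unfolding inv using I that by (rule mpoly_ideal_uminus)
    qed (use I in \<open>auto intro: mpoly_idealD\<close>)
  qed (use I in \<open>auto intro: mpoly_idealD\<close>)
qed

lemma genideal_mpoly_ring: "Idl\<^bsub>mpoly_ring\<^esub> A = \<Inter>{I. mpoly_ideal I \<and> A \<subseteq> I}"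
  by (simp add: genideal_def ideal_mpoly_ring_iff)

lemma mpoly_ideal_genideal: "mpoly_ideal (Idl\<^bsub>mpoly_ring\<^esub> A)"
  unfolding genideal_mpoly_ring by (auto simp: mpoly_ideal_def)

lemma genideal_superset: "A \<subseteq> Idl\<^bsub>mpoly_ring\<^esub> A"
  unfolding genideal_mpoly_ring by auto

lemma genideal_least: "mpoly_ideal I \<Longrightarrow> A \<subseteq> I \<Longrightarrow> Idl\<^bsub>mpoly_ring\<^esub> A \<subseteq> I"
  unfolding genideal_mpoly_ring by auto

definition mpoly_prime :: "('x::finite, 'k::field) mpoly set \<Rightarrow> bool" where
  "mpoly_prime P \<longleftrightarrow> mpoly_ideal P \<and> 1 \<notin> P \<and> (\<forall>p q. p * q \<in> P \<longrightarrow> p \<in> P \<or> q \<in> P)"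

lemma mpoly_primeD:
  assumes "mpoly_prime P"
  shows "mpoly_ideal P" "1 \<notin> P" "p * q \<in> P \<Longrightarrow> p \<in> P \<or> q \<in> P"
  using assms by (auto simp: mpoly_prime_def)

lemma mpoly_ideal_eq_UNIV_iff: "mpoly_ideal I \<Longrightarrow> I = UNIV \<longleftrightarrow> 1 \<in> I"
  using mpoly_idealD(3)[of I 1] by auto

lemma primeideal_mpoly_ring_iff: "primeideal P mpoly_ring \<longleftrightarrow> mpoly_prime P"
proof
  assume "primeideal P (mpoly_ring :: ('a, 'b) mpoly ring)"
  then interpret primeideal P "mpoly_ring :: ('a, 'b) mpoly ring" .
  have "mpoly_ideal P" using is_ideal by (simp add: ideal_mpoly_ring_iff)
  then show "mpoly_prime P"
    using I_notcarr I_prime mpoly_ideal_eq_UNIV_iff[of P] by (auto simp: mpoly_prime_def)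
next
  assume P: "mpoly_prime P"
  show "primeideal P mpoly_ring"
    by (rule primeidealI)
      (use P mpoly_ring_cring mpoly_ideal_eq_UNIV_iff[of P] in \<open>auto simp: mpoly_prime_def ideal_mpoly_ring_iff\<close>)
qed

lemma mpoly_prime_power: "mpoly_prime P \<Longrightarrow> p ^ k \<in> P \<Longrightarrow> p \<in> P"
  by (induction k) (auto dest: mpoly_primeD)

lemma mpoly_prime_prod:
  assumes "mpoly_prime P" "finite A" "prod p A \<in> P"
  shows "\<exists>i\<in>A. p i \<in> P"
  using assms(2,3) by (induction A rule: finite_induct) (use assms(1) in \<open>auto dest: mpoly_primeD\<close>)

lemma mpoly_prime_0: "mpoly_prime {0}"
  by (auto simp: mpoly_prime_def mpoly_ideal_def)

lemma mpoly_prime_linear_form: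
  assumes "u \<noteq> 0"
  shows "mpoly_prime {p. linear_form u dvd p}"
proof -
  obtain e where "pairing u e = 1" using ex_pairing_eq_1 assms by blast
  then show ?thesis
    using linear_form_prime[OF _ assms] by (auto simp: mpoly_prime_def mpoly_ideal_def linear_form_dvd_iff)
qed

lemma mpoly_prime_linear_forms:
  assumes "dual_vectors u u' e e'"
  shows "mpoly_prime (ideal2 (linear_form u) (linear_form u'))"
  using linear_forms_prime[OF assms] one_notin_linear_forms[OF assms] mpoly_ideal_ideal2
  by (auto simp: mpoly_prime_def)

section \<open>The height of an ideal generated by two linear forms\<close>

text \<open>To be read as: polynomials in \<open>y\<close> of degree less than \<open>n\<close> over
  \<open>B\<close>, described by peeling off the top coefficient.\<close>

fun degree_less :: "('x::finite, 'k::field) mpoly set \<Rightarrow> ('x, 'k) mpoly \<Rightarrow> nat \<Rightarrow> ('x, 'k) mpoly set" where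
  "degree_less B y 0 = {0}"
| "degree_less B y (Suc n) = {d + b * y ^ n | d b. d \<in> degree_less B y n \<and> b \<in> B}"

text \<open>Presents S as \<open>B[y]\<close>. It is used with \<open>B\<close> the ring of
  polynomials fixed by a restriction and \<open>y\<close> the linear form of that
  restriction.\<close>

locale coefficient_ring =
  fixes B :: "('x::finite, 'k::field) mpoly set" and y
  assumes zero: "0 \<in> B" and one: "1 \<in> B" and const_mem: "const c \<in> B"
    and add: "b \<in> B \<Longrightarrow> b' \<in> B \<Longrightarrow> b + b' \<in> B" and mult: "b \<in> B \<Longrightarrow> b' \<in> B \<Longrightarrow> b * b' \<in> B"
    and vars: "\<exists>b\<in>B. \<exists>c. indeterminate x = b + const c * y"
begin

abbreviation "D \<equiv> degree_less B y"

lemma D_Suc: "d \<in> D n \<Longrightarrow> b \<in> B \<Longrightarrow> d + b * y ^ n \<in> D (Suc n)"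
  by auto

lemma D_Suc_mono: "d \<in> D n \<Longrightarrow> d \<in> D (Suc n)"
  using D_Suc[OF _ zero, of d n] by simp

lemma D_mono: "n \<le> m \<Longrightarrow> d \<in> D n \<Longrightarrow> d \<in> D m"
  by (induction m rule: dec_induct) (auto intro: D_Suc_mono simp del: degree_less.simps)

lemma D_0: "0 \<in> D n"
  by (rule D_mono[of 0]) auto

lemma D_add: "d \<in> D n \<Longrightarrow> d' \<in> D n \<Longrightarrow> d + d' \<in> D n"
proof (induction n arbitrary: d d')
  case (Suc n)
  then obtain e b e' b' where "d = e + b * y ^ n" "d' = e' + b' * y ^ n"
    "e \<in> D n" "e' \<in> D n" "b \<in> B" "b' \<in> B" by auto
  moreover from this have "d + d' = (e + e') + (b + b') * y ^ n" by (simp add: algebra_simps)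
  ultimately show ?case using D_Suc Suc.IH add by metis
qed auto

lemma D_mult_B: "d \<in> D n \<Longrightarrow> b \<in> B \<Longrightarrow> b * d \<in> D n"
proof (induction n arbitrary: d)
  case (Suc n)
  then obtain e b' where "d = e + b' * y ^ n" "e \<in> D n" "b' \<in> B" by auto
  moreover from this have "b * d = b * e + (b * b') * y ^ n" by (simp add: algebra_simps)
  ultimately show ?case using D_Suc Suc mult by metis
qed auto

lemma D_diff:
  assumes "d \<in> D n" "d' \<in> D n"
  shows "d - d' \<in> D n"
  using D_add[OF assms(1) D_mult_B[OF assms(2) const_mem[of "- 1"]]] by (simp add: single_uminus)

lemma D_mult_y: "d \<in> D n \<Longrightarrow> y ^ k * d \<in> D (n + k)"
proof (induction n arbitrary: d)
  case 0
  then show ?case using D_0[of k] by simp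
next
  case (Suc n)
  then obtain e b where *: "d = e + b * y ^ n" "e \<in> D n" "b \<in> B" by auto
  moreover from this have "y ^ k * d = y ^ k * e + b * y ^ (n + k)" by (simp add: algebra_simps power_add)
  ultimately show ?case using D_Suc[OF Suc.IH[OF *(2)], of b] by (simp del: degree_less.simps)
qed

lemma D_mult: "d \<in> D n \<Longrightarrow> d' \<in> D m \<Longrightarrow> d * d' \<in> D (n + m)"
proof (induction n arbitrary: d)
  case 0
  then show ?case using D_0[of m] by simp
next
  case (Suc n)
  then obtain e b where *: "d = e + b * y ^ n" "e \<in> D n" "b \<in> B" by auto
  have "e * d' \<in> D (Suc (n + m))" using Suc.IH[OF *(2) Suc.prems(2)] by (rule D_Suc_mono)
  moreover have "b * (y ^ n * d') \<in> D (Suc (n + m))"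
    using D_mult_B[OF D_mult_y[OF Suc.prems(2), of n] *(3)] by (metis D_Suc_mono add.commute)
  ultimately have "e * d' + b * (y ^ n * d') \<in> D (Suc (n + m))" by (rule D_add)
  then show ?case using * by (simp add: algebra_simps del: degree_less.simps)
qed

lemma B_subset_D: "b \<in> B \<Longrightarrow> b \<in> D 1"
  using D_Suc[of 0 0 b] by simp

lemma D_1: "D (Suc 0) = B"
  by auto

lemma ex_D: "\<exists>n. p \<in> D n"
proof (induction p rule: mpoly_induct)
  case (const c)
  then show ?case using B_subset_D const_mem by blast
next
  case (indeterminate x)
  obtain b c where "b \<in> B" "indeterminate x = b + const c * y" using vars by blast
  then have "indeterminate x \<in> D (Suc 1)"
    using D_Suc[OF B_subset_D[of b] const_mem[of c]] by (simp del: degree_less.simps)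
  then show ?case by blast
next
  case (add p q)
  then obtain n m where "p \<in> D n" "q \<in> D m" by blast
  then have "p \<in> D (max n m)" "q \<in> D (max n m)" using D_mono by (meson max.cobounded1 max.cobounded2)+
  then show ?case using D_add by blast
next
  case (mult p q)
  then show ?case using D_mult by blast
qed

text \<open>The leading coefficient \<open>c\<close> of \<open>h\<close> need not be invertible, so
  each reduction of the degree of \<open>f\<close> costs a factor \<open>c\<close>.\<close>

lemma pseudo_division:
  assumes h: "h = c * y ^ n + h'" "c \<in> B" "h' \<in> D n"
    and "f \<in> D (n + k)"
  shows "\<exists>e. \<exists>q \<in> D k. c ^ e * f - q * h \<in> D n"
  using assms(4)
proof (induction k arbitrary: f)
  case 0
  have "c ^ 0 * f - 0 * h \<in> D n" "0 \<in> D 0" using 0 by auto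
  then show ?case by blast
next
  case (Suc k)
  then obtain f' b where f: "f = f' + b * y ^ (n + k)" "f' \<in> D (n + k)" "b \<in> B" by auto
  have "c * f - b * y ^ k * h = c * f' - b * (y ^ k * h')"
    by (simp add: f h(1) algebra_simps power_add)
  moreover have "c * f' - b * (y ^ k * h') \<in> D (n + k)"
    by (intro D_diff D_mult_B D_mult_y f h)
  ultimately obtain e q where q: "q \<in> D k" "c ^ e * (c * f - b * y ^ k * h) - q * h \<in> D n"
    using Suc.IH by metis
  have ce: "c ^ e \<in> B" by (induction e) (auto intro: one mult h)
  have "c ^ e * (c * f - b * y ^ k * h) - q * h = c ^ Suc e * f - (q + (c ^ e * b) * y ^ k) * h"
    by (simp add: algebra_simps)
  moreover have "q + (c ^ e * b) * y ^ k \<in> D (Suc k)"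
    by (intro D_Suc q mult ce f)
  ultimately show ?case using q(2) by metis
qed

text \<open>Peels off the coefficient of lowest degree, for a descent that divides by
  \<open>y\<close>.\<close>

lemma D_Suc_bottom:
  assumes "d \<in> D (Suc n)"
  shows "\<exists>b\<in>B. \<exists>d'\<in>D n. d = b + y * d'"
  using assms
proof (induction n arbitrary: d)
  case 0
  then show ?case by auto
next
  case (Suc n)
  then obtain e b where e: "d = e + b * y ^ Suc n" "e \<in> D (Suc n)" "b \<in> B"
    by (subst (asm) degree_less.simps(2)) auto
  then obtain b' d' where "b' \<in> B" "d' \<in> D n" "e = b' + y * d'" using Suc.IH by blast
  moreover have "d = b' + y * (d' + b * y ^ n)" using e calculation by (simp add: algebra_simps)
  ultimately show ?case using D_Suc[of d' n b] e(3) by blast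
qed

text \<open>This is the fact that the domain \<open>Frac(B)[y]\<close> has dimension one: otherwise both primes would
  survive in it.\<close>

lemma prime_chain_meets_B:
  assumes P: "mpoly_prime P" and Q: "mpoly_prime Q" and "P \<subset> Q" "\<exists>g\<in>P. g \<noteq> 0"
  shows "\<exists>b\<in>B \<inter> Q. b \<noteq> 0"
proof (rule ccontr)
  assume "\<not> ?thesis"
  then have QB: "\<And>b. b \<in> B \<Longrightarrow> b \<in> Q \<Longrightarrow> b = 0" by blast
  note QI = mpoly_primeD(1)[OF Q] and PI = mpoly_primeD(1)[OF P]
  have exP: "\<exists>n. \<exists>g\<in>P \<inter> D n. g \<noteq> 0" using assms(4) ex_D by blast
  have exQ: "\<exists>n. \<exists>g\<in>Q \<inter> D n. g \<noteq> 0" using assms(3,4) ex_D by blast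
  define n where "n = (LEAST n. \<exists>g\<in>Q \<inter> D n. g \<noteq> 0)"
  define N where "N = (LEAST n. \<exists>g\<in>P \<inter> D n. g \<noteq> 0)"
  obtain h where h: "h \<in> Q" "h \<in> D n" "h \<noteq> 0"
    using LeastI_ex[OF exQ] unfolding n_def by blast
  obtain g where g: "g \<in> P" "g \<in> D N" "g \<noteq> 0"
    using LeastI_ex[OF exP] unfolding N_def by blast
  have minQ: "f = 0" if "f \<in> Q" "f \<in> D m" "m < n" for f m
    using not_less_Least[of m "\<lambda>n. \<exists>g\<in>Q \<inter> D n. g \<noteq> 0"] that unfolding n_def by blast
  have minP: "f = 0" if "f \<in> P" "f \<in> D m" "m < N" for f m
    using not_less_Least[of m "\<lambda>n. \<exists>g\<in>P \<inter> D n. g \<noteq> 0"] that unfolding N_def by blast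
  have "n \<noteq> 0" using h by (intro notI) simp
  \<comment> \<open>\<open>n = 1\<close> would put \<open>h\<close> into \<open>B\<close>. Hence
    \<open>h\<close> has degree \<open>k \<ge> 1\<close>, which makes the bound \<open>j\<close> for
    the quotient below smaller than \<open>N\<close>.\<close>
  moreover have "n \<noteq> Suc 0" using h QB D_1 by metis
  ultimately obtain k where n: "n = Suc k" "k \<ge> 1" by (cases n) auto
  obtain h' c where hc: "h = h' + c * y ^ k" "h' \<in> D k" "c \<in> B"
    using h(2) unfolding n(1) by auto
  have "c \<noteq> 0"
  proof
    assume "c = 0"
    then have "h \<in> D k" using hc by simp
    then show False using minQ[OF h(1), of k] n h(3) by simp
  qed
  then have c: "c \<notin> Q" using QB hc(3) by blast
  have c': "c ^ e \<notin> Q" for e using c mpoly_prime_power[OF Q] by blast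
  \<comment> \<open>The remainder of pseudo-division by \<open>h\<close> lies in \<open>Q\<close>
    and has smaller degree than \<open>h\<close>, so it vanishes by minimality.\<close>
  have div: "\<exists>e. \<exists>q\<in>D j. c ^ e * f = q * h" if f: "f \<in> Q" "f \<in> D (k + j)" for f j
  proof -
    have "h = c * y ^ k + h'" using hc(1) by (simp only: add.commute)
    then obtain e q where q: "q \<in> D j" "c ^ e * f - q * h \<in> D k"
      using pseudo_division[OF _ hc(3,2) f(2)] by blast
    have "c ^ e * f - q * h \<in> Q" using QI f(1) h(1) by (intro mpoly_ideal_diff mpoly_idealD)
    then show ?thesis using minQ[OF _ q(2)] n q(1) by auto
  qed
  \<comment> \<open>Otherwise every \<open>f\<close> in \<open>Q\<close> satisfies
    \<open>c ^ e * f \<in> P\<close> for some \<open>e\<close>, with no power of \<open>c\<close> in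
    \<open>P\<close>, and \<open>Q\<close> would be contained in \<open>P\<close>.\<close>
  have hP: "h \<notin> P"
  proof
    assume hP: "h \<in> P"
    have "f \<in> P" if f: "f \<in> Q" for f
    proof -
      obtain m where "f \<in> D m" using ex_D by blast
      then have "f \<in> D (k + m)" using D_mono[of m "k + m"] by simp
      then obtain e q where "c ^ e * f = q * h" using div f by blast
      then have "c ^ e * f \<in> P" using hP PI mpoly_idealD by metis
      then show ?thesis using mpoly_primeD(3)[OF P] c' assms(3) by blast
    qed
    then show False using assms(3) by blast
  qed
  have "N \<ge> n" using minQ g assms(3) by (metis linorder_not_less psubset_imp_subset subsetD)
  then obtain j where j: "N = k + j" "j < N" using n by (metis less_add_Suc1 add_diff_inverse_nat add.commute
    Suc_le_lessD less_imp_le_nat not_less less_add_same_cancel1 less_le_trans zero_less_one)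
  obtain e q where q: "q \<in> D j" "c ^ e * g = q * h" using div[of g j] g j assms(3) by blast
  \<comment> \<open>The quotient inherits membership in \<open>P\<close> but has degree below the
    minimum \<open>N\<close>, so it is zero.\<close>
  have "q * h \<in> P" using q(2) g(1) PI mpoly_idealD by metis
  then have "q \<in> P" using mpoly_primeD(3)[OF P] hP by blast
  then have "q = 0" using minP q(1) j(2) by blast
  then have "c ^ e = 0" using q(2) g(3) by simp
  then show False using \<open>c \<noteq> 0\<close> mpoly_power_eq_0 by blast
qed

end

lemma coefficient_ring_restrict_hyp:
  assumes "pairing u e = 1"
  shows "coefficient_ring {p. restrict_hyp u e p = p} (linear_form u)"
proof
  fix x
  have "restrict_hyp u e (restrict_hyp u e (indeterminate x)) = restrict_hyp u e (indeterminate x)"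
    by (rule restrict_hyp_idem[OF assms])
  moreover have "indeterminate x = restrict_hyp u e (indeterminate x) + const (e $ x) * linear_form u"
    by simp
  ultimately show "\<exists>b\<in>{p. restrict_hyp u e p = p}. \<exists>c. indeterminate x = b + const c * linear_form u"
    by blast
qed auto

text \<open>By descent: \<open>Q\<close> contains a nonzero \<open>b\<close> free of
  \<open>linear_form u'\<close>. Lying in the big ideal, \<open>b\<close> is then a multiple of
  \<open>linear_form u\<close>; if that form were outside \<open>Q\<close>, the quotient would be an
  element of the same kind, of smaller degree in \<open>linear_form u\<close>.\<close>

lemma linear_form_mem_intermediate_prime:
  assumes d: "dual_vectors u u' e e'"
    and P: "mpoly_prime P" "mpoly_prime Q" "P \<subset> Q" "\<exists>g\<in>P. g \<noteq> 0"
    and QI: "Q \<subseteq> ideal2 (linear_form u) (linear_form u')"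
  shows "linear_form u \<in> Q"
proof (rule ccontr)
  assume uQ: "linear_form u \<notin> Q"
  let ?x = "linear_form u" and ?r = "restrict_hyp u e" and ?r' = "restrict_hyp u' e'"
  have ue: "pairing u e = 1" "pairing u' e' = 1" using d by (auto simp: dual_vectors_def)
  interpret B: coefficient_ring "{p. ?r' p = p}" "linear_form u'"
    by (rule coefficient_ring_restrict_hyp) (rule ue)
  interpret X: coefficient_ring "{p. ?r p = p}" ?x
    by (rule coefficient_ring_restrict_hyp) (rule ue)
  have False if "b \<in> Q" "?r' b = b" "b \<noteq> 0" "b \<in> X.D n" for b n
    using that
  proof (induction n arbitrary: b)
    case (Suc n)
    obtain b0 d where b: "?r b0 = b0" "d \<in> X.D n" "b = b0 + ?x * d"
      using X.D_Suc_bottom[OF Suc.prems(4)] by auto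
    obtain p q where pq: "b = p * ?x + q * linear_form u'"
      using QI Suc.prems(1) by (blast elim: ideal2E)
    have "?r' ?x = ?x" "?r' (linear_form u') = 0"
      using d by (simp_all add: restrict_hyp_linear_form dual_vectors_def)
    then have "?r' b = ?x * ?r' p" unfolding pq by (simp add: mult.commute)
    then have "b = ?x * ?r' p" using Suc.prems(2) by simp
    moreover from this have "?r b = 0" using ue by (simp add: restrict_hyp_linear_form)
    then have "b0 = 0" using b ue by (simp add: restrict_hyp_linear_form)
    ultimately have "?x * d = ?x * ?r' p" "b = ?x * d" using b by auto
    moreover have x0: "?x \<noteq> 0" using dual_vectors_nonzero[OF d] by (simp add: linear_form_eq_0_iff)
    ultimately have "d = ?r' p" using mpoly_mult_left_cancel by blast
    then have "?r' d = d" using restrict_hyp_idem ue by blast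
    moreover have "d \<noteq> 0" using Suc.prems(3) \<open>b = ?x * d\<close> by auto
    moreover have "d \<in> Q" using Suc.prems(1) \<open>b = ?x * d\<close> uQ mpoly_primeD(3)[OF P(2)] by blast
    ultimately show False using Suc.IH b(2) by blast
  qed simp
  moreover obtain b where "b \<in> Q" "?r' b = b" "b \<noteq> 0"
    using B.prime_chain_meets_B[OF P] by blast
  ultimately show False using X.ex_D by blast
qed

lemma no_intermediate_primes:
  assumes d: "dual_vectors u u' e e'"
    and P: "mpoly_prime P" "mpoly_prime Q" "P \<subset> Q" "\<exists>g\<in>P. g \<noteq> 0"
    and QI: "Q \<subseteq> ideal2 (linear_form u) (linear_form u')"
  shows "Q = ideal2 (linear_form u) (linear_form u')"
proof -
  have "linear_form u \<in> Q" by (rule linear_form_mem_intermediate_prime[OF assms])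
  moreover have "linear_form u' \<in> Q"
    by (rule linear_form_mem_intermediate_prime[OF dual_vectors_swap[OF d] P])
      (use QI ideal2_commute in blast)
  ultimately show ?thesis using ideal2_subset[OF mpoly_primeD(1)[OF P(2)]] QI by blast
qed

lemma prime_height_ge:
  assumes "\<And>i. i \<le> r \<Longrightarrow> mpoly_prime (C i)" "\<And>i. i < r \<Longrightarrow> C i \<subset> C (Suc i)" "C r = P"
  shows "enat r \<le> prime_height mpoly_ring P"
  unfolding prime_height_def by (rule Sup_upper) (use assms in \<open>auto simp: primeideal_mpoly_ring_iff\<close>)

lemma prime_height_linear_forms_le:
  assumes d: "dual_vectors u u' e e'"
  shows "prime_height mpoly_ring (ideal2 (linear_form u) (linear_form u')) \<le> 2"
  unfolding prime_height_def
proof (rule Sup_least, clarsimp simp: primeideal_mpoly_ring_iff)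
  fix r C
  assume C: "\<forall>i\<le>r. mpoly_prime (C i)" "\<forall>i<r. C i \<subset> C (Suc i)"
    "C r = ideal2 (linear_form u) (linear_form u')"
  have "r \<le> 2"
  proof (rule ccontr)
    assume "\<not> r \<le> 2"
    \<comment> \<open>A chain this long ends in four primes \<open>C k\<close> to
      \<open>C (k + 3)\<close>. The second is nonzero because it properly contains
      \<open>C k\<close>, so the third is a forbidden intermediate prime.\<close>
    then obtain k where r: "r = Suc (Suc (Suc k))" by (metis numeral_2_eq_2 not_less_eq_eq less_eq_Suc_le Suc_le_D not_less)
    have "0 \<in> C k" using C(1) r by (auto dest!: spec[of _ k] mpoly_primeD(1) mpoly_idealD(1))
    moreover have "C k \<subset> C (Suc k)" using C(2) r by auto
    ultimately have "\<exists>g\<in>C (Suc k). g \<noteq> 0" by (metis psubset_imp_ex_mem singletonI subsetD psubset_imp_subset psubset_eq Diff_iff)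
    moreover have "C (Suc (Suc k)) \<subset> C r" "C (Suc k) \<subset> C (Suc (Suc k))" using C(2) r by auto
    ultimately show False
      using no_intermediate_primes[OF d, of "C (Suc k)" "C (Suc (Suc k))"] C r by auto
  qed
  then show "enat r \<le> 2" by (metis enat_ord_simps(1) numeral_eq_enat)
qed

text \<open>The chain 0, (l_u), \<open>P\<close> gives the bound. If \<open>P\<close> were larger
  than the prime (l_u, l_u'), inserting that prime would produce a chain of length three.\<close>

lemma prime_height_ge_2:
  assumes P: "mpoly_prime P" and d: "dual_vectors u u' e e'"
    and "linear_form u \<in> P" "linear_form u' \<in> P"
  shows "2 \<le> prime_height mpoly_ring P"
    and "prime_height mpoly_ring P = 2 \<Longrightarrow> P = ideal2 (linear_form u) (linear_form u')"
proof -
  let ?L = "{p. linear_form u dvd p}" and ?I = "ideal2 (linear_form u) (linear_form u')"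
  note u = dual_vectors_nonzero[OF d]
  have L: "mpoly_prime ?L" by (rule mpoly_prime_linear_form) (use u in blast)
  have "linear_form u \<noteq> 0" using u by (simp add: linear_form_eq_0_iff)
  moreover have "0 \<in> ?L" "linear_form u \<in> ?L" by simp_all
  ultimately have 0: "{0} \<subset> ?L" by blast
  have 1: "\<not> linear_form u dvd linear_form u'"
    using d u by (simp add: linear_form_dvd_iff[of u e] dual_vectors_def restrict_hyp_linear_form linear_form_eq_0_iff)
  have LP: "?L \<subset> P"
    using mpoly_ideal_dvd[OF mpoly_primeD(1)[OF P] assms(3)] assms(4) 1 by blast
  have LI: "?L \<subset> ?I"
    using ideal2_dvd[of "linear_form u"] 1 gens_in_ideal2 by blast
  have "enat 2 \<le> prime_height mpoly_ring P"
    by (rule prime_height_ge[where C = "\<lambda>i. if i = 0 then {0} else if i = 1 then ?L else P"])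
      (use P L LP 0 mpoly_prime_0 in \<open>auto simp: less_2_cases_iff\<close>)
  then show "2 \<le> prime_height mpoly_ring P" by (simp add: numeral_eq_enat)
  assume h: "prime_height mpoly_ring P = 2"
  show "P = ?I"
  proof (rule ccontr)
    assume "P \<noteq> ?I"
    moreover have "?I \<subseteq> P" by (rule ideal2_subset[OF mpoly_primeD(1)[OF P] assms(3,4)])
    ultimately have IP: "?I \<subset> P" by blast
    have "enat 3 \<le> prime_height mpoly_ring P"
    proof (rule prime_height_ge[where C = "\<lambda>i. if i = 0 then {0} else if i = 1 then ?L else if i = 2 then ?I else P"])
      show "(if i = 0 then {0} else if i = 1 then ?L else if i = 2 then ?I else P)
        \<subset> (if Suc i = 0 then {0} else if Suc i = 1 then ?L else if Suc i = 2 then ?I else P)" if i3: "i < 3" for i :: nat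
      proof -
        consider "i = 0" | "i = 1" | "i = 2" using i3 by linarith
        then show ?thesis using 0 LI IP by cases auto
      qed
    qed (use P L mpoly_prime_0 mpoly_prime_linear_forms[OF d] in auto)
    then show False using h by (simp add: numeral_eq_enat)
  qed
qed

section \<open>Homogeneous polynomials\<close>

lemma homogeneous_0 [simp]: "homogeneous e 0"
  by (simp add: homogeneous_def)

lemma homogeneous_add: "homogeneous e p \<Longrightarrow> homogeneous e q \<Longrightarrow> homogeneous e (p + q)"
  unfolding homogeneous_def using Poly_Mapping.keys_add[of p q] by blast

lemma homogeneous_uminus: "homogeneous e p \<Longrightarrow> homogeneous e (- p)"
  by (simp add: homogeneous_def in_keys_iff)

lemma homogeneous_diff: "homogeneous e p \<Longrightarrow> homogeneous e q \<Longrightarrow> homogeneous e (p - q)"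
  using homogeneous_add[of e p "- q"] homogeneous_uminus[of e q] by simp

lemma homogeneous_sum: "(\<And>i. i \<in> A \<Longrightarrow> homogeneous e (p i)) \<Longrightarrow> homogeneous e (sum p A)"
  by (induction A rule: infinite_finite_induct) (auto intro: homogeneous_add)

lemma homogeneous_mult:
  assumes "homogeneous e p" "homogeneous e' q"
  shows "homogeneous (e + e') (p * q)"
  unfolding homogeneous_def
proof
  fix m assume "m \<in> Poly_Mapping.keys (p * q)"
  then obtain k l where "m = k + l" "k \<in> Poly_Mapping.keys p" "l \<in> Poly_Mapping.keys q"
    using Poly_Mapping.keys_mult[of p q] by blast
  then show "int (\<Sum>x\<in>UNIV. Poly_Mapping.lookup m x) = e + e'"
    using assms by (auto simp: homogeneous_def lookup_add sum.distrib)
qed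

lemma homogeneous_mult':
  "homogeneous e p \<Longrightarrow> homogeneous e' q \<Longrightarrow> e + e' = e'' \<Longrightarrow> homogeneous e'' (p * q)"
  using homogeneous_mult by blast

lemma homogeneous_const [simp]: "homogeneous 0 (const c)"
  by (simp add: homogeneous_def)

lemma homogeneous_linear_form:
  fixes a :: "'k::field ^ 'x::finite"
  shows "homogeneous 1 (linear_form a)"
  unfolding linear_form_def
proof (rule homogeneous_sum)
  fix x :: 'x
  have "(\<Sum>y\<in>UNIV. Poly_Mapping.lookup (Poly_Mapping.single x (1::nat)) y) = (\<Sum>y\<in>UNIV. if y = x then 1 else 0)"
    by (rule sum.cong) (auto simp: lookup_single when_def)
  then show "homogeneous 1 (Poly_Mapping.single (Poly_Mapping.single x 1) (a $ x))"
    by (auto simp: homogeneous_def simp flip: of_nat_sum)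
qed

lemma homogeneous_prod_linear_form:
  "finite A \<Longrightarrow> homogeneous (int (card A)) (\<Prod>H\<in>A. linear_form (a H))"
proof (induction A rule: finite_induct)
  case empty
  show ?case using homogeneous_const[of 1] by simp
next
  case (insert H A)
  then show ?case by (auto intro!: homogeneous_mult'[OF homogeneous_linear_form])
qed

text \<open>Every monomial of positive degree is divisible by a variable. This reduces minimality of
  the resolution to a statement about degrees.\<close>

lemma homogeneous_pos_mem_irrelevant:
  assumes "homogeneous e p" "e > 0"
  shows "p \<in> Idl\<^bsub>mpoly_ring\<^esub> (range indeterminate)"
proof -
  let ?I = "Idl\<^bsub>mpoly_ring\<^esub> (range indeterminate) :: ('a, 'b) mpoly set"
  note I = mpoly_ideal_genideal[of "range indeterminate"]
  have "p = (\<Sum>m\<in>Poly_Mapping.keys p. Poly_Mapping.single m (Poly_Mapping.lookup p m))"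
    by (rule poly_mapping_eqI) (auto simp: lookup_sum lookup_single when_def in_keys_iff)
  also have "\<dots> \<in> ?I"
  proof (rule mpoly_ideal_sum[OF I])
    fix m assume "m \<in> Poly_Mapping.keys p"
    then have "int (\<Sum>x\<in>UNIV. Poly_Mapping.lookup m x) > 0"
      using assms by (simp add: homogeneous_def)
    then have "\<exists>x. Poly_Mapping.lookup m x \<noteq> 0" by (metis less_irrefl of_nat_0 sum.neutral)
    then obtain x where "Poly_Mapping.lookup m x \<noteq> 0" by blast
    then obtain k where k: "Poly_Mapping.lookup m x = Suc k" using not0_implies_Suc by blast
    have "indeterminate x dvd (\<Prod>y\<in>UNIV. indeterminate y ^ Poly_Mapping.lookup m y :: ('a, 'b) mpoly)"
      by (rule dvd_trans[OF _ dvd_prodI[of UNIV x]]) (simp_all add: k)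
    then have "indeterminate x dvd Poly_Mapping.single m (Poly_Mapping.lookup p m)"
      unfolding single_eq_prod[of m] by (rule dvd_mult)
    moreover have "indeterminate x \<in> ?I" by (rule subsetD[OF genideal_superset rangeI])
    ultimately show "Poly_Mapping.single m (Poly_Mapping.lookup p m) \<in> ?I"
      using mpoly_ideal_dvd[OF I] by blast
  qed
  finally show ?thesis .
qed

section \<open>Derivatives of products of linear forms\<close>

lemma partial_deriv_single:
  "partial_deriv x (Poly_Mapping.single m c)
    = Poly_Mapping.single (m - Poly_Mapping.single x 1) (of_nat (Poly_Mapping.lookup m x) * c)"
  by (cases "c = 0") (auto simp: partial_deriv_def)

lemma partial_deriv_add: "partial_deriv x (p + q) = partial_deriv x p + partial_deriv x q"
  unfolding partial_deriv_def
  by (rule setsum_keys_plus_distrib) (auto simp: single_add algebra_simps)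

lemma partial_deriv_0 [simp]: "partial_deriv x 0 = 0"
  by (simp add: partial_deriv_def)

lemma partial_deriv_sum: "partial_deriv x (sum p A) = (\<Sum>i\<in>A. partial_deriv x (p i))"
  by (induction A rule: infinite_finite_induct) (auto simp: partial_deriv_add)

lemma partial_deriv_mult:
  "partial_deriv x (p * q) = partial_deriv x p * q + p * partial_deriv x q"
proof (induction p rule: mpoly_single_induct)
  case (single m c)
  show ?case
  proof (induction q rule: mpoly_single_induct)
    case (single n d)
    let ?x = "Poly_Mapping.single x (1::nat)"
    have shift: "m' + n' - ?x = (m' - ?x) + n'" if "Poly_Mapping.lookup m' x \<noteq> 0" for m' n' :: "'a \<Rightarrow>\<^sub>0 nat"
      by (rule poly_mapping_eqI) (use that in \<open>auto simp: lookup_minus lookup_add lookup_single when_def\<close>)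
    let ?s = "Poly_Mapping.single (m + n - ?x)"
    have 1: "partial_deriv x (Poly_Mapping.single m c) * Poly_Mapping.single n d
        = ?s (of_nat (Poly_Mapping.lookup m x) * (c * d))"
      using shift[of m n]
      by (cases "Poly_Mapping.lookup m x = 0") (simp_all add: partial_deriv_single mult_single add_ac mult_ac)
    have 2: "Poly_Mapping.single m c * partial_deriv x (Poly_Mapping.single n d)
        = ?s (of_nat (Poly_Mapping.lookup n x) * (c * d))"
      using shift[of n m]
      by (cases "Poly_Mapping.lookup n x = 0") (simp_all add: partial_deriv_single mult_single add_ac mult_ac)
    have "partial_deriv x (Poly_Mapping.single m c * Poly_Mapping.single n d)
        = ?s (of_nat (Poly_Mapping.lookup m x + Poly_Mapping.lookup n x) * (c * d))"
      by (simp add: mult_single partial_deriv_single lookup_add)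
    then show ?case unfolding 1 2 by (simp add: algebra_simps flip: single_add)
  next
    case (add p q)
    then show ?case by (simp add: partial_deriv_add algebra_simps)
  qed
next
  case (add p q)
  then show ?case by (simp add: partial_deriv_add algebra_simps)
qed

lemma partial_deriv_linear_form: "partial_deriv x (linear_form a) = const (a $ x)"
proof -
  have "partial_deriv x (linear_form a) = (\<Sum>y\<in>UNIV. if y = x then const (a $ y) else 0)"
    unfolding linear_form_def partial_deriv_sum
    by (rule sum.cong) (auto simp: partial_deriv_single lookup_single when_def)
  then show ?thesis by simp
qed

text \<open>Arbitrary directions allow generators of a Jacobian ideal to be chosen along vectors
  adapted to the pencil, without a change of coordinates.\<close>

definition directional_deriv :: "'k ^ 'x \<Rightarrow> ('x::finite, 'k::field) mpoly \<Rightarrow> ('x, 'k) mpoly" where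
  "directional_deriv z p = (\<Sum>x\<in>UNIV. const (z $ x) * partial_deriv x p)"

lemma directional_deriv_mult:
  "directional_deriv z (p * q) = directional_deriv z p * q + p * directional_deriv z q"
  by (simp add: directional_deriv_def partial_deriv_mult algebra_simps sum.distrib sum_distrib_left)

lemma directional_deriv_linear_form: "directional_deriv z (linear_form a) = const (pairing a z)"
  by (simp add: directional_deriv_def partial_deriv_linear_form pairing_def const_sum const_mult mult.commute)

lemma directional_deriv_1: "directional_deriv z 1 = 0"
  using directional_deriv_mult[of z 1 1] by simp

lemma directional_deriv_axis: "directional_deriv (axis x 1) p = partial_deriv x p"
proof -
  have "directional_deriv (axis x 1) p = (\<Sum>y\<in>UNIV. if y = x then partial_deriv y p else 0)"
    unfolding directional_deriv_def axis_def by (rule sum.cong) auto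
  then show ?thesis by simp
qed

lemma directional_deriv_prod_linear_form:
  assumes "finite A"
  shows "directional_deriv z (\<Prod>H\<in>A. linear_form (a H))
    = (\<Sum>H\<in>A. const (pairing (a H) z) * (\<Prod>K\<in>A - {H}. linear_form (a K)))"
  using assms
proof (induction A rule: finite_induct)
  case empty
  show ?case by (simp add: directional_deriv_1)
next
  case (insert H A)
  have "(\<Prod>K\<in>insert H A - {H'}. linear_form (a K)) = linear_form (a H) * (\<Prod>K\<in>A - {H'}. linear_form (a K))"
    if "H' \<in> A" for H'
  proof -
    have "insert H A - {H'} = insert H (A - {H'})" using insert that by auto
    then show ?thesis using insert by simp
  qed
  then have "(\<Sum>H'\<in>A. const (pairing (a H') z) * (\<Prod>K\<in>insert H A - {H'}. linear_form (a K)))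
      = linear_form (a H) * (\<Sum>H'\<in>A. const (pairing (a H') z) * (\<Prod>K\<in>A - {H'}. linear_form (a K)))"
    unfolding sum_distrib_left by (intro sum.cong) (simp_all add: mult_ac)
  then show ?case
    using insert by (simp add: directional_deriv_mult directional_deriv_linear_form)
qed

lemma homogeneous_directional_deriv_prod:
  assumes "finite A"
  shows "homogeneous (int (card A) - 1) (directional_deriv z (\<Prod>H\<in>A. linear_form (a H)))"
  unfolding directional_deriv_prod_linear_form[OF assms]
proof (rule homogeneous_sum)
  fix H assume H: "H \<in> A"
  have card: "0 + int (card (A - {H})) = int (card A) - 1"
    using card_Suc_Diff1[OF assms H] by linarith
  show "homogeneous (int (card A) - 1)
      (const (pairing (a H) z) * (\<Prod>K\<in>A - {H}. linear_form (a K)))"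
    by (rule homogeneous_mult'[OF homogeneous_const homogeneous_prod_linear_form card]) (use assms in simp)
qed

lemma directional_deriv_mem_jacobian_ideal: "directional_deriv z f \<in> jacobian_ideal f"
  unfolding directional_deriv_def jacobian_ideal_def
  using genideal_superset[of "range (\<lambda>x. partial_deriv x f)"]
  by (intro mpoly_ideal_sum mpoly_idealD mpoly_ideal_genideal) auto

lemma jacobian_ideal_subset:
  assumes "mpoly_ideal I" "\<And>z. directional_deriv z f \<in> I"
  shows "jacobian_ideal f \<subseteq> I"
  unfolding jacobian_ideal_def
  using assms directional_deriv_axis[of _ f] by (intro genideal_least) (metis image_subset_iff)+

text \<open>Euler's formula.  Characteristic zero is needed to divide by the degree.\<close>

lemma prod_linear_form_mem_jacobian_ideal:
  fixes a :: "'i \<Rightarrow> 'k::field_char_0 ^ 'x::finite"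
  assumes "finite A" "A \<noteq> {}"
  shows "(\<Prod>H\<in>A. linear_form (a H)) \<in> jacobian_ideal (\<Prod>H\<in>A. linear_form (a H))"
proof -
  let ?f = "\<Prod>H\<in>A. linear_form (a H)"
  let ?r = "\<lambda>H. \<Prod>K\<in>A - {H}. linear_form (a K)"
  have "(\<Sum>x\<in>UNIV. indeterminate x * partial_deriv x ?f)
      = (\<Sum>x\<in>UNIV. \<Sum>H\<in>A. const (a H $ x) * indeterminate x * ?r H)"
    unfolding directional_deriv_axis[symmetric] directional_deriv_prod_linear_form[OF assms(1)] pairing_axis
    by (simp add: sum_distrib_left mult_ac)
  also have "\<dots> = (\<Sum>H\<in>A. linear_form (a H) * ?r H)"
    by (subst sum.swap) (simp add: linear_form_eq sum_distrib_right)
  also have "\<dots> = (\<Sum>H\<in>A. ?f)"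
    using assms(1) by (intro sum.cong) (simp_all add: prod.remove)
  also have "\<dots> = of_nat (card A) * ?f" by simp
  also have "of_nat (card A) = (const (of_nat (card A)) :: ('x, 'k) mpoly)" by simp
  finally have eq: "(\<Sum>x\<in>UNIV. indeterminate x * partial_deriv x ?f) = const (of_nat (card A)) * ?f" .
  have "(\<Sum>x\<in>UNIV. indeterminate x * partial_deriv x ?f) \<in> jacobian_ideal ?f"
    unfolding jacobian_ideal_def
    by (intro mpoly_ideal_sum mpoly_idealD(3) mpoly_ideal_genideal subsetD[OF genideal_superset rangeI])
  then have "const (of_nat (card A)) * ?f \<in> jacobian_ideal ?f" by (simp only: eq)
  then have "const (inverse (of_nat (card A))) * (const (of_nat (card A)) * ?f) \<in> jacobian_ideal ?f"
    unfolding jacobian_ideal_def by (rule mpoly_idealD(3)[OF mpoly_ideal_genideal])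
  moreover have "const (inverse (of_nat (card A))) * const (of_nat (card A)) = (1 :: ('x, 'k) mpoly)"
    using assms const_mult_inverse[of "of_nat (card A) :: 'k"] by (simp add: mult.commute)
  ultimately show ?thesis by (simp flip: mult.assoc)
qed

section \<open>The Jacobian ideal of a pencil\<close>

lemma pairing_diff_left: "pairing (a - b) v = pairing a v - pairing b v"
  using pairing_add_left[of "a - b" b v] by simp

lemma pairing_diff_right: "pairing a (v - w) = pairing a v - pairing a w"
  using pairing_add_right[of a "v - w" w] by simp

text \<open>Removing from a vector its components along \<open>e\<close> and \<open>e'\<close>
  leaves a vector in the common kernel of \<open>u\<close> and \<open>u'\<close>, on which
  \<open>c\<close> vanishes.\<close>

lemma eq_combination_of_dual:
  assumes d: "dual_vectors u u' e e'"
    and c: "\<And>v. pairing u v = 0 \<Longrightarrow> pairing u' v = 0 \<Longrightarrow> pairing c v = 0"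
  shows "c = pairing c e *s u + pairing c e' *s u'"
proof -
  have "pairing c v = pairing c e * pairing u v + pairing c e' * pairing u' v" for v
  proof -
    let ?v = "v - pairing u v *s e - pairing u' v *s e'"
    have "pairing c ?v = 0"
      by (rule c) (use d in \<open>simp_all add: dual_vectors_def pairing_diff_right pairing_smult_right\<close>)
    then show ?thesis unfolding pairing_diff_right pairing_smult_right by (simp add: algebra_simps)
  qed
  from this[of "axis _ 1"] show ?thesis by (simp add: pairing_axis vec_eq_iff)
qed

text \<open>The bridge to geometry, where the right-hand side is an inclusion between an
  intersection of hyperplanes and a hyperplane.\<close>

lemma linear_form_mem_ideal2_iff:
  assumes d: "dual_vectors u u' e e'"
  shows "linear_form c \<in> ideal2 (linear_form u) (linear_form u')
    \<longleftrightarrow> (\<forall>v. pairing u v = 0 \<longrightarrow> pairing u' v = 0 \<longrightarrow> pairing c v = 0)"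
    (is "?l \<longleftrightarrow> ?r")
proof
  assume ?l
  moreover have "restrict_hyp u' e' (restrict_hyp u e (linear_form c))
      = linear_form (c - pairing c e *s u - pairing c e' *s u')"
    using d by (simp add: restrict_hyp_linear_form dual_vectors_def linear_form_diff linear_form_add linear_form_smult algebra_simps)
  ultimately have "linear_form (c - pairing c e *s u - pairing c e' *s u') = 0"
    using mem_ideal2_linear_forms_iff[OF d] by simp
  then have eq: "c = pairing c e *s u + pairing c e' *s u'"
    unfolding linear_form_eq_0_iff diff_diff_eq right_minus_eq .
  show ?r
  proof (intro allI impI)
    fix v assume "pairing u v = 0" "pairing u' v = 0"
    then show "pairing c v = 0"
      using arg_cong[OF eq, of "\<lambda>x. pairing x v"] by (simp add: pairing_add_left pairing_smult_left)
  qed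
next
  assume ?r
  then have "linear_form c = const (pairing c e) * linear_form u + const (pairing c e') * linear_form u'"
    using eq_combination_of_dual[OF d, of c] by (metis linear_form_add linear_form_smult)
  then show ?l by (simp add: ideal2I)
qed

lemma not_linear_form_dvd:
  assumes "dual_vectors u u' e e'"
  shows "\<not> linear_form u dvd linear_form u'"
  using assms by (simp add: linear_form_dvd_iff[of u e] dual_vectors_def restrict_hyp_linear_form
      linear_form_eq_0_iff dual_vectors_nonzero[OF assms])

lemma prod_linear_form_dvd:
  assumes "finite A" "\<And>H K. H \<in> A \<Longrightarrow> K \<in> A \<Longrightarrow> H \<noteq> K \<Longrightarrow> \<not> linear_form (a H) dvd linear_form (a K)"
    and "\<And>H. H \<in> A \<Longrightarrow> a H \<noteq> 0" "\<And>H. H \<in> A \<Longrightarrow> linear_form (a H) dvd q"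
  shows "(\<Prod>H\<in>A. linear_form (a H)) dvd q"
  using assms
proof (induction A rule: finite_induct)
  case (insert H A)
  then obtain r where r: "q = (\<Prod>K\<in>A. linear_form (a K)) * r" by (auto elim: dvdE)
  have "linear_form (a H) dvd (\<Prod>K\<in>A. linear_form (a K)) * r" using insert.prems(3)[of H] r by simp
  then have "linear_form (a H) dvd r"
    using linear_form_prime[of "a H"] linear_form_prime_prod[of "a H" "\<lambda>K. linear_form (a K)" A]
      insert.prems(1,2) insert.hyps by blast
  then show ?case using r insert.hyps by (auto simp: mult_ac elim!: dvdE)
qed auto

text \<open>For an ideal \<open>I\<close>: \<open>h\<close> is a nonzerodivisor modulo
  \<open>I\<close>. If this holds for all \<open>h\<close> outside a prime, then \<open>I\<close> is
  the contraction of its localisation at that prime.\<close>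

definition saturated :: "('x::finite, 'k::field) mpoly set \<Rightarrow> ('x, 'k) mpoly \<Rightarrow> bool" where
  "saturated I h \<longleftrightarrow> (\<forall>p. h * p \<in> I \<longrightarrow> p \<in> I)"

lemma saturatedD: "saturated I h \<Longrightarrow> h * p \<in> I \<Longrightarrow> p \<in> I"
  by (simp add: saturated_def)

text \<open>As \<open>p\<close> is a nonzerodivisor modulo \<open>r\<close>, multiplication by
  \<open>p\<close> embeds S/(q, r) into S/(pq, r) with cokernel S/(p, r). A nonzerodivisor on both
  ends is one in the middle.\<close>

lemma saturated_ideal2_mult:
  assumes "saturated (ideal2 p r) h" "saturated (ideal2 q r) h"
    and cop: "\<And>y. r dvd p * y \<Longrightarrow> r dvd y"
  shows "saturated (ideal2 (p * q) r) h"
  unfolding saturated_def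
proof (intro allI impI)
  fix y assume "h * y \<in> ideal2 (p * q) r"
  then obtain s t where st: "h * y = s * (p * q) + t * r" by (rule ideal2E)
  then have "h * y = (s * q) * p + t * r" by (simp add: mult_ac)
  then have "y \<in> ideal2 p r" using saturatedD[OF assms(1)] by (simp add: ideal2I)
  then obtain c d where y: "y = c * p + d * r" by (rule ideal2E)
  have "p * (h * c - s * q) = r * (t - h * d)" using st y by (simp add: algebra_simps)
  then have "r dvd h * c - s * q" using cop by (metis dvd_triv_left)
  then obtain z where "h * c - s * q = r * z" by (elim dvdE)
  then have "h * c = s * q + z * r" by (simp add: algebra_simps)
  then have "c \<in> ideal2 q r" using saturatedD[OF assms(2)] by (simp add: ideal2I)
  then obtain c1 c2 where "c = c1 * q + c2 * r" by (rule ideal2E)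
  then have "y = c1 * (p * q) + (c2 * p + d) * r" using y by (simp add: algebra_simps)
  then show "y \<in> ideal2 (p * q) r" by (simp only: ideal2I)
qed

lemma saturated_ideal2_prod:
  assumes "finite A" "\<And>i. i \<in> A \<Longrightarrow> saturated (ideal2 (p i) r) h"
    and "\<And>i y. i \<in> A \<Longrightarrow> r dvd p i * y \<Longrightarrow> r dvd y"
  shows "saturated (ideal2 (prod p A) r) h"
  using assms
proof (induction A rule: finite_induct)
  case empty
  have "y \<in> ideal2 1 r" for y :: "('b, 'c) mpoly" using ideal2_mult[of 1 1 r y] by simp
  then show ?case by (simp add: saturated_def)
next
  case (insert i A)
  then show ?case by (auto intro!: saturated_ideal2_mult)
qed

lemma dvd_cancel_linear_form:
  assumes "r dvd linear_form u * y" "\<not> linear_form u dvd r" "u \<noteq> 0"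
  shows "r dvd y"
proof -
  obtain z where z: "linear_form u * y = r * z" using assms(1) by (elim dvdE)
  then have "linear_form u dvd r * z" by (metis dvd_triv_left)
  then have "linear_form u dvd z" using linear_form_prime assms(2,3) by blast
  then obtain z' where "z = linear_form u * z'" by (elim dvdE)
  then have "linear_form u * y = linear_form u * (r * z')" using z by (simp add: mult_ac)
  then have "y = r * z'" using mpoly_mult_left_cancel assms(3) linear_form_eq_0_iff by metis
  then show ?thesis by simp
qed

text \<open>Eliminating \<open>G'\<close> between the relation and the Euler formula gives
  \<open>G * (p * v - q * u) = - g * q\<close>. Coprimality of \<open>G\<close> and \<open>g\<close>
  then makes \<open>p * v - q * u\<close> a multiple of \<open>g\<close>, and the quotient is the
  desired \<open>r\<close>.\<close>

lemma koszul_relation: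
  fixes G G' :: "('x::finite, 'k::field) mpoly"
  assumes "u * G + v * G' = g" "g \<noteq> 0" "G \<noteq> 0" "\<And>y. g dvd G * y \<Longrightarrow> g dvd y"
    and "p * G + q * G' = 0"
  shows "\<exists>r. p = r * G' \<and> q = - (r * G)"
proof -
  have "G * (p * v - q * u) = v * (p * G + q * G') - q * (u * G + v * G')"
    by (simp add: algebra_simps)
  also have "\<dots> = g * (- q)" using assms(1,5) by simp
  finally have eq: "G * (p * v - q * u) = g * (- q)" .
  then have "g dvd p * v - q * u" using assms(4) by (metis dvd_triv_left)
  then obtain r where "p * v - q * u = g * r" by (elim dvdE)
  then have "g * (- q) = g * (r * G)" using eq by (simp add: mult_ac)
  then have q: "- q = r * G" using assms(2) mpoly_mult_left_cancel by blast
  then have "q = - (r * G)" by (metis minus_minus)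
  moreover from this have "G * p = G * (r * G')" using assms(5) by (simp add: algebra_simps)
  then have "p = r * G'" using assms(3) mpoly_mult_left_cancel by blast
  ultimately show ?thesis by blast
qed

text \<open>Modulo \<open>linear_form (a H)\<close> only the summand of the product rule that
  differentiates this factor survives.\<close>

lemma linear_form_dvd_deriv_diff:
  assumes "finite b" "H \<in> b"
  shows "linear_form (a H) dvd directional_deriv y (\<Prod>K\<in>b. linear_form (a K))
    - const (pairing (a H) y) * (\<Prod>K\<in>b - {H}. linear_form (a K))"
proof -
  have "directional_deriv y (\<Prod>K\<in>b. linear_form (a K)) - const (pairing (a H) y) * (\<Prod>K\<in>b - {H}. linear_form (a K))
     = (\<Sum>L\<in>b - {H}. const (pairing (a L) y) * (\<Prod>K\<in>b - {L}. linear_form (a K)))"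
    unfolding directional_deriv_prod_linear_form[OF assms(1)] by (subst sum.remove[OF assms]) simp
  also have "linear_form (a H) dvd \<dots>"
    by (intro dvd_sum dvd_mult dvd_prodI) (use assms in auto)
  finally show ?thesis .
qed

text \<open>\<open>w\<close> is a direction transversal to all hyperplanes of the pencil;
  \<open>H1\<close> and \<open>H2\<close> provide a basis of the two-dimensional space spanned by
  its forms.\<close>

locale pencil =
  fixes b :: "'i set" and a :: "'i \<Rightarrow> 'k::field_char_0 ^ 'x::finite" and w :: "'k ^ 'x" and H1 H2 :: 'i
  assumes fin: "finite b" and H: "H1 \<in> b" "H2 \<in> b" "H1 \<noteq> H2"
    and dual: "\<And>H K. H \<in> b \<Longrightarrow> K \<in> b \<Longrightarrow> H \<noteq> K \<Longrightarrow> \<exists>e e'. dual_vectors (a H) (a K) e e'"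
    and span: "\<And>H K L. H \<in> b \<Longrightarrow> K \<in> b \<Longrightarrow> L \<in> b \<Longrightarrow> H \<noteq> K \<Longrightarrow>
      linear_form (a L) \<in> ideal2 (linear_form (a H)) (linear_form (a K))"
    and w: "\<And>H. H \<in> b \<Longrightarrow> pairing (a H) w \<noteq> 0"
begin

abbreviation l where "l H \<equiv> linear_form (a H)"
definition g where "g = (\<Prod>H\<in>b. l H)"
abbreviation G where "G \<equiv> directional_deriv w g"
abbreviation centre where "centre \<equiv> ideal2 (l H1) (l H2)"

lemma a_nonzero: "H \<in> b \<Longrightarrow> a H \<noteq> 0"
  using w by (force simp: pairing_def)

lemma not_dvd: "H \<in> b \<Longrightarrow> K \<in> b \<Longrightarrow> H \<noteq> K \<Longrightarrow> \<not> l H dvd l K"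
  using dual not_linear_form_dvd by blast

lemma ideal2_eq_centre:
  assumes "H \<in> b" "K \<in> b" "H \<noteq> K"
  shows "ideal2 (l H) (l K) = centre"
  using ideal2_least[OF span[OF H(1,2) assms(1) H(3)] span[OF H(1,2) assms(2) H(3)]]
    ideal2_least[OF span[OF assms(1,2) H(1) assms(3)] span[OF assms(1,2) H(2) assms(3)]]
  by (rule equalityI)

text \<open>By transversality of \<open>w\<close>, modulo \<open>l H\<close> the derivative
  \<open>G\<close> is a nonzero constant times the product of the other forms.\<close>

lemma not_dvd_G:
  assumes "H \<in> b"
  shows "\<not> l H dvd G"
proof
  assume "l H dvd G"
  then have "l H dvd const (pairing (a H) w) * (\<Prod>K\<in>b - {H}. l K)"
    using linear_form_dvd_deriv_diff[OF fin assms, of a w] dvd_diff[of "l H" G] unfolding g_def by fastforce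
  then have "l H dvd const (pairing (a H) w) \<or> l H dvd (\<Prod>K\<in>b - {H}. l K)"
    using linear_form_prime a_nonzero assms by blast
  moreover have "\<not> l H dvd (\<Prod>K\<in>b - {H}. l K)"
    using linear_form_prime_prod[of "a H" l "b - {H}"] not_dvd assms a_nonzero fin by blast
  moreover obtain e where "pairing (a H) e = 1" using ex_pairing_eq_1[OF a_nonzero[OF assms]] by blast
  then have "\<not> l H dvd const (pairing (a H) w)"
    using w[OF assms] by (simp add: linear_form_dvd_iff)
  ultimately show False by blast
qed

text \<open>Splitting \<open>g\<close> into factors reduces the claim to the ideals (l_H, G). Modulo
  \<open>l H\<close> the second generator may be replaced by the product of the other forms, and
  splitting this product leaves only ideals (l_K, l_H), all equal to the prime
  \<open>centre\<close>.\<close>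

lemma saturated_g_G:
  assumes h: "h \<notin> centre"
  shows "saturated (ideal2 g G) h"
  unfolding g_def
proof (rule saturated_ideal2_prod[OF fin], fold g_def)
  fix H assume H: "H \<in> b"
  show "G dvd y" if "G dvd l H * y" for y
    using dvd_cancel_linear_form[OF that not_dvd_G[OF H] a_nonzero[OF H]] .
  let ?r = "\<Prod>K\<in>b - {H}. l K" and ?c = "pairing (a H) w"
  obtain z where z: "G - const ?c * ?r = l H * z"
    using linear_form_dvd_deriv_diff[OF fin H, of a w] unfolding g_def by (elim dvdE)
  then have "G = z * l H + const ?c * ?r" by (simp add: algebra_simps)
  moreover have "?r = (- const (inverse ?c) * z) * l H + const (inverse ?c) * G"
  proof -
    have "const (inverse ?c) * G - const (inverse ?c) * (l H * z) = (const ?c * const (inverse ?c)) * ?r"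
      unfolding z[symmetric] by (simp add: algebra_simps)
    then show ?thesis unfolding const_mult_inverse[OF w[OF H]] by (simp add: algebra_simps)
  qed
  ultimately have G_eq: "ideal2 (l H) G = ideal2 ?r (l H)"
    unfolding ideal2_commute[of ?r] by (intro equalityI ideal2_least gens_in_ideal2) (metis ideal2I)+
  have "saturated (ideal2 ?r (l H)) h"
  proof (rule saturated_ideal2_prod)
    fix K assume K: "K \<in> b - {H}"
    obtain e e' where d: "dual_vectors (a K) (a H) e e'" using dual K H by blast
    show "saturated (ideal2 (l K) (l H)) h"
      using linear_forms_prime[OF d] ideal2_eq_centre[of K H] K H h by (auto simp: saturated_def)
    show "l H dvd y" if "l H dvd l K * y" for y
      using dvd_cancel_linear_form[OF that] not_dvd K H a_nonzero by blast
  qed (use fin in simp)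
  then show "saturated (ideal2 (l H) G) h" by (simp only: G_eq)
qed

lemma g_nonzero: "g \<noteq> 0"
  using fin a_nonzero by (simp add: g_def mpoly_prod_eq_0_iff linear_form_eq_0_iff)

lemma G_nonzero: "G \<noteq> 0"
  using not_dvd_G[OF H(1)] by force

lemma g_dvd_cancel_G:
  assumes "g dvd G * y"
  shows "g dvd y"
  unfolding g_def
proof (rule prod_linear_form_dvd)
  fix H assume H: "H \<in> b"
  have "l H dvd g" unfolding g_def by (rule dvd_prodI[OF fin H])
  then have "l H dvd G * y" using assms by (rule dvd_trans)
  then show "l H dvd y" using linear_form_prime a_nonzero not_dvd_G H by blast
qed (use fin not_dvd a_nonzero in auto)

text \<open>The forms of the pencil span a plane, so two directions suffice for all derivatives. The
  transversal \<open>w\<close> is complemented by a direction \<open>z\<close> tangent to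
  \<open>H1\<close> but not to \<open>H2\<close>.\<close>

lemma jacobian:
  obtains z u v where
    "linear_form u * G + linear_form v * directional_deriv z g = g"
    "\<And>y. directional_deriv y g \<in> ideal2 G (directional_deriv z g)"
    "\<And>h. h \<notin> centre \<Longrightarrow> saturated (ideal2 G (directional_deriv z g)) h"
proof -
  obtain e z where d: "dual_vectors (a H1) (a H2) e z" using dual H by blast
  \<comment> \<open>\<open>u0\<close> and \<open>v0\<close> are the basis of the span of the forms
    that is dual to \<open>w\<close> and \<open>z\<close>: \<open>u0\<close> takes the values 1 and
    0 there, \<open>v0\<close> the values 0 and 1.\<close>
  define c where "c = pairing (a H2) w / pairing (a H1) w"
  define u0 where "u0 = inverse (pairing (a H1) w) *s a H1"
  define v0 where "v0 = a H2 - c *s a H1"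
  define t where "t = (of_nat (card b) :: 'k)"
  have t0: "t \<noteq> 0" using fin H by (auto simp: t_def)
  let ?G' = "directional_deriv z g"
  have comb: "a H = pairing (a H) w *s u0 + pairing (a H) z *s v0" if HH: "H \<in> b" for H
  proof -
    have "\<forall>v. pairing (a H1) v = 0 \<longrightarrow> pairing (a H2) v = 0 \<longrightarrow> pairing (a H) v = 0"
      using span[OF H(1,2) HH H(3)] linear_form_mem_ideal2_iff[OF d] by blast
    then have eq: "a H = pairing (a H) e *s a H1 + pairing (a H) z *s a H2"
      using eq_combination_of_dual[OF d] by blast
    then have "pairing (a H) w = pairing (a H) e * pairing (a H1) w + pairing (a H) z * pairing (a H2) w"
      by (metis pairing_add_left pairing_smult_left)
    then have co: "pairing (a H) w * inverse (pairing (a H1) w) = pairing (a H) e + pairing (a H) z * c"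
      using w[OF H(1)] by (simp add: c_def field_simps)
    have "pairing (a H) w *s u0 + pairing (a H) z *s v0
      = (pairing (a H) w * inverse (pairing (a H1) w) - pairing (a H) z * c) *s a H1 + pairing (a H) z *s a H2"
      by (simp add: u0_def v0_def vec_eq_iff algebra_simps)
    also have "\<dots> = a H" using eq unfolding co by simp
    finally show ?thesis by simp
  qed
  have deriv: "directional_deriv y g = const (pairing u0 y) * G + const (pairing v0 y) * ?G'" for y
  proof -
    let ?r = "\<lambda>H. \<Prod>K\<in>b - {H}. l K"
    have "const (pairing (a H) y) * ?r H = const (pairing u0 y) * (const (pairing (a H) w) * ?r H)
        + const (pairing v0 y) * (const (pairing (a H) z) * ?r H)" if "H \<in> b" for H
    proof -
      have "pairing (a H) y = pairing u0 y * pairing (a H) w + pairing v0 y * pairing (a H) z"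
        by (subst comb[OF that]) (simp add: pairing_add_left pairing_smult_left)
      then show ?thesis by (simp only: const_add const_mult distrib_right mult.assoc)
    qed
    then show ?thesis
      unfolding g_def directional_deriv_prod_linear_form[OF fin] sum_distrib_left sum.distrib[symmetric]
      by (rule sum.cong[OF refl])
  qed
  have "const t * g = (\<Sum>H\<in>b. l H * (\<Prod>K\<in>b - {H}. l K))"
  proof -
    have "(\<Sum>H\<in>b. l H * (\<Prod>K\<in>b - {H}. l K)) = (\<Sum>H\<in>b. g)"
      unfolding g_def using fin by (intro sum.cong) (simp_all add: prod.remove)
    then show ?thesis by (simp add: t_def)
  qed
  also have "\<dots> = (\<Sum>H\<in>b. (const (pairing (a H) w) * linear_form u0 + const (pairing (a H) z) * linear_form v0)
      * (\<Prod>K\<in>b - {H}. l K))"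
    by (intro sum.cong refl arg_cong2[where f = "(*)"]) (metis comb linear_form_add linear_form_smult)
  also have "\<dots> = linear_form u0 * G + linear_form v0 * ?G'"
    unfolding g_def directional_deriv_prod_linear_form[OF fin]
    by (simp add: sum_distrib_left sum.distrib[symmetric] algebra_simps)
  finally have euler: "const t * g = linear_form u0 * G + linear_form v0 * ?G'" .
  define u where "u = inverse t *s u0"
  define v where "v = inverse t *s v0"
  have euler': "linear_form u * G + linear_form v * ?G' = g"
  proof -
    have "linear_form u * G + linear_form v * ?G' = const (inverse t) * (linear_form u0 * G + linear_form v0 * ?G')"
      by (simp add: u_def v_def linear_form_smult algebra_simps)
    also have "\<dots> = (const t * const (inverse t)) * g"
      unfolding euler[symmetric] by (simp only: mult_ac)
    also have "\<dots> = g" unfolding const_mult_inverse[OF t0] by simp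
    finally show ?thesis .
  qed
  have v0w: "pairing v0 w = 0" using w[OF H(1)] by (simp add: v0_def c_def pairing_diff_left pairing_smult_left)
  have v0z: "pairing v0 z = 1" using d by (simp add: v0_def dual_vectors_def pairing_diff_left pairing_smult_left)
  have v: "v \<noteq> 0" "pairing v w = 0"
    using t0 v0z v0w by (auto simp: v_def pairing_smult_left) (auto simp: pairing_def)
  \<comment> \<open>By Euler's formula a common factor would divide \<open>g\<close> and so be
    proportional to some \<open>l H\<close>; but \<open>v\<close> vanishes at \<open>w\<close> and
    \<open>a H\<close> does not.\<close>
  have vG: "\<not> linear_form v dvd G"
  proof
    assume "linear_form v dvd G"
    then have "linear_form v dvd g" by (metis euler' dvd_add dvd_mult dvd_triv_left)
    then obtain H where H: "H \<in> b" "linear_form v dvd l H"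
      unfolding g_def using linear_form_prime_prod[OF _ v(1) fin] by blast
    obtain e' where e': "pairing v e' = 1" using ex_pairing_eq_1 v by blast
    then have "linear_form (a H - pairing (a H) e' *s v) = 0"
      using H(2) by (simp add: linear_form_dvd_iff restrict_hyp_linear_form linear_form_diff linear_form_smult)
    then have "a H = pairing (a H) e' *s v" by (simp add: linear_form_eq_0_iff)
    then have "pairing (a H) w = 0" using v(2) pairing_smult_left by (metis mult_zero_right)
    then show False using w H(1) by blast
  qed
  show thesis
  proof (rule that[OF euler'])
    show "directional_deriv y g \<in> ideal2 G ?G'" for y unfolding deriv[of y] by (rule ideal2I)
    fix h assume h: "h \<notin> centre"
    show "saturated (ideal2 G ?G') h"
      unfolding saturated_def
    proof (intro allI impI)
      fix p assume "h * p \<in> ideal2 G ?G'"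
      then obtain r s where rs: "h * p = r * G + s * ?G'" by (rule ideal2E)
      \<comment> \<open>Multiplication by \<open>linear_form v\<close> turns a multiple of
        \<open>?G'\<close> into one of \<open>g\<close> modulo \<open>G\<close>. So the known
        saturation of (g, G) applies, and \<open>linear_form v\<close> is cancelled
        afterwards.\<close>
      have "h * (linear_form v * p) = linear_form v * (h * p)" by (simp add: mult_ac)
      also have "\<dots> = s * (linear_form u * G + linear_form v * ?G') + (linear_form v * r - s * linear_form u) * G"
        unfolding rs by (simp add: algebra_simps)
      finally have "h * (linear_form v * p) = s * g + (linear_form v * r - s * linear_form u) * G"
        unfolding euler' .
      then have "linear_form v * p \<in> ideal2 g G"
        using saturatedD[OF saturated_g_G[OF h]] by (simp add: ideal2I)
      then obtain c d where "linear_form v * p = c * g + d * G" by (rule ideal2E)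
      also have "\<dots> = c * (linear_form u * G + linear_form v * ?G') + d * G" unfolding euler' ..
      finally have eq: "linear_form v * (p - c * ?G') = (c * linear_form u + d) * G"
        by (simp add: algebra_simps)
      then have "linear_form v dvd (c * linear_form u + d) * G" by (metis dvd_triv_left)
      then have "linear_form v dvd c * linear_form u + d" using linear_form_prime v vG by blast
      then obtain k where k: "c * linear_form u + d = linear_form v * k" by (elim dvdE)
      have "linear_form v * (p - c * ?G') = linear_form v * (k * G)" unfolding eq k by (simp add: mult_ac)
      then have "p - c * ?G' = k * G"
        using mpoly_mult_left_cancel v(1) linear_form_eq_0_iff by metis
      then have "p = k * G + c * ?G'" by (simp add: algebra_simps)
      then show "p \<in> ideal2 G ?G'" by (simp only: ideal2I)
    qed
  qed
qed

end

text \<open>A line \<open>w + c *s y\<close> not contained in the new hyperplane meets each kernel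
  involved in at most one point, and the field is infinite.\<close>

lemma ex_generic_vector:
  fixes a :: "'i \<Rightarrow> 'k::field_char_0 ^ 'x::finite"
  assumes "finite A" "\<And>H. H \<in> A \<Longrightarrow> a H \<noteq> 0"
  shows "\<exists>w. \<forall>H\<in>A. pairing (a H) w \<noteq> 0"
  using assms
proof (induction A rule: finite_induct)
  case (insert H A)
  then obtain w where w: "\<forall>H\<in>A. pairing (a H) w \<noteq> 0" by auto
  obtain y where y: "pairing (a H) y = 1" using ex_pairing_eq_1 insert.prems by blast
  \<comment> \<open>The values of \<open>c\<close> at which some form vanishes on the line. If a
    form is constant along the line, division by zero merely excludes \<open>c = 0\<close>.\<close>
  let ?bad = "insert (- pairing (a H) w) ((\<lambda>K. - pairing (a K) w / pairing (a K) y) ` A)"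
  obtain c where c: "c \<notin> ?bad"
    using ex_new_if_finite[OF infinite_UNIV_char_0, of ?bad] insert.hyps by auto
  have "pairing (a K) (w + c *s y) \<noteq> 0" if "K \<in> insert H A" for K
  proof
    assume "pairing (a K) (w + c *s y) = 0"
    then have eq: "pairing (a K) w + c * pairing (a K) y = 0"
      by (simp add: pairing_add_right pairing_smult_right)
    show False
    proof (cases "K = H")
      case True
      then show ?thesis using c eq y by (simp add: eq_neg_iff_add_eq_0 add.commute)
    next
      case False
      then have K: "K \<in> A" using that by simp
      then have "pairing (a K) y \<noteq> 0" using eq w by auto
      then have "c = - pairing (a K) w / pairing (a K) y"
        using eq by (simp add: field_simps eq_neg_iff_add_eq_0 add.commute)
      then show ?thesis using c K by blast
    qed
  qed
  then show ?case by blast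
qed auto

section \<open>The top-dimensional part for disconnected pencils\<close>

text \<open>The blocks \<open>blk (Inl p)\<close> are the pencils, the blocks \<open>blk (Inr q)\<close> the remaining hyperplanes.\<close>

locale disconnected_pencils =
  fixes P :: "'p set" and Q :: "'q set" and blk :: "'p + 'q \<Rightarrow> 'i set" and A :: "'i set"
    and a :: "'i \<Rightarrow> 'k::field_char_0 ^ 'x::finite"
  assumes finite_P: "finite P" and finite_Q: "finite Q" and nonempty: "P <+> Q \<noteq> {}"
    and finite_A: "finite A" and A_eq: "A = \<Union>(blk ` (P <+> Q))"
    and disjoint: "\<And>i j. i \<in> P <+> Q \<Longrightarrow> j \<in> P <+> Q \<Longrightarrow> i \<noteq> j \<Longrightarrow> blk i \<inter> blk j = {}"
    and card_pencil: "\<And>p. p \<in> P \<Longrightarrow> card (blk (Inl p)) \<ge> 2"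
    and singleton: "\<And>q. q \<in> Q \<Longrightarrow> \<exists>H. blk (Inr q) = {H}"
    and nonzero: "\<And>H. H \<in> A \<Longrightarrow> a H \<noteq> 0"
    and dual: "\<And>H K. H \<in> A \<Longrightarrow> K \<in> A \<Longrightarrow> H \<noteq> K \<Longrightarrow> \<exists>e e'. dual_vectors (a H) (a K) e e'"
    and flat_same: "\<And>j H K L. j \<in> P <+> Q \<Longrightarrow> H \<in> blk j \<Longrightarrow> K \<in> blk j \<Longrightarrow> H \<noteq> K \<Longrightarrow> L \<in> A \<Longrightarrow>
      linear_form (a L) \<in> ideal2 (linear_form (a H)) (linear_form (a K)) \<longleftrightarrow> L \<in> blk j"
    and flat_diff: "\<And>i j H K L. i \<in> P <+> Q \<Longrightarrow> j \<in> P <+> Q \<Longrightarrow> i \<noteq> j \<Longrightarrow> H \<in> blk i \<Longrightarrow> K \<in> blk j \<Longrightarrow> L \<in> A \<Longrightarrow>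
      linear_form (a L) \<in> ideal2 (linear_form (a H)) (linear_form (a K)) \<longleftrightarrow> L = H \<or> L = K"
begin

abbreviation J where "J \<equiv> P <+> Q"
abbreviation l where "l H \<equiv> linear_form (a H)"
definition f where "f = (\<Prod>H\<in>A. l H)"
definition g where "g j = (\<Prod>H\<in>blk j. l H)"
definition F where "F j = (\<Prod>H\<in>A - blk j. l H)"

lemma finite_J: "finite J"
  using finite_P finite_Q by simp

lemma blk_subset: "j \<in> J \<Longrightarrow> blk j \<subseteq> A"
  unfolding A_eq by blast

lemma finite_blk: "j \<in> J \<Longrightarrow> finite (blk j)"
  using blk_subset finite_A finite_subset by blast

lemma ex_blk: "H \<in> A \<Longrightarrow> \<exists>j\<in>J. H \<in> blk j"
  unfolding A_eq by blast

lemma blk_unique: "i \<in> J \<Longrightarrow> j \<in> J \<Longrightarrow> H \<in> blk i \<Longrightarrow> H \<in> blk j \<Longrightarrow> i = j"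
  using disjoint by blast

lemma blk_nonempty:
  assumes "j \<in> J"
  shows "blk j \<noteq> {}"
proof (cases j)
  case (Inl p)
  then show ?thesis using assms card_pencil[of p] by auto
next
  case (Inr q)
  then show ?thesis using assms singleton[of q] by auto
qed

lemma A_nonempty: "A \<noteq> {}"
  using nonempty blk_nonempty unfolding A_eq by blast

lemma f_eq: "j \<in> J \<Longrightarrow> f = g j * F j"
  unfolding f_def g_def F_def using blk_subset finite_A by (metis mult.commute prod.subset_diff)

lemma f_nonzero: "f \<noteq> 0"
  unfolding f_def using finite_A nonzero by (simp add: mpoly_prod_eq_0_iff linear_form_eq_0_iff)

lemma g_nonzero: "j \<in> J \<Longrightarrow> g j \<noteq> 0"
  using f_nonzero f_eq by fastforce

lemma g_dvd_F:
  assumes "i \<in> J" "j \<in> J" "i \<noteq> j"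
  shows "g j dvd F i"
  unfolding g_def F_def
  by (rule prod_dvd_prod_subset) (use assms blk_subset disjoint finite_A in blast)+

lemma l_dvd_F: "H \<in> A \<Longrightarrow> H \<notin> blk j \<Longrightarrow> l H dvd F j"
  unfolding F_def using finite_A by (intro dvd_prodI) auto

lemma not_dvd: "H \<in> A \<Longrightarrow> K \<in> A \<Longrightarrow> H \<noteq> K \<Longrightarrow> \<not> l H dvd l K"
  using dual not_linear_form_dvd by blast

lemma prime_pair: "H \<in> A \<Longrightarrow> K \<in> A \<Longrightarrow> H \<noteq> K \<Longrightarrow> mpoly_prime (ideal2 (l H) (l K))"
  using dual mpoly_prime_linear_forms by blast

text \<open>No hyperplane outside the pencil contains its centre. Thus \<open>F j\<close> is a unit
  in the localisation there, and \<open>g j\<close> can take the place of \<open>f\<close>.\<close>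

lemma F_notin_flat:
  assumes "j \<in> J" "H \<in> blk j" "K \<in> blk j" "H \<noteq> K"
  shows "F j \<notin> ideal2 (l H) (l K)"
proof
  assume "F j \<in> ideal2 (l H) (l K)"
  moreover have "mpoly_prime (ideal2 (l H) (l K))" using assms blk_subset prime_pair by blast
  ultimately obtain L where "L \<in> A - blk j" "l L \<in> ideal2 (l H) (l K)"
    unfolding F_def using mpoly_prime_prod finite_A by blast
  then show False using flat_same assms by blast
qed

text \<open>Two hyperplanes of different blocks meet in a flat that lies on no third hyperplane, so
  the remaining factors of \<open>f\<close> are units there.\<close>

lemma prod_notin_flat:
  assumes "i \<in> J" "j \<in> J" "i \<noteq> j" "H \<in> blk i" "K \<in> blk j" "c \<subseteq> A - {H, K}"
  shows "(\<Prod>L\<in>c. l L) \<notin> ideal2 (l H) (l K)"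
proof
  assume "(\<Prod>L\<in>c. l L) \<in> ideal2 (l H) (l K)"
  moreover have "H \<noteq> K" using assms disjoint by blast
  then have "mpoly_prime (ideal2 (l H) (l K))" using assms blk_subset prime_pair by blast
  moreover have "finite c" using assms(6) finite_A finite_subset by blast
  ultimately obtain L where "L \<in> c" "l L \<in> ideal2 (l H) (l K)"
    using mpoly_prime_prod by blast
  then show False using flat_diff assms by blast
qed

end

text \<open>Fixes for each block two generators of its Jacobian ideal and the Euler coefficients. A
  single hyperplane is fitted into the same scheme with a constant \<open>G\<close>,
  \<open>G' = 0\<close> and \<open>v = 0\<close>.\<close>

locale disconnected_pencils_jacobian = disconnected_pencils P Q blk A a
  for P :: "'p set" and Q :: "'q set" and blk :: "'p + 'q \<Rightarrow> 'i set" and A :: "'i set"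
    and a :: "'i \<Rightarrow> 'k::field_char_0 ^ 'x::finite" +
  fixes G G' u v :: "'p + 'q \<Rightarrow> ('x, 'k) mpoly"
  assumes euler: "\<And>j. j \<in> P <+> Q \<Longrightarrow> u j * G j + v j * G' j = g j"
    and G_deriv: "\<And>j. j \<in> P <+> Q \<Longrightarrow> \<exists>y. G j = directional_deriv y (g j)"
    and G'_deriv: "\<And>j. j \<in> P <+> Q \<Longrightarrow> \<exists>y. G' j = directional_deriv y (g j)"
    and deriv: "\<And>j y. j \<in> P <+> Q \<Longrightarrow> directional_deriv y (g j) \<in> ideal2 (G j) (G' j)"
    and saturated: "\<And>j H K h. j \<in> P <+> Q \<Longrightarrow> H \<in> blk j \<Longrightarrow> K \<in> blk j \<Longrightarrow> H \<noteq> K \<Longrightarrow>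
      h \<notin> ideal2 (l H) (l K) \<Longrightarrow> saturated (ideal2 (G j) (G' j)) h"
    and koszul: "\<And>p r s. p \<in> P \<Longrightarrow> r * G (Inl p) + s * G' (Inl p) = 0 \<Longrightarrow>
      \<exists>t. r = t * G' (Inl p) \<and> s = - (t * G (Inl p))"
    and G_nonzero: "\<And>j. j \<in> P <+> Q \<Longrightarrow> G j \<noteq> 0"
    and free: "\<And>q. q \<in> Q \<Longrightarrow> \<exists>c. c \<noteq> 0 \<and> G (Inr q) = const c" "\<And>q. q \<in> Q \<Longrightarrow> G' (Inr q) = 0"
      "\<And>q. q \<in> Q \<Longrightarrow> v (Inr q) = 0"
    and hom_uv: "\<And>j. j \<in> P <+> Q \<Longrightarrow> homogeneous 1 (u j)" "\<And>j. j \<in> P <+> Q \<Longrightarrow> homogeneous 1 (v j)"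
begin

text \<open>The sum of the ideals J_b F_b, to be identified with the top part.\<close>

definition Y where "Y = {\<Sum>j\<in>J. (r j * G j + s j * G' j) * F j | r s. True}"

lemma Y_I: "(\<Sum>j\<in>J. (r j * G j + s j * G' j) * F j) \<in> Y"
  unfolding Y_def by blast

lemma Y_add:
  assumes "p \<in> Y" "q \<in> Y"
  shows "p + q \<in> Y"
proof -
  obtain r s r' s' where "p = (\<Sum>j\<in>J. (r j * G j + s j * G' j) * F j)"
    "q = (\<Sum>j\<in>J. (r' j * G j + s' j * G' j) * F j)" using assms unfolding Y_def by blast
  then have "p + q = (\<Sum>j\<in>J. ((r j + r' j) * G j + (s j + s' j) * G' j) * F j)"
    by (simp add: algebra_simps flip: sum.distrib)
  then show ?thesis using Y_I[of "\<lambda>j. r j + r' j" "\<lambda>j. s j + s' j"] by simp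
qed

lemma Y_single:
  assumes "j \<in> J"
  shows "(r * G j + s * G' j) * F j \<in> Y"
proof -
  have "(\<Sum>i\<in>J. ((if i = j then r else 0) * G i + (if i = j then s else 0) * G' i) * F i)
      = (\<Sum>i\<in>J. if i = j then (r * G i + s * G' i) * F i else 0)"
    by (rule sum.cong) auto
  also have "\<dots> = (r * G j + s * G' j) * F j" using assms finite_J by simp
  finally show ?thesis using Y_I[of "\<lambda>i. if i = j then r else 0" "\<lambda>i. if i = j then s else 0"] by simp
qed

lemma Y_subset:
  assumes "mpoly_ideal I" "\<And>j. j \<in> J \<Longrightarrow> G j * F j \<in> I" "\<And>j. j \<in> J \<Longrightarrow> G' j * F j \<in> I"
  shows "Y \<subseteq> I"
proof
  fix p assume "p \<in> Y"
  then obtain r s where "p = (\<Sum>j\<in>J. (r j * G j + s j * G' j) * F j)" unfolding Y_def by blast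
  then have "p = (\<Sum>j\<in>J. r j * (G j * F j) + s j * (G' j * F j))" by (simp add: algebra_simps)
  also have "\<dots> \<in> I"
    by (rule mpoly_ideal_sum[OF assms(1)]) (intro mpoly_idealD(2)[OF assms(1)] mpoly_idealD(3)[OF assms(1)] assms(2,3))
  finally show "p \<in> I" .
qed

lemma g_mem: "j \<in> J \<Longrightarrow> g j \<in> ideal2 (G j) (G' j)"
  using euler ideal2I by metis

text \<open>A single hyperplane has the unit ideal as Jacobian ideal and imposes no condition; a
  pencil supplies two hyperplanes whose ideal is that of its centre.\<close>

lemma block_cases:
  assumes "j \<in> J"
  obtains H K where "H \<in> blk j" "K \<in> blk j" "H \<noteq> K" | "ideal2 (G j) (G' j) = UNIV"
proof (cases j)
  case (Inl p)
  then have "card (blk j) \<ge> 2" using assms card_pencil by auto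
  then have "\<not> card (blk j) \<le> Suc 0" by simp
  then obtain H K where "H \<in> blk j" "K \<in> blk j" "H \<noteq> K"
    using card_le_Suc0_iff_eq[OF finite_blk[OF assms]] by blast
  then show ?thesis using that by blast
next
  case (Inr q)
  then obtain c where c: "c \<noteq> 0" "G j = const c" using assms free(1)[of q] by auto
  have "p \<in> ideal2 (G j) (G' j)" for p
  proof -
    have "(p * const (inverse c)) * G j + 0 * G' j = (const c * const (inverse c)) * p"
      unfolding c(2) by (simp only: mult_ac mult_zero_left add.right_neutral)
    also have "\<dots> = p" unfolding const_mult_inverse[OF c(1)] by simp
    finally show ?thesis using ideal2I by metis
  qed
  then show ?thesis using that by blast
qed

text \<open>The key is that the conditions at pairs from different blocks place \<open>p\<close> in
  the ideal (g_j, F_j). This ideal is reached one linear form at a time.\<close>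

lemma mem_Y:
  assumes cross: "\<And>i j H K. i \<in> J \<Longrightarrow> j \<in> J \<Longrightarrow> i \<noteq> j \<Longrightarrow> H \<in> blk i \<Longrightarrow> K \<in> blk j \<Longrightarrow> p \<in> ideal2 (l H) (l K)"
    and jac: "\<And>j. j \<in> J \<Longrightarrow> p \<in> ideal2 (G j) (G' j)"
  shows "p \<in> Y"
proof -
  \<comment> \<open>Adjoining \<open>K\<close> to the product: the cofactor \<open>s\<close> times
    the old product lies in the prime (l_H, l_K), the product does not, so \<open>s\<close>
    does.\<close>
  have step1: "p \<in> ideal2 (l H) (\<Prod>K\<in>c. l K)" if j: "j \<in> J" "H \<in> blk j" and "finite c" "c \<subseteq> A - blk j" for j H c
    using that(3,4)
  proof (induction c rule: finite_induct)
    case empty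
    have "p = 0 * l H + p * 1" by simp
    then show ?case using ideal2I by (metis prod.empty)
  next
    case (insert K c)
    then obtain r s where rs: "p = r * l H + s * (\<Prod>K\<in>c. l K)" by (auto elim: ideal2E)
    obtain i where i: "i \<in> J" "K \<in> blk i" "i \<noteq> j" using insert.prems ex_blk by blast
    have "p - r * l H \<in> ideal2 (l H) (l K)"
      using cross[OF j(1) i(1) _ j(2) i(2)] i(3) by (intro ideal2_diff ideal2_mult gens_in_ideal2) auto
    then have "s * (\<Prod>K\<in>c. l K) \<in> ideal2 (l H) (l K)" unfolding rs by simp
    moreover have "(\<Prod>K\<in>c. l K) \<notin> ideal2 (l H) (l K)"
      by (rule prod_notin_flat[OF j(1) i(1) _ j(2) i(2)]) (use i insert j in auto)
    moreover have "mpoly_prime (ideal2 (l H) (l K))"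
      by (rule prime_pair) (use j insert blk_subset in auto)
    ultimately have "s \<in> ideal2 (l H) (l K)" using mpoly_primeD(3) by blast
    then obtain s1 s2 where "s = s1 * l H + s2 * l K" by (rule ideal2E)
    then have "p = (r + s1 * (\<Prod>K\<in>c. l K)) * l H + s2 * (l K * (\<Prod>K\<in>c. l K))"
      unfolding rs by (simp add: algebra_simps)
    then have "p \<in> ideal2 (l H) (l K * (\<Prod>K\<in>c. l K))" by (simp only: ideal2I)
    then show ?case using insert.hyps by simp
  qed
  \<comment> \<open>Adjoining \<open>H\<close> to the product \<open>?h\<close>: by
    \<open>step1\<close> the multiple \<open>?h * r\<close> of the cofactor lies in (F_j, l_H), and
    \<open>?h\<close> is a nonzerodivisor modulo this ideal.\<close>
  have step2: "p \<in> ideal2 (\<Prod>H\<in>c. l H) (F j)" if j: "j \<in> J" and "finite c" "c \<subseteq> blk j" for j c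
    using that(2,3)
  proof (induction c rule: finite_induct)
    case empty
    have "p = p * 1 + 0 * F j" by simp
    then show ?case using ideal2I by (metis prod.empty)
  next
    case (insert H c)
    let ?h = "\<Prod>H\<in>c. l H"
    obtain r s where rs: "p = r * ?h + s * F j" using insert by (auto elim: ideal2E)
    have H: "H \<in> blk j" "H \<in> A" using insert.prems blk_subset[OF j] by auto
    have "p \<in> ideal2 (l H) (F j)" unfolding F_def by (rule step1) (use j H finite_A in auto)
    then have "p - s * F j \<in> ideal2 (F j) (l H)"
      unfolding ideal2_commute[of "F j"] by (intro ideal2_diff ideal2_mult gens_in_ideal2)
    then have "?h * r \<in> ideal2 (F j) (l H)" unfolding rs by (simp add: mult.commute)
    moreover have "saturated (ideal2 (F j) (l H)) ?h"
      unfolding F_def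
    proof (rule saturated_ideal2_prod)
      fix K assume K: "K \<in> A - blk j"
      then have KA: "K \<in> A" "K \<noteq> H" using H by auto
      obtain i where i: "i \<in> J" "K \<in> blk i" "i \<noteq> j" using K ex_blk by blast
      have "?h \<notin> ideal2 (l K) (l H)"
        by (rule prod_notin_flat[OF i(1) j i(3) i(2) H(1)]) (use insert K blk_subset[OF j] in auto)
      then show "saturated (ideal2 (l K) (l H)) ?h"
        using mpoly_primeD(3)[OF prime_pair[OF KA(1) H(2) KA(2)]] unfolding saturated_def by blast
      show "l H dvd y" if "l H dvd l K * y" for y
        using dvd_cancel_linear_form[OF that not_dvd[OF KA(1) H(2) KA(2)] nonzero[OF KA(1)]] .
    qed (use finite_A in simp)
    ultimately have "r \<in> ideal2 (F j) (l H)" by (rule saturatedD[rotated])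
    then obtain r1 r2 where "r = r1 * F j + r2 * l H" by (rule ideal2E)
    then have "p = r2 * (l H * ?h) + (r1 * ?h + s) * F j" unfolding rs by (simp add: algebra_simps)
    then have "p \<in> ideal2 (l H * ?h) (F j)" by (simp only: ideal2I)
    then show ?case using insert.hyps by simp
  qed
  \<comment> \<open>Write \<open>p = b * g j + c * F j\<close>. Both \<open>p\<close> and
    \<open>g j\<close> lie in J_j, hence so does \<open>F j * c\<close>; for a pencil
    \<open>F j\<close> lies outside the centre and can be cancelled.\<close>
  have "\<exists>r s. g j dvd p - (r * G j + s * G' j) * F j" if j: "j \<in> J" for j
  proof -
    have "p \<in> ideal2 (g j) (F j)" unfolding g_def by (rule step2) (use j finite_blk in auto)
    then obtain b c where bc: "p = b * g j + c * F j" by (rule ideal2E)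
    have "p - b * g j \<in> ideal2 (G j) (G' j)"
      by (intro ideal2_diff ideal2_mult jac g_mem j)
    then have Fc: "F j * c \<in> ideal2 (G j) (G' j)" unfolding bc by (simp add: mult.commute)
    have "c \<in> ideal2 (G j) (G' j)"
      using j
    proof (cases rule: block_cases)
      case (1 H K)
      then show ?thesis using saturatedD[OF saturated[OF j 1 F_notin_flat[OF j 1]] Fc] by blast
    qed auto
    then obtain r s where "c = r * G j + s * G' j" by (rule ideal2E)
    then have "p - (r * G j + s * G' j) * F j = g j * b" unfolding bc by (simp add: mult.commute)
    then show ?thesis by (metis dvd_triv_left)
  qed
  then obtain r s where rs: "\<And>j. j \<in> J \<Longrightarrow> g j dvd p - (r j * G j + s j * G' j) * F j" by metis
  let ?y = "\<Sum>j\<in>J. (r j * G j + s j * G' j) * F j"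
  \<comment> \<open>The summands of the other blocks do not disturb the congruence modulo
    \<open>g j\<close>, because \<open>g j\<close> divides their factor \<open>F i\<close>.\<close>
  have "g j dvd p - ?y" if j: "j \<in> J" for j
  proof -
    have "p - ?y = (p - (r j * G j + s j * G' j) * F j) - (\<Sum>i\<in>J - {j}. (r i * G i + s i * G' i) * F i)"
      by (simp add: sum.remove[OF finite_J j])
    moreover have "g j dvd (\<Sum>i\<in>J - {j}. (r i * G i + s i * G' i) * F i)"
      using g_dvd_F j by (intro dvd_sum dvd_mult) auto
    ultimately show ?thesis using rs[OF j] by (simp only: dvd_diff)
  qed
  moreover have "l H dvd g j" if "H \<in> blk j" "j \<in> J" for H j
    unfolding g_def using that finite_blk by (intro dvd_prodI)
  ultimately have "l H dvd p - ?y" if "H \<in> A" for H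
    using ex_blk[OF that] dvd_trans by blast
  then have "f dvd p - ?y"
    unfolding f_def using finite_A not_dvd nonzero by (intro prod_linear_form_dvd)
  then obtain q where q: "p - ?y = f * q" by (elim dvdE)
  \<comment> \<open>Any block will do: its Euler formula expresses \<open>f\<close> as an element of
    J_j F_j.\<close>
  obtain j where j: "j \<in> J" using nonempty by blast
  have "f * q = ((q * u j) * G j + (q * v j) * G' j) * F j"
    unfolding f_eq[OF j] euler[OF j, symmetric] by (simp add: algebra_simps)
  then have "f * q \<in> Y" using Y_single[OF j] by metis
  then have "f * q + ?y \<in> Y" by (intro Y_add Y_I)
  then show ?thesis unfolding q[symmetric] by simp
qed

lemma f_mem_jacobian_ideal: "f \<in> jacobian_ideal f"
  unfolding f_def by (rule prod_linear_form_mem_jacobian_ideal[OF finite_A A_nonempty])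

text \<open>The first form comes from \<open>f\<close> itself, the second from a derivative of
  \<open>f\<close> transversal to \<open>H\<close>, which modulo \<open>l H\<close> is the product
  of the other forms.\<close>

lemma prime_contains_pair:
  assumes I: "mpoly_prime I" and JI: "jacobian_ideal f \<subseteq> I"
  shows "\<exists>H\<in>A. \<exists>K\<in>A. H \<noteq> K \<and> l H \<in> I \<and> l K \<in> I"
proof -
  have "(\<Prod>H\<in>A. l H) \<in> I" using JI f_mem_jacobian_ideal unfolding f_def by blast
  then obtain H where H: "H \<in> A" "l H \<in> I" using mpoly_prime_prod[OF I finite_A] by blast
  obtain y where y: "pairing (a H) y = 1" using ex_pairing_eq_1 nonzero H by blast
  have "l H dvd directional_deriv y f - const 1 * (\<Prod>K\<in>A - {H}. l K)"
    using linear_form_dvd_deriv_diff[OF finite_A H(1), of a y] unfolding y f_def .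
  then have "directional_deriv y f - const 1 * (\<Prod>K\<in>A - {H}. l K) \<in> I"
    by (rule mpoly_ideal_dvd[OF mpoly_primeD(1)[OF I] H(2)])
  moreover have "directional_deriv y f \<in> I" using JI directional_deriv_mem_jacobian_ideal by blast
  ultimately have "(\<Prod>K\<in>A - {H}. l K) \<in> I"
    using mpoly_ideal_diff[OF mpoly_primeD(1)[OF I], of "directional_deriv y f"] by force
  then show ?thesis using mpoly_prime_prod[OF I, of "A - {H}" l] finite_A H by blast
qed

text \<open>A prime \<open>I\<close> of height two above \<open>C\<close> is some (l_H, l_K), and
  elements outside \<open>I\<close> can be cancelled in \<open>C\<close>. This leaves the local
  equation of the arrangement along the flat and its derivatives in \<open>C\<close>.\<close>

lemma height_two_component:
  assumes pr: "primaryideal C mpoly_ring" and JC: "jacobian_ideal f \<subseteq> C"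
    and ht: "ideal_height mpoly_ring C = 2"
  shows "Y \<subseteq> C"
proof -
  interpret primaryideal C "mpoly_ring :: ('x, 'k) mpoly ring" by (rule pr)
  have C: "mpoly_ideal C" using ideal_axioms by (simp add: ideal_mpoly_ring_iff)
  \<comment> \<open>An infimum of extended naturals over a nonempty set is attained, which produces
    a prime above \<open>C\<close> of height exactly two.\<close>
  have "ideal_height mpoly_ring C \<in> {prime_height mpoly_ring I | I. primeideal I mpoly_ring \<and> C \<subseteq> I}"
    (is "_ \<in> ?S")
  proof -
    have "?S \<noteq> {}" using ht unfolding ideal_height_def by (auto simp: Inf_enat_def split: if_splits)
    then show ?thesis unfolding ideal_height_def by (metis (no_types, lifting) Inf_enat_def LeastI_ex ex_in_conv)
  qed
  then obtain I where I: "mpoly_prime I" "C \<subseteq> I" "prime_height mpoly_ring I = 2"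
    using ht by (auto simp: primeideal_mpoly_ring_iff)
  obtain H K where HK: "H \<in> A" "K \<in> A" "H \<noteq> K" "l H \<in> I" "l K \<in> I"
    using prime_contains_pair[OF I(1)] JC I(2) by blast
  obtain e e' where d: "dual_vectors (a H) (a K) e e'" using dual HK by blast
  have I_eq: "I = ideal2 (l H) (l K)" using prime_height_ge_2(2)[OF I(1) d HK(4,5) I(3)] .
  \<comment> \<open>Otherwise some power of \<open>y\<close> would lie in \<open>C\<close>, hence in
    \<open>I\<close>, and so would \<open>y\<close>.\<close>
  have prim: "x \<in> C" if "x * y \<in> C" "y \<notin> I" for x y
  proof -
    have "x \<in> C \<or> (\<exists>k::nat. y ^ k \<in> C)" using I_primary[of x y] that by simp
    then show ?thesis using mpoly_prime_power[OF I(1)] I(2) that by blast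
  qed
  \<comment> \<open>The product rule transfers derivatives from \<open>f\<close> to its factor
    \<open>x\<close>: the error term is a multiple of \<open>x\<close>, already known to lie in
    \<open>C\<close>.\<close>
  have prim_f: "x \<in> C \<and> directional_deriv y x \<in> C" if f: "f = x * r" and r: "r \<notin> I" for x y r
  proof -
    have "f \<in> C" using JC f_mem_jacobian_ideal by blast
    then have x: "x \<in> C" using prim r unfolding f by blast
    have "directional_deriv y f \<in> C" using JC directional_deriv_mem_jacobian_ideal by blast
    then have "directional_deriv y x * r + x * directional_deriv y r \<in> C"
      unfolding f by (simp add: directional_deriv_mult)
    moreover have "x * directional_deriv y r \<in> C" using C x by (rule mpoly_idealD(4))
    ultimately have "directional_deriv y x * r \<in> C" using mpoly_ideal_diff[OF C] by fastforce
    then show ?thesis using prim r x by blast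
  qed
  obtain i where i: "i \<in> J" "H \<in> blk i" using ex_blk HK by blast
  obtain j where j: "j \<in> J" "K \<in> blk j" using ex_blk HK by blast
  show ?thesis
  proof (cases "i = j")
    case True
    have "F j \<notin> I" unfolding I_eq using F_notin_flat[OF j(1) _ j(2)] i HK True by blast
    then have gC: "g j \<in> C \<and> directional_deriv y (g j) \<in> C" for y
      using prim_f[OF f_eq[OF j(1)]] by blast
    show ?thesis
    proof (rule Y_subset[OF C])
      fix k assume k: "k \<in> J"
      have "F k \<in> C" if "k \<noteq> j"
        using mpoly_ideal_dvd[OF C _ g_dvd_F[OF k j(1) that]] gC by blast
      moreover have "G k \<in> C" "G' k \<in> C" if "k = j"
        using gC G_deriv[OF j(1)] G'_deriv[OF j(1)] that by auto
      ultimately show "G k * F k \<in> C" "G' k * F k \<in> C" using C by (metis mpoly_idealD(3,4))+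
    qed
  next
    case False
    let ?r = "\<Prod>L\<in>A - {H, K}. l L"
    have "A = insert H (insert K (A - {H, K}))" using HK by blast
    moreover have "finite (A - {H, K})" using finite_A by simp
    ultimately have f: "f = (l H * l K) * ?r"
      unfolding f_def using HK(3) by (metis (no_types, lifting) prod.insert Diff_iff insertCI insertE finite_insert mult.assoc)
    have "?r \<notin> I" unfolding I_eq using prod_notin_flat[OF i(1) j(1) False i(2) j(2)] by blast
    then have "directional_deriv y (l H * l K) \<in> C" for y using prim_f[OF f] by blast
    then have "const (pairing (a H) y) * l K + l H * const (pairing (a K) y) \<in> C" for y
      by (simp add: directional_deriv_mult directional_deriv_linear_form)
    from this[of e] this[of e'] have lC: "l K \<in> C" "l H \<in> C" using d by (simp_all add: dual_vectors_def)
    have "F k \<in> C" if k: "k \<in> J" for k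
    proof -
      have "H \<notin> blk k \<or> K \<notin> blk k" using blk_unique i j False k by blast
      then show ?thesis using l_dvd_F[of _ k] HK lC mpoly_ideal_dvd[OF C] by blast
    qed
    then show ?thesis using C by (intro Y_subset) (auto intro: mpoly_idealD)
  qed
qed

text \<open>For the inclusion in \<open>Y\<close>, each flat gets a multiplier outside its ideal
  that carries \<open>p\<close> into the Jacobian ideal. Cancelling it in the prime (l_H, l_K) or in
  the saturated J_b gives the hypotheses of \<open>mem_Y\<close>.\<close>

theorem top_part_eq:
  assumes "primary_decomposition mpoly_ring (jacobian_ideal f) \<Q>"
  shows "top_part mpoly_ring \<Q> = Y"
proof
  have fin: "finite \<Q>" and pr: "\<And>C. C \<in> \<Q> \<Longrightarrow> primaryideal C (mpoly_ring :: ('x, 'k) mpoly ring)"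
    and Jac: "jacobian_ideal f = \<Inter>\<Q>"
    using assms by (auto simp: primary_decomposition_def)
  have ideal: "mpoly_ideal C" if "C \<in> \<Q>" for C
    using pr[OF that] by (simp add: primaryideal_def ideal_mpoly_ring_iff)
  show "Y \<subseteq> top_part mpoly_ring \<Q>"
    using height_two_component[OF pr] Jac unfolding top_part_def by auto
  show "top_part mpoly_ring \<Q> \<subseteq> Y"
  proof
    fix p assume "p \<in> top_part mpoly_ring \<Q>"
    then have p: "p \<in> C" if "C \<in> \<Q>" "ideal_height mpoly_ring C = 2" for C
      using that by (auto simp: top_part_def)
    \<comment> \<open>Each component contributes a factor. If it is contained in (l_H, l_K), it has
      height two and already contains \<open>p\<close>, so the factor 1 works; otherwise an element
      of the component outside the prime is taken.\<close>
    have local: "\<exists>h. h \<notin> ideal2 (l H) (l K) \<and> h * p \<in> jacobian_ideal f"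
      if HK: "H \<in> A" "K \<in> A" "H \<noteq> K" for H K
    proof -
      let ?I = "ideal2 (l H) (l K)"
      obtain e e' where d: "dual_vectors (a H) (a K) e e'" using dual HK by blast
      have I: "mpoly_prime ?I" by (rule prime_pair[OF HK])
      have "\<exists>h. h \<notin> ?I \<and> h * p \<in> C" if C: "C \<in> \<Q>" for C
      proof (cases "C \<subseteq> ?I")
        case True
        have "ideal_height mpoly_ring C \<le> prime_height mpoly_ring ?I"
          unfolding ideal_height_def by (rule Inf_lower) (use True I in \<open>auto simp: primeideal_mpoly_ring_iff\<close>)
        also have "\<dots> \<le> 2" by (rule prime_height_linear_forms_le[OF d])
        finally have "ideal_height mpoly_ring C \<le> 2" .
        \<comment> \<open>Every prime above \<open>C\<close> contains the Jacobian ideal and hence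
          two independent linear forms.\<close>
        moreover have "2 \<le> ideal_height mpoly_ring C"
          unfolding ideal_height_def
        proof (rule Inf_greatest, clarsimp simp: primeideal_mpoly_ring_iff)
          fix I' assume I': "mpoly_prime I'" "C \<subseteq> I'"
          then obtain H' K' where "H' \<in> A" "K' \<in> A" "H' \<noteq> K'" "l H' \<in> I'" "l K' \<in> I'"
            using prime_contains_pair[of I'] Jac C by blast
          then show "2 \<le> prime_height mpoly_ring I'" using prime_height_ge_2(1)[OF I'(1)] dual by blast
        qed
        ultimately have "p \<in> C" using p C by (simp add: order_antisym)
        then show ?thesis using mpoly_primeD(2)[OF I] by (intro exI[of _ 1]) simp
      next
        case False
        then obtain h where "h \<in> C" "h \<notin> ?I" by blast
        then show ?thesis using mpoly_idealD(4)[OF ideal[OF C]] by blast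
      qed
      then obtain h where h: "\<And>C. C \<in> \<Q> \<Longrightarrow> h C \<notin> ?I \<and> h C * p \<in> C" by metis
      have "prod h \<Q> \<notin> ?I" using mpoly_prime_prod[OF I fin] h by blast
      moreover have "prod h \<Q> * p \<in> C" if C: "C \<in> \<Q>" for C
      proof -
        have "h C * p dvd prod h \<Q> * p" using C fin by (intro mult_dvd_mono dvd_prodI) auto
        then show ?thesis using mpoly_ideal_dvd[OF ideal[OF C]] h[OF C] by blast
      qed
      ultimately show ?thesis unfolding Jac by blast
    qed
    show "p \<in> Y"
    proof (rule mem_Y)
      fix i j H K assume ij: "i \<in> J" "j \<in> J" "i \<noteq> j" "H \<in> blk i" "K \<in> blk j"
      then have HK: "H \<in> A" "K \<in> A" "H \<noteq> K" using blk_subset disjoint by blast+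
      let ?I = "ideal2 (l H) (l K)"
      have "jacobian_ideal f \<subseteq> ?I"
      proof (rule jacobian_ideal_subset[OF mpoly_ideal_ideal2])
        fix z
        let ?r = "\<Prod>L\<in>A - {H}. l L"
        have "directional_deriv z f - const (pairing (a H) z) * ?r \<in> ?I"
          using linear_form_dvd_deriv_diff[OF finite_A HK(1)] unfolding f_def
          by (rule ideal2_dvd[OF gens_in_ideal2(1)])
        moreover have "l K dvd ?r" using HK finite_A by (intro dvd_prodI) auto
        then have "const (pairing (a H) z) * ?r \<in> ?I"
          by (intro ideal2_mult ideal2_dvd[OF gens_in_ideal2(2)])
        ultimately show "directional_deriv z f \<in> ?I" using ideal2_add by fastforce
      qed
      then show "p \<in> ?I" using local[OF HK] mpoly_primeD(3)[OF prime_pair[OF HK]] by blast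
    next
      fix j assume j: "j \<in> J"
      then show "p \<in> ideal2 (G j) (G' j)"
      proof (cases rule: block_cases)
        case (1 H K)
        have "jacobian_ideal f \<subseteq> ideal2 (G j) (G' j)"
          by (rule jacobian_ideal_subset[OF mpoly_ideal_ideal2])
            (auto simp: f_eq[OF j] directional_deriv_mult intro!: ideal2_add ideal2_mult2 deriv[OF j] g_mem[OF j])
        then show ?thesis
          using local[of H K] 1 blk_subset[OF j] saturated[OF j 1] saturatedD by blast
      qed auto
    qed
  qed
qed

end

context disconnected_pencils
begin

lemma ex_jacobian: "\<exists>G G' u v. disconnected_pencils_jacobian P Q blk A a G G' u v"
proof -
  obtain w where w: "\<And>H. H \<in> A \<Longrightarrow> pairing (a H) w \<noteq> 0"
    using ex_generic_vector[of A a] finite_A nonzero by blast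
  \<comment> \<open>All requirements on one block in a single predicate, so that the four families
    are chosen simultaneously.\<close>
  define good where "good j Gj G'j uj vj \<longleftrightarrow>
      uj * Gj + vj * G'j = g j \<and> (\<exists>y. Gj = directional_deriv y (g j)) \<and> (\<exists>y. G'j = directional_deriv y (g j)) \<and>
      (\<forall>y. directional_deriv y (g j) \<in> ideal2 Gj G'j) \<and>
      (\<forall>H\<in>blk j. \<forall>K\<in>blk j. \<forall>h. H \<noteq> K \<longrightarrow> h \<notin> ideal2 (l H) (l K) \<longrightarrow> saturated (ideal2 Gj G'j) h) \<and>
      (\<forall>p r s. j = Inl p \<longrightarrow> r * Gj + s * G'j = 0 \<longrightarrow> (\<exists>t. r = t * G'j \<and> s = - (t * Gj))) \<and>
      Gj \<noteq> 0 \<and> (\<forall>q. j = Inr q \<longrightarrow> (\<exists>c. c \<noteq> 0 \<and> Gj = const c) \<and> G'j = 0 \<and> vj = 0) \<and>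
      homogeneous 1 uj \<and> homogeneous 1 vj" for j and Gj G'j uj vj :: "('x, 'k) mpoly"
  have "\<exists>Gj G'j uj vj. good j Gj G'j uj vj" if j: "j \<in> J" for j
  proof (cases j)
    case (Inl p)
    then have "card (blk j) \<ge> 2" using j card_pencil by auto
    then have "\<not> card (blk j) \<le> Suc 0" by simp
    then obtain H1 H2 where H: "H1 \<in> blk j" "H2 \<in> blk j" "H1 \<noteq> H2"
      using card_le_Suc0_iff_eq[OF finite_blk[OF j]] by blast
    have pen: "pencil (blk j) a w H1 H2"
    proof
      show "l L \<in> ideal2 (l H) (l K)" if "H \<in> blk j" "K \<in> blk j" "L \<in> blk j" "H \<noteq> K" for H K L
        using that flat_same[OF j, of H K L] blk_subset[OF j] by blast
    qed (use H finite_blk[OF j] dual blk_subset[OF j] w in blast)+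
    have g_eq: "pencil.g (blk j) a = g j"
      unfolding g_def by (rule pencil.g_def[OF pen])
    let ?G = "directional_deriv w (g j)"
    obtain z u v where zuv: "linear_form u * ?G + linear_form v * directional_deriv z (g j) = g j"
      "\<And>y. directional_deriv y (g j) \<in> ideal2 ?G (directional_deriv z (g j))"
      "\<And>h. h \<notin> ideal2 (l H1) (l H2) \<Longrightarrow> saturated (ideal2 ?G (directional_deriv z (g j))) h"
      by (rule pencil.jacobian[OF pen, unfolded g_eq]) blast
    have sat: "saturated (ideal2 ?G (directional_deriv z (g j))) h"
      if "H \<in> blk j" "K \<in> blk j" "H \<noteq> K" "h \<notin> ideal2 (l H) (l K)" for H K h
      using zuv(3) that(4) unfolding pencil.ideal2_eq_centre[OF pen that(1-3)] by blast
    have kos: "\<exists>t. r = t * directional_deriv z (g j) \<and> s = - (t * ?G)"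
      if "r * ?G + s * directional_deriv z (g j) = 0" for r s
      by (rule koszul_relation[OF zuv(1) g_nonzero[OF j] pencil.G_nonzero[OF pen, unfolded g_eq]
            pencil.g_dvd_cancel_G[OF pen, unfolded g_eq] that])
    have "good j ?G (directional_deriv z (g j)) (linear_form u) (linear_form v)"
      unfolding good_def
      using zuv(1,2) sat kos pencil.G_nonzero[OF pen, unfolded g_eq] homogeneous_linear_form Inl by blast
    then show ?thesis by blast
  next
    case (Inr q)
    then obtain H where H: "blk j = {H}" using j singleton[of q] by auto
    then have HA: "H \<in> A" using blk_subset[OF j] by blast
    let ?c = "pairing (a H) w"
    have c: "?c \<noteq> 0" by (rule w[OF HA])
    have g: "g j = l H" unfolding g_def H by simp
    have D: "directional_deriv y (g j) = const (pairing (a H) y)" for y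
      unfolding g by (rule directional_deriv_linear_form)
    have inv: "const (inverse ?c) * const ?c = (1 :: ('x, 'k) mpoly)"
      using const_mult_inverse[OF c] by (simp only: mult.commute)
    have all: "p \<in> ideal2 (const ?c) 0" for p :: "('x, 'k) mpoly"
    proof -
      have "p = (p * const (inverse ?c)) * const ?c + 0 * 0" unfolding mult.assoc inv by simp
      then show ?thesis using ideal2I by metis
    qed
    \<comment> \<open>For a single hyperplane the derivative along \<open>w\<close> is the nonzero
      constant \<open>?c\<close>, the second generator is the derivative along the zero vector, and
      dividing \<open>l H\<close> by \<open>?c\<close> gives the Euler coefficient.\<close>
    have "good j (const ?c) 0 (linear_form (inverse ?c *s a H)) 0"
      unfolding good_def D
    proof (intro conjI allI ballI impI)
      show "linear_form (inverse ?c *s a H) * const ?c + 0 * 0 = g j"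
        unfolding g linear_form_smult using inv by (simp add: mult.commute mult.left_commute)
      show "\<exists>y. 0 = (const (pairing (a H) y) :: ('x, 'k) mpoly)"
        by (rule exI[of _ 0]) (simp add: pairing_def)
    qed (use c Inr H all homogeneous_linear_form in \<open>auto simp: saturated_def\<close>)
    then show ?thesis by blast
  qed
  then obtain G G' u v where good: "\<And>j. j \<in> J \<Longrightarrow> good j (G j) (G' j) (u j) (v j)" by metis
  have "disconnected_pencils_jacobian P Q blk A a G G' u v"
  proof
    show "\<exists>t. r = t * G' (Inl p) \<and> s = - (t * G (Inl p))"
      if "p \<in> P" "r * G (Inl p) + s * G' (Inl p) = 0" for p r s
      using good[of "Inl p"] that unfolding good_def by blast
    show "\<exists>c. c \<noteq> 0 \<and> G (Inr q) = const c" "G' (Inr q) = 0" "v (Inr q) = 0" if "q \<in> Q" for q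
      using good[of "Inr q"] that unfolding good_def by blast+
    show "saturated (ideal2 (G j) (G' j)) h"
      if "j \<in> J" "H \<in> blk j" "K \<in> blk j" "H \<noteq> K" "h \<notin> ideal2 (l H) (l K)" for j H K h
      using good[of j] that unfolding good_def by blast
  qed (use good in \<open>unfold good_def, blast\<close>)+
  then show ?thesis by blast
qed

end

section \<open>The resolution\<close>

lemma minimal_graded_free_resolutionI:
  fixes \<phi> :: "('b \<Rightarrow> ('x::finite, 'k::field) mpoly) \<Rightarrow> 'c \<Rightarrow> ('x, 'k) mpoly"
  assumes fin: "finite B\<^sub>1" "finite B\<^sub>0"
    and \<phi>_supp: "\<And>v b. b \<notin> B\<^sub>0 \<Longrightarrow> \<phi> v b = 0"
    and \<phi>_add: "\<And>v w. \<phi> (\<lambda>b. v b + w b) = (\<lambda>b. \<phi> v b + \<phi> w b)"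
    and \<phi>_smult: "\<And>p v. \<phi> (\<lambda>b. p * v b) = (\<lambda>b. p * \<phi> v b)"
    and \<phi>_grade: "\<And>e v b. (\<And>b. b \<in> B\<^sub>1 \<Longrightarrow> homogeneous (\<tau>\<^sub>1 b + e) (v b)) \<Longrightarrow> b \<in> B\<^sub>0 \<Longrightarrow>
      homogeneous (\<tau>\<^sub>0 b + e) (\<phi> v b)"
    and \<phi>_min: "\<And>v b. b \<in> B\<^sub>0 \<Longrightarrow> \<phi> v b \<in> Idl\<^bsub>mpoly_ring\<^esub> (range indeterminate)"
    and \<epsilon>_add: "\<And>v w. \<epsilon> (\<lambda>b. v b + w b) = \<epsilon> v + \<epsilon> w"
    and \<epsilon>_smult: "\<And>p v. \<epsilon> (\<lambda>b. p * v b) = p * \<epsilon> v"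
    and \<epsilon>_grade: "\<And>e v. (\<And>b. b \<in> B\<^sub>0 \<Longrightarrow> homogeneous (\<tau>\<^sub>0 b + e) (v b)) \<Longrightarrow> homogeneous e (\<epsilon> v)"
    and \<epsilon>_image: "\<epsilon> ` {v. \<forall>b. b \<notin> B\<^sub>0 \<longrightarrow> v b = 0} = I"
    and inj: "inj_on \<phi> {v. \<forall>b. b \<notin> B\<^sub>1 \<longrightarrow> v b = 0}"
    and exact1: "\<And>v. \<epsilon> (\<phi> v) = 0"
    and exact2: "\<And>w. (\<And>b. b \<notin> B\<^sub>0 \<Longrightarrow> w b = 0) \<Longrightarrow> \<epsilon> w = 0 \<Longrightarrow> \<exists>v. (\<forall>b. b \<notin> B\<^sub>1 \<longrightarrow> v b = 0) \<and> w = \<phi> v"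
  shows "minimal_graded_free_resolution B\<^sub>1 \<tau>\<^sub>1 B\<^sub>0 \<tau>\<^sub>0 (ideal_module I) \<phi> \<epsilon>"
proof -
  let ?F1 = "twisted_free B\<^sub>1 \<tau>\<^sub>1 :: (('x, 'k) mpoly, 'b \<Rightarrow> ('x, 'k) mpoly) graded_module"
  let ?F0 = "twisted_free B\<^sub>0 \<tau>\<^sub>0 :: (('x, 'k) mpoly, 'c \<Rightarrow> ('x, 'k) mpoly) graded_module"
  have \<phi>: "\<phi> \<in> graded_hom mpoly_ring ?F1 ?F0"
    using \<phi>_supp \<phi>_grade by (auto simp: graded_hom_def hom_def twisted_free_def \<phi>_add \<phi>_smult)
  have im: "\<epsilon> v \<in> I" if "\<And>b. b \<notin> B\<^sub>0 \<Longrightarrow> v b = 0" for v using \<epsilon>_image that by blast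
  have \<epsilon>: "\<epsilon> \<in> graded_hom mpoly_ring ?F0 (ideal_module I)"
    using im \<epsilon>_grade by (auto simp: graded_hom_def hom_def twisted_free_def ideal_module_def \<epsilon>_add \<epsilon>_smult)
  have ker: "\<phi> ` carrier ?F1 = a_kernel ?F0 (ideal_module I) \<epsilon>"
    using \<phi>_supp exact1 exact2
    by (auto simp: a_kernel_def kernel_def twisted_free_def ideal_module_def) blast
  show ?thesis
    unfolding minimal_graded_free_resolution_def Let_def
    using fin \<phi> \<epsilon> ker inj \<epsilon>_image \<phi>_min by (auto simp: twisted_free_def ideal_module_def)
qed

context disconnected_pencils_jacobian
begin

lemma homogeneous_GF:
  assumes "j \<in> J"
  shows "homogeneous (int (card (blk j)) - 1) (G j)" "homogeneous (int (card (blk j)) - 1) (G' j)"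
    "homogeneous (int (card A) - int (card (blk j))) (F j)"
proof -
  have D: "homogeneous (int (card (blk j)) - 1) (directional_deriv y (g j))" for y
    unfolding g_def by (rule homogeneous_directional_deriv_prod[OF finite_blk[OF assms]])
  show "homogeneous (int (card (blk j)) - 1) (G j)" using D G_deriv[OF assms] by metis
  show "homogeneous (int (card (blk j)) - 1) (G' j)" using D G'_deriv[OF assms] by metis
  have "card (A - blk j) = card A - card (blk j)" "card (blk j) \<le> card A"
    using card_Diff_subset[OF finite_blk[OF assms] blk_subset[OF assms]] card_mono[OF finite_A blk_subset[OF assms]]
    by auto
  then have "int (card A) - int (card (blk j)) = int (card (A - blk j))" by simp
  then show "homogeneous (int (card A) - int (card (blk j))) (F j)"
    unfolding F_def using homogeneous_prod_linear_form[of "A - blk j" a] finite_A by simp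
qed

lemma g_dvd_cancel_F:
  assumes j: "j \<in> J" and "g j dvd F j * y"
  shows "g j dvd y"
  unfolding g_def
proof (rule prod_linear_form_dvd[OF finite_blk[OF j]])
  fix H assume H: "H \<in> blk j"
  then have HA: "H \<in> A" using blk_subset[OF j] by blast
  have "l H dvd g j" unfolding g_def by (rule dvd_prodI[OF finite_blk[OF j] H])
  then have "l H dvd F j * y" using assms(2) by (rule dvd_trans)
  moreover have "\<not> l H dvd F j"
  proof
    assume "l H dvd F j"
    then obtain K where "K \<in> A - blk j" "l H dvd l K"
      unfolding F_def using linear_form_prime_prod[of "a H" l "A - blk j"] nonzero[OF HA] finite_A by blast
    then show False using not_dvd[OF HA] H by blast
  qed
  ultimately show "l H dvd y" using linear_form_prime nonzero[OF HA] by blast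
qed (use not_dvd nonzero blk_subset[OF j] in blast)+

text \<open>The summand of block \<open>j\<close> equals \<open>\<delta> j * f\<close>: the other
  summands are divisible by \<open>g j\<close>, and \<open>F j\<close> has no factor in common with
  it. What remains after subtracting \<open>\<delta> j\<close> times the Euler expression is a
  Koszul relation with coefficient \<open>\<kappa> j\<close>. The condition on \<open>y\<close>
  reflects that a single hyperplane contributes only one generator.\<close>

lemma syzygy:
  assumes "(\<Sum>j\<in>J. (x j * G j + y j * G' j) * F j) = 0"
    and y: "\<And>q. y (Inr q) = 0"
  shows "\<exists>\<delta> \<kappa>. (\<Sum>j\<in>J. \<delta> j) = 0 \<and> (\<forall>q. \<kappa> (Inr q) = 0) \<and>
    (\<forall>j\<in>J. x j = \<delta> j * u j + \<kappa> j * G' j \<and> y j = \<delta> j * v j - \<kappa> j * G j)"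
proof -
  have "\<exists>d. x j * G j + y j * G' j = d * g j" if j: "j \<in> J" for j
  proof -
    let ?S = "\<Sum>i\<in>J - {j}. (x i * G i + y i * G' i) * F i"
    have "(x j * G j + y j * G' j) * F j + ?S = 0"
      using assms(1) by (simp add: sum.remove[OF finite_J j])
    then have "F j * (x j * G j + y j * G' j) = - ?S" by (simp add: eq_neg_iff_add_eq_0 mult.commute)
    moreover have "g j dvd ?S" using g_dvd_F j by (intro dvd_sum dvd_mult) auto
    ultimately have "g j dvd F j * (x j * G j + y j * G' j)" by simp
    then have "g j dvd x j * G j + y j * G' j" by (rule g_dvd_cancel_F[OF j])
    then show ?thesis by (metis dvdE mult.commute)
  qed
  then obtain \<delta> where \<delta>: "\<And>j. j \<in> J \<Longrightarrow> x j * G j + y j * G' j = \<delta> j * g j" by metis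
  have "f * (\<Sum>j\<in>J. \<delta> j) = (\<Sum>j\<in>J. (x j * G j + y j * G' j) * F j)"
    unfolding sum_distrib_left
  proof (rule sum.cong[OF refl])
    fix j assume j: "j \<in> J"
    show "f * \<delta> j = (x j * G j + y j * G' j) * F j"
      unfolding \<delta>[OF j] f_eq[OF j] by (simp only: mult_ac)
  qed
  then have "f * (\<Sum>j\<in>J. \<delta> j) = 0" using assms(1) by simp
  then have sum0: "(\<Sum>j\<in>J. \<delta> j) = 0" using f_nonzero mpoly_mult_eq_0_iff by blast
  have "\<exists>k. (\<forall>q. j = Inr q \<longrightarrow> k = 0) \<and> x j = \<delta> j * u j + k * G' j \<and> y j = \<delta> j * v j - k * G j" if j: "j \<in> J" for j
  proof -
    have rel: "(x j - \<delta> j * u j) * G j + (y j - \<delta> j * v j) * G' j = 0"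
    proof -
      have "x j * G j + y j * G' j = \<delta> j * (u j * G j + v j * G' j)" unfolding euler[OF j] by (rule \<delta>[OF j])
      then show ?thesis by (simp add: algebra_simps)
    qed
    show ?thesis
    proof (cases j)
      case (Inl p)
      then obtain t where "x j - \<delta> j * u j = t * G' j" "y j - \<delta> j * v j = - (t * G j)"
        using koszul[of p] rel j by blast
      then show ?thesis using Inl by (intro exI[of _ t]) (simp add: algebra_simps)
    next
      case (Inr q)
      then have q: "q \<in> Q" using j by auto
      then have "(x j - \<delta> j * u j) * G j = 0" using rel free(2)[OF q] Inr by simp
      then have "x j - \<delta> j * u j = 0" using G_nonzero[OF j] mpoly_mult_eq_0_iff by blast
      then show ?thesis using Inr y free(3)[OF q] by (intro exI[of _ 0]) simp
    qed
  qed
  then obtain k where k: "\<And>j. j \<in> J \<Longrightarrow> (\<forall>q. j = Inr q \<longrightarrow> k j = 0) \<and>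
      x j = \<delta> j * u j + k j * G' j \<and> y j = \<delta> j * v j - k j * G j" by metis
  define \<kappa> where "\<kappa> j = (if j \<in> J then k j else 0)" for j
  show ?thesis
    using sum0 k by (intro exI[of _ \<delta>] exI[of _ \<kappa>]) (auto simp: \<kappa>_def)
qed

text \<open>Every block contributes the generator G_j F_j and every pencil also G'_p F_p, all of
  degree d - 1. On the syzygy side the families \<open>\<delta>\<close> with sum zero have rank one
  less than the number of blocks, with linear coefficients \<open>u\<close> and \<open>v\<close>;
  each pencil adds one Koszul relation, whose coefficients have degree t_P - 1.\<close>

theorem minimal_resolution:
  "\<exists>\<phi> \<epsilon>. minimal_graded_free_resolution ({..<card P + card Q - 1} <+> P)
     (case_sum (\<lambda>_. - int (card A)) (\<lambda>p. - int (card A) - int (card (blk (Inl p))) + 2))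
     {..<2 * card P + card Q} (\<lambda>_. - int (card A) + 1) (ideal_module Y) \<phi> \<epsilon>"
proof -
  let ?c = "card P + card Q" and ?N = "2 * card P + card Q"
  have cardJ: "card J = ?c" using finite_P finite_Q by (rule card_Plus)
  \<comment> \<open>There is at least one block, so the truncated subtraction in
    \<open>?c - 1\<close> is a genuine one.\<close>
  have c0: "?c > 0" using cardJ finite_J nonempty card_gt_0_iff by metis

  \<comment> \<open>Enumeration of the blocks and of the generators\<close>
  obtain en where en: "bij_betw en {..<?c} J"
    using finite_same_card_bij[of "{..<?c}" J] finite_J cardJ by auto
  have "card (J <+> P) = ?N" using finite_J finite_P cardJ by (simp add: card_Plus)
  then obtain \<beta> where \<beta>: "bij_betw \<beta> {..<?N} (J <+> P)"
    using finite_same_card_bij[of "{..<?N}" "J <+> P"] finite_J finite_P by auto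
  define pos where "pos = inv_into {..<?N} \<beta>"
  have pos: "\<beta> (pos b) = b" "pos b < ?N" if "b \<in> J <+> P" for b
    using bij_betw_inv_into_right[OF \<beta> that] bij_betwE[OF bij_betw_inv_into[OF \<beta>]] that
    by (auto simp: pos_def)
  have posl: "\<beta> (pos (Inl j)) = Inl j" "pos (Inl j) < ?N" if "j \<in> J" for j
    using pos[OF InlI[OF that]] by auto
  have posr: "\<beta> (pos (Inr p)) = Inr p" "pos (Inr p) < ?N" if "p \<in> P" for p
    using pos[OF InrI[OF that]] by auto
  have pos_\<beta>: "pos (\<beta> n) = n" "\<beta> n \<in> J <+> P" if "n < ?N" for n
    using bij_betw_inv_into_left[OF \<beta>, of n] bij_betwE[OF \<beta>] that by (auto simp: pos_def)
  define idx where "idx = inv_into {..<?c} en"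
  have idx: "en (idx j) = j" "idx j < ?c" if "j \<in> J" for j
    using bij_betw_inv_into_right[OF en that] bij_betwE[OF bij_betw_inv_into[OF en]] that
    by (auto simp: idx_def)
  have idx_en: "idx (en i) = i" "en i \<in> J" if "i < ?c" for i
    using bij_betw_inv_into_left[OF en, of i] bij_betwE[OF en] that by (auto simp: idx_def)
  \<comment> \<open>A family with sum zero is determined by its values off one block; the block
    \<open>last\<close> is the one that absorbs the negative of their sum.\<close>
  define last where "last = en (?c - 1)"
  have last: "last \<in> J" using idx_en(2) c0 by (simp add: last_def)
  have en_last: "en i \<noteq> last" if "i < ?c - 1" for i
    using idx_en(1)[of i] idx_en(1)[of "?c - 1"] that c0 by (metis last_def less_imp_diff_less nat_neq_iff diff_less zero_less_one less_trans)
  have bij_last: "bij_betw en {..<?c - 1} (J - {last})"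
  proof -
    have "bij_betw en ({..<?c} - {?c - 1}) (J - {en (?c - 1)})"
      using bij_betw_DiffI[OF en, of "{?c - 1}" "{en (?c - 1)}"] idx_en c0 by (simp add: bij_betw_def)
    moreover have "{..<?c} - {?c - 1} = {..<?c - 1}" by auto
    ultimately show ?thesis by (simp add: last_def)
  qed

  \<comment> \<open>The two maps\<close>
  define \<delta> where "\<delta> e j = (if j = last then - (\<Sum>i<?c - 1. e (Inl i)) else e (Inl (idx j)))"
    for e :: "nat + 'p \<Rightarrow> ('x, 'k) mpoly" and j
  define \<kappa> where "\<kappa> e j = case_sum (\<lambda>p. e (Inr p)) (\<lambda>_. 0) j"
    for e :: "nat + 'p \<Rightarrow> ('x, 'k) mpoly" and j :: "'p + 'q"
  define \<phi> where "\<phi> e n = (if n < ?N then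
      case_sum (\<lambda>j. \<delta> e j * u j + \<kappa> e j * G' j) (\<lambda>p. \<delta> e (Inl p) * v (Inl p) - \<kappa> e (Inl p) * G (Inl p)) (\<beta> n)
      else 0)" for e n
  \<comment> \<open>\<open>CX w j\<close> and \<open>CZ w j\<close> are the coefficients of
    \<open>G j * F j\<close> and \<open>G' j * F j\<close>; a single hyperplane has no basis element
    for the latter, hence the default 0.\<close>
  define CX where "CX w j = w (pos (Inl j))" for w :: "nat \<Rightarrow> ('x, 'k) mpoly" and j
  define CZ where "CZ w j = case_sum (\<lambda>p. w (pos (Inr p))) (\<lambda>_. 0) j"
    for w :: "nat \<Rightarrow> ('x, 'k) mpoly" and j :: "'p + 'q"
  define \<epsilon> where "\<epsilon> w = (\<Sum>j\<in>J. (CX w j * G j + CZ w j * G' j) * F j)" for w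
  have sum\<delta>: "(\<Sum>j\<in>J. \<delta> e j) = 0" for e
  proof -
    have "(\<Sum>j\<in>J. \<delta> e j) = \<delta> e last + (\<Sum>j\<in>J - {last}. \<delta> e j)" by (rule sum.remove[OF finite_J last])
    also have "(\<Sum>j\<in>J - {last}. \<delta> e j) = (\<Sum>i<?c - 1. \<delta> e (en i))"
      by (rule sum.reindex_bij_betw[OF bij_last, symmetric])
    also have "\<dots> = (\<Sum>i<?c - 1. e (Inl i))"
      by (rule sum.cong) (use en_last idx_en(1) in \<open>auto simp: \<delta>_def\<close>)
    finally show ?thesis by (simp add: \<delta>_def)
  qed
  have CX\<phi>: "CX (\<phi> e) j = \<delta> e j * u j + \<kappa> e j * G' j" if "j \<in> J" for e j
    using posl[OF that] by (simp add: CX_def \<phi>_def)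
  have CZ\<phi>: "CZ (\<phi> e) j = \<delta> e j * v j - \<kappa> e j * G j" if "j \<in> J" for e j
  proof (cases j)
    case (Inl p)
    then show ?thesis using posr[of p] that by (auto simp: CZ_def \<phi>_def)
  next
    case (Inr q)
    then show ?thesis using free(3)[of q] that by (auto simp: CZ_def \<kappa>_def)
  qed
  have comb: "CX (\<phi> e) j * G j + CZ (\<phi> e) j * G' j = g j * \<delta> e j" if j: "j \<in> J" for e j
    unfolding CX\<phi>[OF j] CZ\<phi>[OF j] euler[OF j, symmetric] by (simp add: algebra_simps)

  \<comment> \<open>Degrees\<close>
  have homY: "homogeneous e (\<epsilon> w)" if "\<And>n. n < ?N \<Longrightarrow> homogeneous (- int (card A) + 1 + e) (w n)" for e w
    unfolding \<epsilon>_def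
  proof (rule homogeneous_sum)
    fix j assume j: "j \<in> J"
    have "homogeneous (- int (card A) + 1 + e) (CX w j)"
      unfolding CX_def using that posl(2)[OF j] by blast
    moreover have "homogeneous (- int (card A) + 1 + e) (CZ w j)"
      using that posr(2) j by (cases j) (auto simp: CZ_def)
    ultimately have "homogeneous (- int (card A) + 1 + e + (int (card (blk j)) - 1)) (CX w j * G j + CZ w j * G' j)"
      using homogeneous_GF[OF j] by (intro homogeneous_add homogeneous_mult)
    then show "homogeneous e ((CX w j * G j + CZ w j * G' j) * F j)"
      by (rule homogeneous_mult'[OF _ homogeneous_GF(3)[OF j]]) simp
  qed
  have hom\<phi>: "homogeneous (- int (card A) + 1 + e) (\<phi> w n)"
    if w: "\<And>b. b \<in> {..<?c - 1} <+> P \<Longrightarrow>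
        homogeneous (case_sum (\<lambda>_. - int (card A)) (\<lambda>p. - int (card A) - int (card (blk (Inl p))) + 2) b + e) (w b)"
      and n: "n < ?N" for e w n
  proof -
    have wi: "homogeneous (- int (card A) + e) (w (Inl i))" if "i < ?c - 1" for i
      using w[of "Inl i"] that by (simp add: InlI)
    have wp: "homogeneous (- int (card A) - int (card (blk (Inl p))) + 2 + e) (w (Inr p))" if "p \<in> P" for p
      using w[of "Inr p"] that by (simp add: InrI)
    have \<delta>: "homogeneous (- int (card A) + e) (\<delta> w j)" if j: "j \<in> J" for j
    proof (cases "j = last")
      case True
      then show ?thesis using wi by (auto simp: \<delta>_def intro!: homogeneous_uminus homogeneous_sum)
    next
      case False
      then have "idx j \<noteq> ?c - 1" using idx(1)[OF j] by (auto simp: last_def)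
      then have "idx j < ?c - 1" using idx(2)[OF j] by simp
      then show ?thesis using wi False by (simp add: \<delta>_def)
    qed
    have \<kappa>: "homogeneous (- int (card A) - int (card (blk j)) + 2 + e) (\<kappa> w j)" if "j \<in> J" for j
      using wp that by (cases j) (auto simp: \<kappa>_def)
    have 1: "homogeneous (- int (card A) + 1 + e) (\<delta> w j * u j + \<kappa> w j * G' j)" if j: "j \<in> J" for j
      by (intro homogeneous_add homogeneous_mult'[OF \<delta>[OF j] hom_uv(1)[OF j]]
          homogeneous_mult'[OF \<kappa>[OF j] homogeneous_GF(2)[OF j]]) auto
    have 2: "homogeneous (- int (card A) + 1 + e) (\<delta> w j * v j - \<kappa> w j * G j)" if j: "j \<in> J" for j
      by (intro homogeneous_diff homogeneous_mult'[OF \<delta>[OF j] hom_uv(2)[OF j]]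
          homogeneous_mult'[OF \<kappa>[OF j] homogeneous_GF(1)[OF j]]) auto
    show ?thesis
    proof (cases "\<beta> n")
      case (Inl j)
      then have "j \<in> J" using pos_\<beta>(2)[OF n] by auto
      then show ?thesis using 1[of j] n Inl by (simp add: \<phi>_def)
    next
      case (Inr p)
      then have "p \<in> P" using pos_\<beta>(2)[OF n] by auto
      then show ?thesis using 2[OF InlI, of p] n Inr by (simp add: \<phi>_def)
    qed
  qed

  \<comment> \<open>Minimality\<close>
  let ?m = "Idl\<^bsub>mpoly_ring\<^esub> (range indeterminate) :: ('x, 'k) mpoly set"
  have m: "mpoly_ideal ?m" by (rule mpoly_ideal_genideal)
  have uvm: "u j \<in> ?m" "v j \<in> ?m" if "j \<in> J" for j
    using homogeneous_pos_mem_irrelevant[of 1] hom_uv[OF that] by auto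
  have Gm: "G (Inl p) \<in> ?m" "G' (Inl p) \<in> ?m" if "p \<in> P" for p
    using homogeneous_pos_mem_irrelevant[OF homogeneous_GF(1)[OF InlI[OF that]]]
      homogeneous_pos_mem_irrelevant[OF homogeneous_GF(2)[OF InlI[OF that]]] card_pencil[OF that] by auto
  \<comment> \<open>For a single hyperplane \<open>G j\<close> is a unit, but there
    \<open>\<kappa>\<close> vanishes, so no unit enters the matrix.\<close>
  have \<kappa>m: "\<kappa> e j * G j \<in> ?m" "\<kappa> e j * G' j \<in> ?m" if "j \<in> J" for e j
    using that Gm mpoly_idealD[OF m] by (auto simp: \<kappa>_def)
  have min\<phi>: "\<phi> e n \<in> ?m" if n: "n < ?N" for e n
  proof (cases "\<beta> n")
    case (Inl j)
    then have j: "j \<in> J" using pos_\<beta>(2)[OF n] by auto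
    have "\<delta> e j * u j + \<kappa> e j * G' j \<in> ?m"
      by (intro mpoly_idealD(2)[OF m] mpoly_idealD(3)[OF m uvm(1)[OF j]] \<kappa>m(2)[OF j])
    then show ?thesis using n Inl by (simp add: \<phi>_def)
  next
    case (Inr p)
    then have j: "Inl p \<in> J" using pos_\<beta>(2)[OF n] by auto
    have "\<delta> e (Inl p) * v (Inl p) - \<kappa> e (Inl p) * G (Inl p) \<in> ?m"
      by (intro mpoly_ideal_diff[OF m] mpoly_idealD(3)[OF m uvm(2)[OF j]] \<kappa>m(1)[OF j])
    then show ?thesis using n Inr by (simp add: \<phi>_def)
  qed

  \<comment> \<open>Surjectivity onto the ideal\<close>
  have image: "\<epsilon> ` {w. \<forall>n. n \<notin> {..<?N} \<longrightarrow> w n = 0} = Y"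
  proof (intro equalityI subsetI)
    fix p assume "p \<in> Y"
    then obtain r s where p: "p = (\<Sum>j\<in>J. (r j * G j + s j * G' j) * F j)" unfolding Y_def by blast
    define w where "w n = (if n < ?N then case_sum r (\<lambda>p. s (Inl p)) (\<beta> n) else 0)" for n
    have "(CX w j * G j + CZ w j * G' j) * F j = (r j * G j + s j * G' j) * F j" if j: "j \<in> J" for j
    proof -
      have "CX w j = r j" using posl[OF j] by (simp add: CX_def w_def)
      moreover have "CZ w j * G' j = s j * G' j"
        using posr j free(2) by (cases j) (auto simp: CZ_def w_def)
      ultimately show ?thesis by simp
    qed
    then have "\<epsilon> w = p" unfolding \<epsilon>_def p by (rule sum.cong[OF refl])
    then show "p \<in> \<epsilon> ` {w. \<forall>n. n \<notin> {..<?N} \<longrightarrow> w n = 0}" by (intro image_eqI[of _ _ w]) (auto simp: w_def)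
  qed (auto simp: \<epsilon>_def Y_I)

  \<comment> \<open>Injectivity\<close>
  have inj: "inj_on \<phi> {e. \<forall>b. b \<notin> {..<?c - 1} <+> P \<longrightarrow> e b = 0}"
  proof (rule inj_onI, rule ext)
    fix e e' :: "nat + 'p \<Rightarrow> ('x, 'k) mpoly" and b
    assume e: "e \<in> {e. \<forall>b. b \<notin> {..<?c - 1} <+> P \<longrightarrow> e b = 0}" "e' \<in> {e. \<forall>b. b \<notin> {..<?c - 1} <+> P \<longrightarrow> e b = 0}"
      and eq: "\<phi> e = \<phi> e'"
    \<comment> \<open>Applying the generators of block \<open>j\<close> to the image returns
      \<open>g j * \<delta> e j\<close>, from which \<open>g j\<close> is cancelled; with
      \<open>\<delta>\<close> known, the second coordinate determines \<open>\<kappa>\<close> after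
      cancelling \<open>G j\<close>.\<close>
    have \<delta>: "\<delta> e j = \<delta> e' j" if j: "j \<in> J" for j
      using comb[OF j, of e] comb[OF j, of e'] mpoly_mult_left_cancel[OF _ g_nonzero[OF j]] unfolding eq by metis
    have \<kappa>: "\<kappa> e j = \<kappa> e' j" if j: "j \<in> J" for j
    proof -
      have "\<delta> e j * v j - \<kappa> e j * G j = \<delta> e' j * v j - \<kappa> e' j * G j"
        using CZ\<phi>[OF j, of e] CZ\<phi>[OF j, of e'] unfolding eq by simp
      then have "G j * \<kappa> e j = G j * \<kappa> e' j" unfolding \<delta>[OF j] by (simp add: mult.commute)
      then show ?thesis by (rule mpoly_mult_left_cancel[OF _ G_nonzero[OF j]])
    qed
    show "e b = e' b"
    proof (cases b)
      case (Inl i)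
      show ?thesis
      proof (cases "i < ?c - 1")
        case True
        then have "i < ?c" by simp
        then show ?thesis using \<delta>[OF idx_en(2), of i] en_last[OF True] idx_en(1)[of i] Inl by (simp add: \<delta>_def)
      next
        case False
        then have "b \<notin> {..<?c - 1} <+> P" using Inl by auto
        then show ?thesis using e by simp
      qed
    next
      case (Inr p)
      show ?thesis
      proof (cases "p \<in> P")
        case True
        then show ?thesis using \<kappa>[of "Inl p"] Inr by (simp add: \<kappa>_def InlI)
      next
        case False
        then have "b \<notin> {..<?c - 1} <+> P" using Inr by auto
        then show ?thesis using e by simp
      qed
    qed
  qed

  \<comment> \<open>Exactness in the middle\<close>
  have exact1: "\<epsilon> (\<phi> e) = 0" for e
  proof -
    have "\<epsilon> (\<phi> e) = (\<Sum>j\<in>J. f * \<delta> e j)"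
      unfolding \<epsilon>_def
    proof (rule sum.cong[OF refl])
      fix j assume j: "j \<in> J"
      show "(CX (\<phi> e) j * G j + CZ (\<phi> e) j * G' j) * F j = f * \<delta> e j"
        unfolding comb[OF j] f_eq[OF j] by (simp only: mult_ac)
    qed
    then show ?thesis by (simp add: sum\<delta> flip: sum_distrib_left)
  qed
  have exact2: "\<exists>e. (\<forall>b. b \<notin> {..<?c - 1} <+> P \<longrightarrow> e b = 0) \<and> w = \<phi> e"
    if w: "\<And>n. n \<notin> {..<?N} \<Longrightarrow> w n = 0" and w0: "\<epsilon> w = 0" for w
  proof -
    obtain d k where sum0: "(\<Sum>j\<in>J. d j) = 0" and k0: "\<And>q. k (Inr q) = 0"
      and dk: "\<And>j. j \<in> J \<Longrightarrow> CX w j = d j * u j + k j * G' j \<and> CZ w j = d j * v j - k j * G j"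
      using syzygy[OF w0[unfolded \<epsilon>_def]] by (auto simp: CZ_def)
    define e where "e = case_sum (\<lambda>i. if i < ?c - 1 then d (en i) else 0) (\<lambda>p. if p \<in> P then k (Inl p) else 0)"
    have \<delta>e: "\<delta> e j = d j" if j: "j \<in> J" for j
    proof (cases "j = last")
      case True
      have "(\<Sum>i<?c - 1. e (Inl i)) = (\<Sum>i<?c - 1. d (en i))" by (rule sum.cong) (simp_all add: e_def)
      also have "\<dots> = (\<Sum>j\<in>J - {last}. d j)" by (rule sum.reindex_bij_betw[OF bij_last])
      finally have "\<delta> e last = - (\<Sum>j\<in>J - {last}. d j)" by (simp add: \<delta>_def)
      moreover have "d last + (\<Sum>j\<in>J - {last}. d j) = 0"
        using sum0 sum.remove[OF finite_J last, of d] by simp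
      ultimately show ?thesis using True by (metis add_eq_0_iff2)
    next
      case False
      then have "idx j \<noteq> ?c - 1" using idx(1)[OF j] by (auto simp: last_def)
      then have "idx j < ?c - 1" using idx(2)[OF j] by simp
      then show ?thesis using False idx(1)[OF j] by (simp add: \<delta>_def e_def)
    qed
    have \<kappa>e: "\<kappa> e j = k j" if "j \<in> J" for j
      using that k0 by (cases j) (auto simp: \<kappa>_def e_def)
    have "w n = \<phi> e n" for n
    proof (cases "n < ?N")
      case True
      show ?thesis
      proof (cases "\<beta> n")
        case (Inl j)
        then have j: "j \<in> J" using pos_\<beta>(2)[OF True] by auto
        have "pos (Inl j) = n" using pos_\<beta>(1)[OF True] Inl by simp
        then have "w n = CX w j" by (simp add: CX_def)
        also have "\<dots> = \<delta> e j * u j + \<kappa> e j * G' j" using dk[OF j] \<delta>e[OF j] \<kappa>e[OF j] by simp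
        also have "\<dots> = \<phi> e n" using True Inl by (simp add: \<phi>_def)
        finally show ?thesis .
      next
        case (Inr p)
        then have j: "Inl p \<in> J" using pos_\<beta>(2)[OF True] by auto
        have "pos (Inr p) = n" using pos_\<beta>(1)[OF True] Inr by simp
        then have "w n = CZ w (Inl p)" by (simp add: CZ_def)
        also have "\<dots> = \<delta> e (Inl p) * v (Inl p) - \<kappa> e (Inl p) * G (Inl p)"
          using dk[OF j] \<delta>e[OF j] \<kappa>e[OF j] by simp
        also have "\<dots> = \<phi> e n" using True Inr by (simp add: \<phi>_def)
        finally show ?thesis .
      qed
    qed (use w in \<open>auto simp: \<phi>_def\<close>)
    moreover have "e b = 0" if "b \<notin> {..<?c - 1} <+> P" for b
      using that by (cases b) (auto simp: e_def)
    ultimately show ?thesis by blast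
  qed

  \<comment> \<open>Linearity of the maps\<close>
  have \<delta>_lin: "\<delta> (\<lambda>b. e b + e' b) j = \<delta> e j + \<delta> e' j" "\<delta> (\<lambda>b. p * e b) j = p * \<delta> e j" for e e' p j
    by (auto simp: \<delta>_def sum.distrib sum_distrib_left)
  have \<kappa>_lin: "\<kappa> (\<lambda>b. e b + e' b) j = \<kappa> e j + \<kappa> e' j" "\<kappa> (\<lambda>b. p * e b) j = p * \<kappa> e j" for e e' p j
    by (cases j; simp add: \<kappa>_def)+
  have CZ_lin: "CZ (\<lambda>b. e b + e' b) j = CZ e j + CZ e' j" "CZ (\<lambda>b. p * e b) j = p * CZ e j" for e e' p j
    by (cases j; simp add: CZ_def)+
  have "minimal_graded_free_resolution ({..<?c - 1} <+> P)
     (case_sum (\<lambda>_. - int (card A)) (\<lambda>p. - int (card A) - int (card (blk (Inl p))) + 2))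
     {..<?N} (\<lambda>_. - int (card A) + 1) (ideal_module Y) \<phi> \<epsilon>"
  proof (rule minimal_graded_free_resolutionI[OF _ _ _ _ _ hom\<phi> min\<phi> _ _ homY image inj exact1 exact2])
    show "\<phi> (\<lambda>b. e b + e' b) = (\<lambda>b. \<phi> e b + \<phi> e' b)" for e e'
      by (rule ext) (auto simp: \<phi>_def \<delta>_lin \<kappa>_lin algebra_simps split: sum.split)
    show "\<phi> (\<lambda>b. p * e b) = (\<lambda>b. p * \<phi> e b)" for p e
      by (rule ext) (auto simp: \<phi>_def \<delta>_lin \<kappa>_lin algebra_simps split: sum.split)
    show "\<epsilon> (\<lambda>b. w b + w' b) = \<epsilon> w + \<epsilon> w'" for w w'
      by (simp add: \<epsilon>_def CX_def CZ_lin algebra_simps flip: sum.distrib)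
    show "\<epsilon> (\<lambda>b. p * w b) = p * \<epsilon> w" for p w
      by (simp add: \<epsilon>_def CX_def CZ_lin algebra_simps sum_distrib_left)
  qed (use finite_P in \<open>auto simp: \<phi>_def\<close>)
  then show ?thesis by blast
qed

end

section \<open>Projective hyperplanes\<close>

lemma span_mem_projective_hyperplane_iff:
  assumes "v \<noteq> 0"
  shows "vec.span {v} \<in> projective_hyperplane c \<longleftrightarrow> pairing c v = 0"
proof -
  have "vec.span {v} \<in> projective_space" using assms by (auto simp: projective_space_def)
  then have "vec.span {v} \<in> projective_hyperplane c \<longleftrightarrow> (\<forall>w\<in>vec.span {v}. pairing c w = 0)"
    by (simp add: projective_hyperplane_def pairing_def)
  also have "\<dots> \<longleftrightarrow> pairing c v = 0"
    using vec.span_base[of v "{v}"] by (auto simp: vec.span_singleton pairing_smult_right)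
  finally show ?thesis .
qed

lemma projective_hyperplane_inter_subset_iff:
  "projective_hyperplane c \<inter> projective_hyperplane d \<subseteq> projective_hyperplane e
    \<longleftrightarrow> (\<forall>v. pairing c v = 0 \<longrightarrow> pairing d v = 0 \<longrightarrow> pairing e v = 0)" (is "?l \<longleftrightarrow> ?r")
proof
  assume l: ?l
  show ?r
  proof (intro allI impI)
    fix v assume "pairing c v = 0" "pairing d v = 0"
    then show "pairing e v = 0"
      using l span_mem_projective_hyperplane_iff[of v] by (cases "v = 0") (auto simp: pairing_def)
  qed
qed (auto simp: projective_hyperplane_def pairing_def)

text \<open>Forms of different hyperplanes are not proportional, so some two-by-two minor
  \<open>D\<close> of their coefficients is nonzero; Cramer's rule then gives vectors supported on
  the two columns of this minor.\<close>

lemma ex_dual_vectors: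
  assumes "c \<noteq> 0" "d \<noteq> 0" "projective_hyperplane c \<noteq> projective_hyperplane d"
  shows "\<exists>e e'. dual_vectors c d e e'"
proof -
  obtain i where i: "c $ i \<noteq> 0" using assms(1) by (auto simp: vec_eq_iff)
  have "\<exists>j. c $ i * d $ j - c $ j * d $ i \<noteq> 0"
  proof (rule ccontr)
    assume "\<not> ?thesis"
    then have "d $ j = (d $ i / c $ i) * c $ j" for j using i by (simp add: field_simps)
    then have d: "d = (d $ i / c $ i) *s c" unfolding vec_eq_iff vector_smult_component by blast
    then have k: "d $ i / c $ i \<noteq> 0" using assms(2) by (metis vec.scale_zero_left)
    have "pairing d v = (d $ i / c $ i) * pairing c v" for v
      using arg_cong[OF d, of "\<lambda>x. pairing x v"] by (simp only: pairing_smult_left)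
    then have "projective_hyperplane c = projective_hyperplane d"
      using k unfolding projective_hyperplane_def pairing_def[symmetric] by simp
    then show False using assms(3) by contradiction
  qed
  then obtain j D where D: "c $ i * d $ j - c $ j * d $ i = D" "D \<noteq> 0" by blast
  have "(d $ j / D) * c $ i - (d $ i / D) * c $ j = (c $ i * d $ j - c $ j * d $ i) / D"
    "(c $ i / D) * d $ j - (c $ j / D) * d $ i = (c $ i * d $ j - c $ j * d $ i) / D"
    by (simp_all add: diff_divide_distrib mult.commute)
  then have "dual_vectors c d ((d $ j / D) *s axis i 1 - (d $ i / D) *s axis j 1)
      ((c $ i / D) *s axis j 1 - (c $ j / D) *s axis i 1)"
    unfolding dual_vectors_def pairing_diff_right pairing_smult_right pairing_axis D(1)
    using D(2) by simp
  then show ?thesis by blast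
qed

text \<open>The left ideal is a prime of height two containing two independent forms, so by the
  height computation these generate it.\<close>

lemma ideal2_linear_forms_eq:
  assumes d: "dual_vectors u u' e e'" and d': "dual_vectors c c' y y'"
    and "linear_form c \<in> ideal2 (linear_form u) (linear_form u')"
    and "linear_form c' \<in> ideal2 (linear_form u) (linear_form u')"
  shows "ideal2 (linear_form u) (linear_form u') = ideal2 (linear_form c) (linear_form c')"
proof -
  let ?I = "ideal2 (linear_form u) (linear_form u')"
  have I: "mpoly_prime ?I" by (rule mpoly_prime_linear_forms[OF d])
  have "prime_height mpoly_ring ?I = 2"
    using prime_height_ge_2(1)[OF I d' assms(3,4)] prime_height_linear_forms_le[OF d]
    by (rule order_antisym[rotated])
  then show ?thesis by (rule prime_height_ge_2(2)[OF I d' assms(3,4)])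
qed

theorem corollary8p12:
  fixes \<A> :: "('k::field_char_0 ^ 'x::finite) set set set"
    and a :: "('k ^ 'x) set set \<Rightarrow> 'k ^ 'x"
    and \<Q> :: "('x, 'k) mpoly set set"
    and n d s :: nat
  defines "S0 \<equiv> multiple_intersections \<A>"
  assumes "CARD('x) = n + 1" and "n \<ge> 2"
    and "arrangement \<A>" and "card \<A> = d"
    and "defining_forms \<A> a"
    and "\<And>H P P'. \<lbrakk>H \<in> \<A>; P \<in> S0; P' \<in> S0; P \<subseteq> H; P' \<subseteq> H\<rbrakk> \<Longrightarrow> P = P'"
    and "s = card {H \<in> \<A>. \<not> (\<exists>P\<in>S0. P \<subseteq> H)}"
    and "primary_decomposition mpoly_ring (jacobian_ideal (defining_polynomial \<A> a)) \<Q>"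
  shows "\<exists>\<phi> \<epsilon>. minimal_graded_free_resolution
           ({..<card S0 + s - 1} <+> S0)
           (case_sum (\<lambda>_. - int d) (\<lambda>P. - int d - int (multiplicity_at \<A> P) + 2))
           {..<2 * card S0 + s}
           (\<lambda>_. - int d + 1)
           (ideal_module (top_part mpoly_ring \<Q>)) \<phi> \<epsilon>"
proof -
  note uniq = assms(7)
  have fin: "finite \<A>" and ne: "\<A> \<noteq> {}" using assms(4) by (auto simp: arrangement_def)
  have a: "a H \<noteq> 0" "H = projective_hyperplane (a H)" if "H \<in> \<A>" for H
    using assms(6) that by (auto simp: defining_forms_def)
  let ?l = "\<lambda>H. linear_form (a H)"
  have dual: "\<exists>e e'. dual_vectors (a H) (a K) e e'" if "H \<in> \<A>" "K \<in> \<A>" "H \<noteq> K" for H K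
    using ex_dual_vectors a that by metis
  have mem_iff: "?l L \<in> ideal2 (?l H) (?l K) \<longleftrightarrow> H \<inter> K \<subseteq> L"
    if "H \<in> \<A>" "K \<in> \<A>" "H \<noteq> K" "L \<in> \<A>" for H K L
  proof -
    obtain e e' where "dual_vectors (a H) (a K) e e'" using dual \<open>H \<in> \<A>\<close> \<open>K \<in> \<A>\<close> \<open>H \<noteq> K\<close> by blast
    then have "?l L \<in> ideal2 (?l H) (?l K) \<longleftrightarrow>
        projective_hyperplane (a H) \<inter> projective_hyperplane (a K) \<subseteq> projective_hyperplane (a L)"
      by (simp only: linear_form_mem_ideal2_iff projective_hyperplane_inter_subset_iff)
    then show ?thesis using a(2) that by metis
  qed
  define Fr where "Fr = {H \<in> \<A>. \<not> (\<exists>P\<in>S0. P \<subseteq> H)}"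
  \<comment> \<open>Pencils are indexed by their centres and the remaining hyperplanes by
    themselves, so that there are \<open>card S0 + s\<close> blocks.\<close>
  define blk where "blk = case_sum (\<lambda>P. {H \<in> \<A>. P \<subseteq> H}) (\<lambda>H. {H})"
  have S0: "\<exists>H K. H \<in> \<A> \<and> K \<in> \<A> \<and> H \<noteq> K \<and> P = H \<inter> K" "card {H \<in> \<A>. P \<subseteq> H} \<ge> 3" if "P \<in> S0" for P
    using that by (auto simp: S0_def multiple_intersections_def intersections_def multiplicity_at_def)
  have "S0 \<subseteq> (\<lambda>(H, K). H \<inter> K) ` (\<A> \<times> \<A>)" using S0(1) by fast
  then have finS0: "finite S0" using fin finite_subset by blast
  \<comment> \<open>This is where the pencils are disconnected: a hyperplane contains at most one
    centre, and it forms a block of its own only if it contains none.\<close>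
  have blk_unique: "i = j" if "i \<in> S0 <+> Fr" "j \<in> S0 <+> Fr" "H \<in> blk i" "H \<in> blk j" for i j H
  proof -
    have "(\<exists>P\<in>S0. k = Inl P \<and> H \<in> \<A> \<and> P \<subseteq> H) \<or> k = Inr H \<and> H \<in> Fr"
      if "k \<in> S0 <+> Fr" "H \<in> blk k" for k
      using that by (auto simp: blk_def)
    from this[OF that(1,3)] this[OF that(2,4)] show ?thesis
      using uniq[of H] unfolding Fr_def by blast
  qed
  interpret disconnected_pencils S0 Fr blk \<A> a
  proof
    show "finite S0" "finite Fr" "finite \<A>" using finS0 fin by (auto simp: Fr_def)
    have cover: "\<exists>j\<in>S0 <+> Fr. H \<in> blk j" if "H \<in> \<A>" for H
    proof (cases "\<exists>P\<in>S0. P \<subseteq> H")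
      case True
      then obtain P where "P \<in> S0" "P \<subseteq> H" by blast
      then show ?thesis using that by (intro bexI[of _ "Inl P"]) (auto simp: blk_def)
    next
      case False
      then show ?thesis using that by (intro bexI[of _ "Inr H"]) (auto simp: blk_def Fr_def)
    qed
    then show "S0 <+> Fr \<noteq> {}" using ne by blast
    have "blk j \<subseteq> \<A>" if "j \<in> S0 <+> Fr" for j using that by (auto simp: blk_def Fr_def)
    then show "\<A> = \<Union>(blk ` (S0 <+> Fr))" using cover by blast
    show "blk i \<inter> blk j = {}" if "i \<in> S0 <+> Fr" "j \<in> S0 <+> Fr" "i \<noteq> j" for i j
      using blk_unique that by blast
    show "2 \<le> card (blk (Inl P))" if "P \<in> S0" for P using S0(2)[OF that] by (simp add: blk_def)
    show "\<exists>K. blk (Inr H) = {K}" if "H \<in> Fr" for H by (simp add: blk_def)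
    show "a H \<noteq> 0" if "H \<in> \<A>" for H by (rule a(1)[OF that])
    show "\<exists>e e'. dual_vectors (a H) (a K) e e'" if "H \<in> \<A>" "K \<in> \<A>" "H \<noteq> K" for H K
      by (rule dual[OF that])
  next
    fix j H K L
    assume j: "j \<in> S0 <+> Fr" and HK: "H \<in> blk j" "K \<in> blk j" "H \<noteq> K" and L: "L \<in> \<A>"
    obtain P where P: "j = Inl P" "P \<in> S0" using j HK by (auto simp: blk_def)
    \<comment> \<open>\<open>P\<close> is given as the intersection of some pair \<open>H1\<close>,
      \<open>H2\<close>, whereas \<open>H\<close>, \<open>K\<close> are arbitrary members of the
      pencil; both pairs generate the same ideal.\<close>
    then obtain H1 H2 where H12: "H1 \<in> \<A>" "H2 \<in> \<A>" "H1 \<noteq> H2" "P = H1 \<inter> H2" using S0(1) by blast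
    have HK': "H \<in> \<A>" "K \<in> \<A>" "P \<subseteq> H" "P \<subseteq> K" using HK P by (auto simp: blk_def)
    obtain e e' y y' where "dual_vectors (a H1) (a H2) e e'" "dual_vectors (a H) (a K) y y'"
      using dual H12 HK HK' by metis
    moreover have "?l H \<in> ideal2 (?l H1) (?l H2)" "?l K \<in> ideal2 (?l H1) (?l H2)"
      using mem_iff[OF H12(1-3)] HK' H12(4) by blast+
    ultimately have "ideal2 (?l H1) (?l H2) = ideal2 (?l H) (?l K)" by (rule ideal2_linear_forms_eq)
    then have "?l L \<in> ideal2 (?l H) (?l K) \<longleftrightarrow> P \<subseteq> L" using mem_iff[OF H12(1-3) L] H12(4) by simp
    then show "?l L \<in> ideal2 (?l H) (?l K) \<longleftrightarrow> L \<in> blk j" using P L by (simp add: blk_def)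
  next
    fix i j H K L
    assume ij: "i \<in> S0 <+> Fr" "j \<in> S0 <+> Fr" "i \<noteq> j" "H \<in> blk i" "K \<in> blk j" and L: "L \<in> \<A>"
    then have HK: "H \<in> \<A>" "K \<in> \<A>" by (auto simp: blk_def Fr_def)
    have HK3: "H \<noteq> K" using blk_unique ij by blast
    \<comment> \<open>A third hyperplane through \<open>H \<inter> K\<close> would make this
      intersection an element of \<open>S0\<close>, and \<open>H\<close> and \<open>K\<close> would
      lie in the same pencil.\<close>
    have "L = H \<or> L = K" if sub: "H \<inter> K \<subseteq> L"
    proof (rule ccontr)
      assume "\<not> ?thesis"
      then have "card {H, K, L} = 3" using HK3 by (subst card_3_iff) metis
      moreover have "card {H, K, L} \<le> card {M \<in> \<A>. H \<inter> K \<subseteq> M}"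
        using fin HK L sub by (intro card_mono) auto
      ultimately have "H \<inter> K \<in> S0"
        using HK HK3 by (auto simp: S0_def multiple_intersections_def intersections_def multiplicity_at_def)
      then have "Inl (H \<inter> K) \<in> S0 <+> Fr" "H \<in> blk (Inl (H \<inter> K))" "K \<in> blk (Inl (H \<inter> K))"
        using HK by (auto simp: blk_def)
      then show False using blk_unique ij by blast
    qed
    then show "?l L \<in> ideal2 (?l H) (?l K) \<longleftrightarrow> L = H \<or> L = K"
      using mem_iff[OF HK HK3 L] by blast
  qed
  obtain G G' u v where "disconnected_pencils_jacobian S0 Fr blk \<A> a G G' u v"
    using ex_jacobian by blast
  then interpret J: disconnected_pencils_jacobian S0 Fr blk \<A> a G G' u v .
  have "defining_polynomial \<A> a = f" by (simp add: defining_polynomial_def f_def)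
  then have "top_part mpoly_ring \<Q> = J.Y" using assms(9) by (intro J.top_part_eq) simp
  moreover have "card (blk (Inl P)) = multiplicity_at \<A> P" for P
    by (simp add: blk_def multiplicity_at_def)
  moreover have "card Fr = s" using assms(8) by (simp add: Fr_def)
  ultimately show ?thesis using J.minimal_resolution assms(5) by simp
qed

end
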